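(* Let $\varepsilon>0$. Then for almost all $\alpha\in(0,1)$ (with respect to Lebesgue measure) we have $$N D_N^*(\{n_1\alpha\},\dots,\{n_N\alpha\})=\mathcal{O}\left(N^{1+\frac{\log\lambda}{\log 2}+\varepsilon}\right)\quad\text{as } N\to\infty,$$ and $$N D_N^*(\{n_1\alpha\},\dots,\{n_N\alpha\})\ge N^{1+\frac{\log\lambda}{\log 2}-\varepsilon}$$ for infinitely many $N$.
   Context: $(n_k)_{k\ge1}$ denotes the Thue--Morse integers: the non-negative integers with even binary digit sum, in increasing order, $(0,3,5,6,9,10,12,\dots)$. $\{x\}$ denotes the fractional part. For $x_1,\dots,x_N\in[0,1]$ the star-discrepancy is $D_N^*(x_1,\dots,x_N)=\sup_{a\in[0,1]}\left|\frac1N\#\{n\le N: x_n\in[0,a]\}-a\right|$. The constant $\lambda$ is defined by the asymptotic relation (due to Fouvry and Mauduit) $\int_0^1\prod_{\ell=0}^{L-1}|\sin\pi 2^\ell\alpha|\,d\alpha=\kappa\lambda^L(1+o(1))$ as $L\to\infty$, with constants $\kappa>0$ and $\lambda$; it satisfies $0.66130<\lambda<0.66135$. *)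

theory Defs
  imports "HOL-Analysis.Analysis" "HOL-Library.Landau_Symbols" "HOL-Library.Infinite_Set"
begin

fun binary_digit_sum :: "nat \<Rightarrow> nat" where
  "binary_digit_sum n = (if n = 0 then 0 else n mod 2 + binary_digit_sum (n div 2))"

declare binary_digit_sum.simps [simp del]

definition thue_morse_set :: "nat set" where
  "thue_morse_set = {n. even (binary_digit_sum n)}"

text \<open>The sequence is indexed from 1, whereas \<^const>\<open>Infinite_Set.enumerate\<close> starts at 0.\<close>

definition thue_morse_int :: "nat \<Rightarrow> nat" where
  "thue_morse_int k = Infinite_Set.enumerate thue_morse_set (k - 1)"

lemma infinite_thue_morse_set: "infinite thue_morse_set"
proof -
  have "m \<in> thue_morse_set \<or> 2 ^ Suc m + m \<in> thue_morse_set" for m :: nat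
  proof -
    have *: "binary_digit_sum (2 ^ k + r) = Suc (binary_digit_sum r)" if "r < 2 ^ k" for k r :: nat
      using that
    proof (induction k arbitrary: r)
      case 0
      then show ?case
        by (simp add: binary_digit_sum.simps[of "Suc 0"] binary_digit_sum.simps[of 0])
    next
      case (Suc k)
      have "(2 ^ Suc k + r) div 2 = 2 ^ k + r div 2" by simp
      moreover have "binary_digit_sum (2 ^ k + r div 2) = Suc (binary_digit_sum (r div 2))"
        using Suc.prems by (intro Suc.IH) auto
      ultimately have "binary_digit_sum (2 ^ Suc k + r) = r mod 2 + Suc (binary_digit_sum (r div 2))"
        by (subst binary_digit_sum.simps) simp
      also have "\<dots> = Suc (binary_digit_sum r)"
        using binary_digit_sum.simps[of r] binary_digit_sum.simps[of 0] by (cases "r = 0") auto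
      finally show ?case .
    qed
    have "m < 2 ^ Suc m" by (meson less_exp lessI order_less_trans)
    from *[OF this] show ?thesis by (auto simp: thue_morse_set_def)
  qed
  then show ?thesis
    unfolding infinite_nat_iff_unbounded_le
    using le_add2 by blast
qed

lemma strict_mono_on_thue_morse_int: "strict_mono_on {1..} thue_morse_int"
proof (rule strict_mono_onI)
  fix r s :: nat assume "r \<in> {1..}" "r < s"
  then have "r - 1 < s - 1" by simp
  then show "thue_morse_int r < thue_morse_int s"
    unfolding thue_morse_int_def by (intro enumerate_mono infinite_thue_morse_set)
qed

lemma thue_morse_int_image: "thue_morse_int ` {1..} = thue_morse_set"
proof -
  have "thue_morse_int ` {1..} = thue_morse_int ` range Suc"
    by (simp add: greaterThan_0[symmetric] atLeast_Suc_greaterThan)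
  also have "\<dots> = range (Infinite_Set.enumerate thue_morse_set)"
    by (simp add: image_image thue_morse_int_def)
  also have "\<dots> = thue_morse_set"
    by (rule range_enumerate[OF infinite_thue_morse_set])
  finally show ?thesis .
qed

definition star_discrepancy :: "(nat \<Rightarrow> real) \<Rightarrow> nat \<Rightarrow> real" where
  "star_discrepancy x N =
     (SUP a\<in>{0..1}. \<bar>real (card {n \<in> {1..N}. x n \<in> {0..a}}) / real N - a\<bar>)"

definition sine_product_integral :: "nat \<Rightarrow> real" where
  "sine_product_integral L = integral {0..1} (\<lambda>\<alpha>. \<Prod>l<L. \<bar>sin (pi * 2 ^ l * \<alpha>)\<bar>)"

definition fouvry_mauduit_const :: real where
  "fouvry_mauduit_const =
     (THE c. \<exists>\<kappa>>0. sine_product_integral \<sim>[at_top] (\<lambda>L. \<kappa> * c ^ L))"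

text \<open>At most one real number satisfies the defining relation, since \<open>c\<close> is the limit of the ratios
  of consecutive integrals. That it is satisfied by some number is a theorem of Fouvry and
  Mauduit, which is not assumed anywhere.\<close>

lemma asymp_equiv_geometric_ratio:
  fixes f :: "nat \<Rightarrow> real" and c k :: real
  assumes "k > 0" "c \<noteq> 0" "f \<sim>[at_top] (\<lambda>L. k * c ^ L)"
  shows "(\<lambda>L. f (Suc L) / f L) \<longlonglongrightarrow> c"
proof -
  have "(\<lambda>L. f (Suc L)) \<sim>[at_top] (\<lambda>L. k * c ^ Suc L)"
    using asymp_equiv_compose'[OF assms(3) filterlim_Suc] .
  then have "(\<lambda>L. f (Suc L) / f L) \<sim>[at_top] (\<lambda>L. (k * c ^ Suc L) / (k * c ^ L))"
    using assms(3) by (intro asymp_equiv_intros)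
  also have "(\<lambda>L. (k * c ^ Suc L) / (k * c ^ L)) = (\<lambda>_. c)"
    using assms(1,2) by auto
  finally show ?thesis using asymp_equivD_const assms(2) by blast
qed

lemma sine_product_integral_pos: "sine_product_integral L > 0"
proof -
  let ?f = "\<lambda>\<alpha>::real. \<Prod>l<L. \<bar>sin (pi * 2 ^ l * \<alpha>)\<bar>"
  have cont: "continuous_on {0..1} ?f" by (intro continuous_intros)
  have nn: "?f x \<ge> 0" for x by (intro prod_nonneg) auto
  have "sine_product_integral L \<noteq> 0"
  proof
    assume "sine_product_integral L = 0"
    then have z: "\<And>x. x \<in> {0..1} \<Longrightarrow> ?f x = 0"
      using integral_eq_0_iff[OF cont _ nn] by (auto simp: sine_product_integral_def)
    define x :: real where "x = 1 / 2 ^ Suc L"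
    have "x \<in> {0..1}"
      using one_le_power[of "2::real" "Suc L"] by (simp add: x_def divide_le_eq)
    moreover have "?f x > 0"
    proof (intro prod_pos)
      fix l assume "l \<in> {..<L}"
      then have "(2::real) ^ l < 2 ^ Suc L" by (intro power_strict_increasing) auto
      then have "pi * 2 ^ l * x > 0" "pi * 2 ^ l * x < pi" by (auto simp: x_def field_simps)
      then show "\<bar>sin (pi * 2 ^ l * x)\<bar> > 0" using sin_gt_zero[of "pi * 2 ^ l * x"] by simp
    qed
    ultimately show False using z[of x] by simp
  qed
  moreover have "sine_product_integral L \<ge> 0"
    unfolding sine_product_integral_def
    using nn by (intro integral_nonneg integrable_continuous_real cont) auto
  ultimately show ?thesis by simp
qed

lemma fouvry_mauduit_const_eqI:
  assumes "\<kappa> > 0" "sine_product_integral \<sim>[at_top] (\<lambda>L. \<kappa> * c ^ L)"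
  shows "fouvry_mauduit_const = c"
proof -
  have nz: "d \<noteq> 0" if "sine_product_integral \<sim>[at_top] (\<lambda>L. k * d ^ L)" for d k :: real
  proof
    assume "d = 0"
    have "eventually (\<lambda>L. k * d ^ L = 0) at_top"
      using eventually_gt_at_top[of 0] \<open>d = 0\<close> by (auto elim: eventually_mono)
    moreover have "eventually (\<lambda>L. sine_product_integral L = 0 \<longleftrightarrow> k * d ^ L = 0) at_top"
      using asymp_equiv_eventually_zeros[OF that] .
    ultimately have "eventually (\<lambda>L::nat. False) at_top"
      by eventually_elim (metis order_less_irrefl sine_product_integral_pos)
    then show False by simp
  qed
  show ?thesis unfolding fouvry_mauduit_const_def
  proof (rule the_equality)
    fix d assume "\<exists>k>0. sine_product_integral \<sim>[at_top] (\<lambda>L. k * d ^ L)"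
    then obtain k where k: "k > 0" "sine_product_integral \<sim>[at_top] (\<lambda>L. k * d ^ L)" by blast
    show "d = c"
      by (rule LIMSEQ_unique[OF asymp_equiv_geometric_ratio[OF k(1) nz[OF k(2)] k(2)]
            asymp_equiv_geometric_ratio[OF assms(1) nz[OF assms(2)] assms(2)]])
  qed (use assms in blast)
qed

end

theory Submission
  imports Defs "HOL-Real_Asymp.Real_Asymp" "HOL-Computational_Algebra.Primes"
begin

text \<open>
  Write \<open>e(x) = exp(2\<pi>ix)\<close>, \<open>s(n)\<close> for the binary digit sum, and
  \<open>F\<^sub>L(x) = \<bar>\<Sum>n<2\<^sup>L. (-1)\<^sup>s\<^sup>(\<^sup>n\<^sup>) e(nx)\<bar> = \<Prod>l<L. \<bar>2 sin(\<pi>2\<^sup>lx)\<bar>\<close>.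

  The integral of the sine product over \<open>L\<close> factors is the integral of \<open>T\<^sup>L 1\<close> for the transfer operator
  \<open>T f(x) = (sin(\<pi>x/2) f(x/2) + cos(\<pi>x/2) f((x+1)/2)) / 2\<close>. The oscillation of \<open>T\<^sup>n\<^sup>+\<^sup>1 1 / T\<^sup>n 1\<close>, combined
  with a Lipschitz constant, contracts geometrically over blocks of iterations, which gives the asymptotic
  \<open>\<kappa> \<lambda>\<^sup>L\<close>; moreover \<open>T\<^sup>2 1 \<ge> 7/20\<close> gives \<open>2\<lambda> > 1\<close>, so that the exponent is positive.

  Upper bound: the indicator of the Thue--Morse integers is \<open>(1 + (-1)\<^sup>s\<^sup>(\<^sup>n\<^sup>))/2\<close>. By an Erdos--Turan inequality
  the discrepancy is at most a sum over \<open>h\<close> of \<open>1/h\<close> times exponential sums at \<open>hx\<close>, which decompose into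
  dyadic blocks. Their integrals do not depend on \<open>h\<close>, and Borel--Cantelli applies.

  Lower bound: for some level \<open>T\<close> the set \<open>{F\<^sub>L \<ge> T}\<close> has measure \<open>\<mu>\<close> with \<open>T\<mu>\<close> within a factor \<open>O(L)\<close> of the integral
  of \<open>F\<^sub>L\<close>. A second moment estimate, in which the number of divisors enters, shows that almost every \<open>x\<close> has
  a multiple \<open>hx\<close> in this set with \<open>h \<le> 2\<^sup>\<delta>\<^sup>L/\<mu>\<close>, up to rounding. Koksma's inequality with frequency \<open>h\<close> then bounds the
  discrepancy from below by about \<open>T/h\<close>, since the untwisted sum at \<open>hx\<close> is almost surely negligible.
\<close>

section \<open>The transfer operator of the sine product\<close>

text \<open>The weight of one branch of \<open>transfer\<close> vanishes at 0 and that of the other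
  at 1, so contraction cannot rest on a positive lower bound for the weights. A minorisation
  replaces it: after one step away from the endpoints, the iterates see a point within 2^-k of any
  prescribed point, with a weight depending only on k. A Lipschitz bound relative to the supremum
  makes the nearby point as good as the prescribed one.

  The lower bound cannot be read off at x itself. The logarithm of F_L(x) is a Birkhoff sum of log|2
  sin(pi x)|, which has mean 0, so F_L(x) is almost surely subexponential in L, whereas its integral
  grows like (2\<lambda>)^L and is carried by a set of small measure. About 1/\<mu> multiples of x
  are needed to hit that set, and the loss of a factor h in Koksma's inequality returns T\<mu>,
  essentially the integral; hence both bounds meet at the same exponent. The points hx are not
  independent: they are correlated through the coincidences h m = h' m' of frequencies, which the
  divisor function counts. Losses of powers of L and of small powers of 2^L disappear in
  \<epsilon>.\<close>

lemma integral_affine: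
  fixes f :: "real \<Rightarrow> 'b::euclidean_space"
  assumes "f integrable_on {a..b}" "m > 0"
  shows "integral {(a - c) / m..(b - c) / m} (\<lambda>x. f (m * x + c)) = integral {a..b} f /\<^sub>R m"
proof -
  have "(f has_integral integral {a..b} f) (cbox a b)"
    using assms by (simp add: has_integral_integral)
  from has_integral_affinity'[OF this \<open>m > 0\<close>, of c] show ?thesis
    by (intro integral_unique) (simp add: divide_inverse_commute)
qed

lemma abs_sin_add_npi: "\<bar>sin (x + real n * pi)\<bar> = \<bar>sin x\<bar>"
  by (cases "even n") (auto simp: sin_add sin_npi cos_npi)

lemma abs_sin_diff_le: "\<bar>sin x - sin y\<bar> \<le> \<bar>x - y\<bar>" for x y :: real
proof -
  have "\<bar>sin x - sin y\<bar> = 2 * (\<bar>sin ((x - y) / 2)\<bar> * \<bar>cos ((x + y) / 2)\<bar>)"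
    by (simp add: sin_diff_sin abs_mult)
  also have "\<dots> \<le> 2 * (\<bar>(x - y) / 2\<bar> * 1)"
    by (intro mult_left_mono mult_mono abs_sin_x_le_abs_x) auto
  finally show ?thesis by simp
qed

lemma abs_cos_diff_le: "\<bar>cos x - cos y\<bar> \<le> \<bar>x - y\<bar>" for x y :: real
  using abs_sin_diff_le[of "x + pi / 2" "y + pi / 2"] by (simp add: sin_add)

definition sine_product :: "nat \<Rightarrow> real \<Rightarrow> real" where
  "sine_product L x = (\<Prod>l<L. \<bar>sin (pi * 2 ^ l * x)\<bar>)"

lemma sine_product_0 [simp]: "sine_product 0 x = 1"
  by (simp add: sine_product_def)

lemma sine_product_Suc: "sine_product (Suc L) x = \<bar>sin (pi * x)\<bar> * sine_product L (2 * x)"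
  unfolding sine_product_def prod.lessThan_Suc_shift by (simp add: mult_ac)

lemma sine_product_add_1: "sine_product L (x + 1) = sine_product L x"
proof -
  have "\<bar>sin (pi * 2 ^ l * (x + 1))\<bar> = \<bar>sin (pi * 2 ^ l * x)\<bar>" for l
    using abs_sin_add_npi[of "pi * 2 ^ l * x" "2 ^ l"] by (simp add: algebra_simps)
  then show ?thesis by (simp add: sine_product_def)
qed

lemma continuous_on_sine_product [continuous_intros]:
  fixes g :: "real \<Rightarrow> real"
  shows "continuous_on A g \<Longrightarrow> continuous_on A (\<lambda>x. sine_product L (g x))"
  unfolding sine_product_def
  by (intro continuous_intros)

lemma sine_product_integral_altdef: "sine_product_integral L = integral {0..1} (sine_product L)"
  unfolding sine_product_integral_def sine_product_def by simp

text \<open>Adjoint, under the integral over [0,1], of f(x) -> |sin(pi x)| f(2x). The arguments x/2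
  and (x+1)/2 are the preimages of x under doubling, the weights are the values of |sin(pi y)|
  there, written without absolute values because both are nonnegative for x in [0,1], and 1/2 is the
  Jacobian.\<close>

definition transfer :: "(real \<Rightarrow> real) \<Rightarrow> real \<Rightarrow> real" where
  "transfer f x = (sin (pi * x / 2) * f (x / 2) + cos (pi * x / 2) * f ((x + 1) / 2)) / 2"

lemma continuous_on_transfer:
  assumes "continuous_on {0..1} f"
  shows "continuous_on {0..1} (transfer f)"
  unfolding transfer_def
  by (intro continuous_intros continuous_on_compose2[OF assms]) auto

text \<open>The integral is split at 1/2 and each half is substituted through its inverse branch; by
  1-periodicity both halves carry the same remaining factor \<open>sine_product L x\<close>. Each
  use trades one sine factor for one application of the operator.\<close>

lemma transfer_duality:
  assumes f: "continuous_on {0..1} f"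
  shows "integral {0..1} (\<lambda>x. f x * sine_product (Suc L) x)
       = integral {0..1} (\<lambda>x. transfer f x * sine_product L x)"
proof -
  define g where "g = (\<lambda>x. f x * sine_product (Suc L) x)"
  have g: "continuous_on {0..1} g" unfolding g_def by (intro continuous_intros f)
  have gi: "g integrable_on {a..b}" if "0 \<le> a" "b \<le> 1" for a b
    by (rule integrable_continuous_real, rule continuous_on_subset[OF g]) (use that in auto)
  have "transfer f x * sine_product L x = (g (1 / 2 * x + 0) + g (1 / 2 * x + 1 / 2)) / 2"
    if x: "x \<in> {0..1}" for x
  proof -
    have s: "sin (pi * x / 2) \<ge> 0" "cos (pi * x / 2) \<ge> 0"
      using x mult_left_le[of x pi] by (auto intro!: sin_ge_zero cos_ge_zero simp: divide_le_eq intro: order.trans[of _ 0])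
    have 1: "g (x / 2) = f (x / 2) * sin (pi * x / 2) * sine_product L x"
      using s by (simp add: g_def sine_product_Suc)
    have "sin (pi * ((x + 1) / 2)) = cos (pi * x / 2)"
      by (simp add: sin_add algebra_simps add_divide_distrib)
    moreover have "sine_product L (2 * ((x + 1) / 2)) = sine_product L x"
      using sine_product_add_1[of L x] by (simp only: nonzero_mult_div_cancel_left times_divide_eq_right zero_neq_numeral not_False_eq_True)
    ultimately have 2: "g ((x + 1) / 2) = f ((x + 1) / 2) * cos (pi * x / 2) * sine_product L x"
      unfolding g_def sine_product_Suc using s by simp
    show ?thesis using 1 2 by (simp add: transfer_def algebra_simps add_divide_distrib)
  qed
  then have "integral {0..1} (\<lambda>x. transfer f x * sine_product L x)
      = integral {0..1} (\<lambda>x. (g (1 / 2 * x + 0) + g (1 / 2 * x + 1 / 2)) / 2)"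
    by (intro integral_cong) auto
  also have "\<dots> = (integral {0..1} (\<lambda>x. g (1 / 2 * x + 0))
      + integral {0..1} (\<lambda>x. g (1 / 2 * x + 1 / 2))) / 2"
    by (subst integral_divide, subst Henstock_Kurzweil_Integration.integral_add)
       (auto intro!: integrable_continuous_real continuous_intros continuous_on_compose2[OF g])
  also have "integral {0..1} (\<lambda>x. g (1 / 2 * x + 0)) = 2 * integral {0..1 / 2} g"
    using integral_affine[OF gi[of 0 "1/2"], of "1/2" 0] by simp
  also have "integral {0..1} (\<lambda>x. g (1 / 2 * x + 1 / 2)) = 2 * integral {1 / 2..1} g"
    using integral_affine[OF gi[of "1/2" 1], of "1/2" "1/2"] by simp
  also have "(2 * integral {0..1 / 2} g + 2 * integral {1 / 2..1} g) / 2 = integral {0..1} g"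
    using Henstock_Kurzweil_Integration.integral_combine[of 0 "1/2" 1 g] gi[of 0 1] by simp
  finally show ?thesis by (simp add: g_def)
qed

lemma half_angle_bounds:
  assumes "x \<in> {0..1}"
  shows "sin (pi * x / 2) \<ge> 0" "cos (pi * x / 2) \<ge> 0" "sin (pi * x / 2) \<le> 1" "cos (pi * x / 2) \<le> 1"
    "sin (pi * x / 2) + cos (pi * x / 2) \<ge> 1" "sin (pi * x / 2) + cos (pi * x / 2) \<le> 3 / 2"
proof -
  let ?s = "sin (pi * x / 2)" and ?c = "cos (pi * x / 2)"
  show s: "?s \<ge> 0" and c: "?c \<ge> 0"
    using assms mult_left_le[of x pi] by (auto intro!: sin_ge_zero cos_ge_zero simp: divide_le_eq intro: order.trans[of _ 0])
  show s1: "?s \<le> 1" and c1: "?c \<le> 1" by auto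
  have sq: "?s\<^sup>2 + ?c\<^sup>2 = 1" by simp
  have "?s\<^sup>2 \<le> ?s" "?c\<^sup>2 \<le> ?c" using s c s1 c1 by (simp_all add: power2_eq_square mult_left_le)
  then show "?s + ?c \<ge> 1" using sq by linarith
  \<comment> \<open>The value 3/2 stands in for sqrt 2. It produces the Lipschitz factor 3/8 below,
    and any factor below 1/2 survives the possible halving of the supremum in one step.\<close>
  have "(?s + ?c)\<^sup>2 \<le> (3 / 2)\<^sup>2"
    using sq zero_le_power2[of "?s - ?c"] by (simp add: power2_sum power2_diff power_divide)
  then show "?s + ?c \<le> 3 / 2" by (rule power2_le_imp_le) simp
qed

lemma transfer_mono:
  assumes "\<And>x. x \<in> {0..1} \<Longrightarrow> f x \<le> g x" "x \<in> {0..1}"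
  shows "transfer f x \<le> transfer g x"
  unfolding transfer_def using assms half_angle_bounds(1,2)[OF assms(2)]
  by (intro divide_right_mono add_mono mult_left_mono) auto

lemma transfer_diff_scale: "transfer (\<lambda>y. f y - c * g y) x = transfer f x - c * transfer g x"
  by (simp add: transfer_def algebra_simps diff_divide_distrib add_divide_distrib)

lemma transfer_scale: "transfer (\<lambda>y. c * g y) x = c * transfer g x"
  by (simp add: transfer_def algebra_simps add_divide_distrib)

lemma transfer_pow_scale: "(transfer ^^ n) (\<lambda>y. c * g y) = (\<lambda>x. c * (transfer ^^ n) g x)"
proof (induction n)
  case (Suc n)
  then show ?case by (auto simp: transfer_scale)
qed simp

lemma transfer_pow_mono:
  assumes "\<And>x. x \<in> {0..1} \<Longrightarrow> f x \<le> g x" "x \<in> {0..1}"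
  shows "(transfer ^^ n) f x \<le> (transfer ^^ n) g x"
  using assms(2) by (induction n arbitrary: x) (auto intro: assms(1) transfer_mono)

lemma transfer_pow_diff_scale:
  "(transfer ^^ n) (\<lambda>y. f y - c * g y) = (\<lambda>x. (transfer ^^ n) f x - c * (transfer ^^ n) g x)"
proof (induction n)
  case (Suc n)
  then show ?case by (auto simp: transfer_diff_scale)
qed simp

lemma transfer_nonneg:
  assumes "\<And>x. x \<in> {0..1} \<Longrightarrow> 0 \<le> f x" "x \<in> {0..1}"
  shows "0 \<le> transfer f x"
  using transfer_mono[of "\<lambda>_. 0" f x] assms by (simp add: transfer_def)

lemma transfer_const_bounds:
  assumes "x \<in> {0..1}"
  shows "transfer (\<lambda>_. 1) x \<ge> 1 / 2" "transfer (\<lambda>_. 1) x \<le> 3 / 4"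
  using half_angle_bounds[OF assms] by (auto simp: transfer_def)

text \<open>A Doeblin-Fortet inequality. The branches halve distances and the weights sum to at most
  3/2, so the old constant is multiplied by at most 3/2 * 1/2 * 1/2 = 3/8; the two weights, each
  varying at rate at most pi/2, add pi/2 times the bound of f.\<close>

lemma transfer_lipschitz:
  assumes f: "C-lipschitz_on {0..1} f" and b: "\<And>x. x \<in> {0..1} \<Longrightarrow> \<bar>f x\<bar> \<le> B"
  shows "(3 / 8 * C + pi / 2 * B)-lipschitz_on {0..1} (transfer f)"
proof (rule lipschitz_onI)
  have B0: "B \<ge> 0" using b[of 0] by auto
  have C0: "C \<ge> 0" using f by (rule lipschitz_on_nonneg)
  show "0 \<le> 3 / 8 * C + pi / 2 * B" using B0 C0 by simp
  fix x y :: real assume x: "x \<in> {0..1}" and y: "y \<in> {0..1}"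
  let ?s = "\<lambda>x. sin (pi * x / 2)" and ?c = "\<lambda>x. cos (pi * x / 2)"
  note hx = half_angle_bounds[OF x]
  have l: "\<bar>f u - f v\<bar> \<le> C * \<bar>u - v\<bar>" if "u \<in> {0..1}" "v \<in> {0..1}" for u v
    using lipschitz_onD[OF f that] by (simp add: dist_real_def)
  have l1: "\<bar>f (x / 2) - f (y / 2)\<bar> \<le> C * \<bar>x - y\<bar> / 2"
    using l[of "x / 2" "y / 2"] x y by (simp flip: diff_divide_distrib)
  have l2: "\<bar>f ((x + 1) / 2) - f ((y + 1) / 2)\<bar> \<le> C * \<bar>x - y\<bar> / 2"
    using l[of "(x + 1) / 2" "(y + 1) / 2"] x y by (simp flip: diff_divide_distrib)
  have s: "\<bar>?s x - ?s y\<bar> \<le> pi / 2 * \<bar>x - y\<bar>" and c: "\<bar>?c x - ?c y\<bar> \<le> pi / 2 * \<bar>x - y\<bar>"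
    using abs_sin_diff_le[of "pi * x / 2" "pi * y / 2"] abs_cos_diff_le[of "pi * x / 2" "pi * y / 2"]
    by (simp_all add: abs_mult flip: diff_divide_distrib right_diff_distrib)
  have "2 * \<bar>transfer f x - transfer f y\<bar>
      = \<bar>?s x * (f (x / 2) - f (y / 2)) + ?c x * (f ((x + 1) / 2) - f ((y + 1) / 2))
        + (?s x - ?s y) * f (y / 2) + (?c x - ?c y) * f ((y + 1) / 2)\<bar>"
    by (simp add: transfer_def algebra_simps flip: diff_divide_distrib)
  also have "\<dots> \<le> \<bar>?s x * (f (x / 2) - f (y / 2))\<bar> + \<bar>?c x * (f ((x + 1) / 2) - f ((y + 1) / 2))\<bar>
        + \<bar>(?s x - ?s y) * f (y / 2)\<bar> + \<bar>(?c x - ?c y) * f ((y + 1) / 2)\<bar>"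
    by linarith
  also have "\<dots> \<le> ?s x * (C * \<bar>x - y\<bar> / 2) + ?c x * (C * \<bar>x - y\<bar> / 2)
        + (pi / 2 * \<bar>x - y\<bar>) * B + (pi / 2 * \<bar>x - y\<bar>) * B"
    unfolding abs_mult using hx(1,2) y B0 l1 l2 s c by (intro add_mono mult_mono b) auto
  also have "\<dots> = (?s x + ?c x) * (C * \<bar>x - y\<bar> / 2) + pi * B * \<bar>x - y\<bar>"
    by (simp add: algebra_simps)
  also have "\<dots> \<le> 3 / 2 * (C * \<bar>x - y\<bar> / 2) + pi * B * \<bar>x - y\<bar>"
    using hx C0 by (intro add_right_mono mult_right_mono) auto
  finally show "dist (transfer f x) (transfer f y) \<le> (3 / 8 * C + pi / 2 * B) * dist x y"
    by (simp add: dist_real_def algebra_simps)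
qed

section \<open>Positivity: how far the iterates see\<close>

lemma transfer_ge_left:
  assumes "\<And>x. x \<in> {0..1} \<Longrightarrow> 0 \<le> f x" "x \<in> {0..1}"
  shows "transfer f x \<ge> sin (pi * x / 2) / 2 * f (x / 2)"
  unfolding transfer_def using half_angle_bounds(1,2)[OF assms(2)] assms
  by (auto simp: add_divide_distrib)

lemma transfer_ge_right:
  assumes "\<And>x. x \<in> {0..1} \<Longrightarrow> 0 \<le> f x" "x \<in> {0..1}"
  shows "transfer f x \<ge> cos (pi * x / 2) / 2 * f ((x + 1) / 2)"
  unfolding transfer_def using half_angle_bounds(1,2)[OF assms(2)] assms
  by (auto simp: add_divide_distrib)

lemma half_sin_ge:
  assumes "a > 0" "x \<in> {a..1}"
  shows "sin (pi * x / 2) \<ge> sin (pi * a / 2)" "sin (pi * a / 2) > 0"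
proof -
  have *: "pi * a \<le> pi * x" "pi * x \<le> pi * 1" using assms by (auto intro!: mult_left_mono)
  have 0: "0 < pi * a" using assms by simp
  show "sin (pi * x / 2) \<ge> sin (pi * a / 2)" by (intro sin_monotone_2pi_le) (use * 0 in linarith)+
  show "sin (pi * a / 2) > 0" by (intro sin_gt_zero) (use * 0 in linarith)+
qed

lemma half_cos_ge:
  assumes "a > 0" "x \<in> {0..1 - a}"
  shows "cos (pi * x / 2) \<ge> sin (pi * a / 2)"
proof -
  have "cos (pi * x / 2) = sin (pi * (1 - x) / 2)"
    by (simp add: algebra_simps diff_divide_distrib sin_diff)
  then show ?thesis using half_sin_ge(1)[of a "1 - x"] assms by simp
qed

(* Away from the endpoints, where one of the two branch weights vanishes, every dyadic
   interval of length 2^-k is reached by a branch of the k-th iterate with positive weight. *)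
lemma transfer_pow_reaches_interior:
  assumes "0 < a" "a \<le> 1 / 4"
  shows "\<exists>\<delta>>0. \<forall>f. (\<forall>x\<in>{0..1}. 0 \<le> f x) \<longrightarrow> (\<forall>x\<in>{a..1-a}. \<forall>y\<in>{0..1}.
      \<exists>y'\<in>{a / 2 ^ k..1 - a / 2 ^ k}. \<bar>y' - y\<bar> \<le> 1 / 2 ^ k \<and> (transfer ^^ k) f x \<ge> \<delta> * f y')"
proof (induction k)
  case 0
  show ?case using assms by (intro exI[of _ 1]) (auto intro!: bexI)
next
  case (Suc k)
  then obtain \<delta> where d: "\<delta> > 0" and IH: "\<And>f x y. (\<forall>x\<in>{0..1}. 0 \<le> f x) \<Longrightarrow> x\<in>{a..1-a} \<Longrightarrow> y\<in>{0..1} \<Longrightarrow>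
      \<exists>y'\<in>{a / 2 ^ k..1 - a / 2 ^ k}. \<bar>y' - y\<bar> \<le> 1 / 2 ^ k \<and> (transfer ^^ k) f x \<ge> \<delta> * f y'"
    by blast
  define b where "b = a / 2 ^ k"
  have b: "b > 0" using assms by (simp add: b_def)
  have "b \<le> a / 1" unfolding b_def using assms by (intro divide_left_mono) auto
  with b have b: "b > 0" "b \<le> 1/4" using assms by auto
  define \<delta>' where "\<delta>' = \<delta> * (sin (pi * b / 2) / 2)"
  have sb: "sin (pi * b / 2) > 0" using half_sin_ge(2)[of b 1] b by simp
  then have d': "\<delta>' > 0" using d by (simp add: \<delta>'_def)
  have "\<exists>y'\<in>{a / 2 ^ Suc k..1 - a / 2 ^ Suc k}. \<bar>y' - y\<bar> \<le> 1 / 2 ^ Suc k \<and>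
      (transfer ^^ Suc k) f x \<ge> \<delta>' * f y'"
    if f: "\<forall>x\<in>{0..1}. 0 \<le> f x" and x: "x \<in> {a..1-a}" and y: "y \<in> {0..1}" for f x y
  proof -
    have Tf: "\<forall>x\<in>{0..1}. 0 \<le> transfer f x" using transfer_nonneg f by blast
    \<comment> \<open>Splitting off the innermost factor lets the induction hypothesis act on
      \<open>transfer f\<close> with target 2y or 2y - 1. The matching inverse branch, applied to
      the resulting z, halves the error and leaves a margin of at least b/2 at both ends.\<close>
    have eq: "(transfer ^^ Suc k) f x = (transfer ^^ k) (transfer f) x"
      by (simp add: funpow_swap1)
    show ?thesis
    proof (cases "y \<le> 1 / 2")
      case True
      from IH[OF Tf x, of "2 * y"] True y obtain z where z: "z \<in> {b..1-b}"
        "\<bar>z - 2 * y\<bar> \<le> 1 / 2 ^ k" "(transfer ^^ k) (transfer f) x \<ge> \<delta> * transfer f z"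
        unfolding b_def by auto
      have z01: "z \<in> {0..1}" using z b by auto
      have "transfer f z \<ge> sin (pi * z / 2) / 2 * f (z / 2)"
        using transfer_ge_left[of f z] f z01 by auto
      also have "sin (pi * z / 2) / 2 * f (z / 2) \<ge> sin (pi * b / 2) / 2 * f (z / 2)"
        using half_sin_ge(1)[of b z] z b f z01 by (intro mult_right_mono divide_right_mono) auto
      finally have "\<delta>' * f (z / 2) \<le> \<delta> * transfer f z"
        unfolding \<delta>'_def mult.assoc using d by (intro mult_left_mono) auto
      then have "(transfer ^^ Suc k) f x \<ge> \<delta>' * f (z / 2)" unfolding eq using z by linarith
      moreover have "z / 2 \<in> {a / 2 ^ Suc k..1 - a / 2 ^ Suc k}" using z b by (auto simp: b_def)
      moreover have "\<bar>z / 2 - y\<bar> \<le> 1 / 2 ^ Suc k" using z(2) by auto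
      ultimately show ?thesis by blast
    next
      case False
      from IH[OF Tf x, of "2 * y - 1"] False y obtain z where z: "z \<in> {b..1-b}"
        "\<bar>z - (2 * y - 1)\<bar> \<le> 1 / 2 ^ k" "(transfer ^^ k) (transfer f) x \<ge> \<delta> * transfer f z"
        unfolding b_def by auto
      have z01: "z \<in> {0..1}" using z b by auto
      have "transfer f z \<ge> cos (pi * z / 2) / 2 * f ((z + 1) / 2)"
        using transfer_ge_right[of f z] f z01 by auto
      also have "cos (pi * z / 2) / 2 * f ((z + 1) / 2) \<ge> sin (pi * b / 2) / 2 * f ((z + 1) / 2)"
        using half_cos_ge[of b z] z b f z01 by (intro mult_right_mono divide_right_mono) auto
      finally have "\<delta>' * f ((z + 1) / 2) \<le> \<delta> * transfer f z"
        unfolding \<delta>'_def mult.assoc using d by (intro mult_left_mono) auto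
      then have "(transfer ^^ Suc k) f x \<ge> \<delta>' * f ((z + 1) / 2)" unfolding eq using z by linarith
      moreover have "(z + 1) / 2 \<in> {a / 2 ^ Suc k..1 - a / 2 ^ Suc k}" using z b by (auto simp: b_def)
      moreover have "\<bar>(z + 1) / 2 - y\<bar> \<le> 1 / 2 ^ Suc k"
      proof -
        have "(z + 1) / 2 - y = (z - (2 * y - 1)) / 2" by (simp add: field_simps)
        then have "\<bar>(z + 1) / 2 - y\<bar> = \<bar>z - (2 * y - 1)\<bar> / 2" by (simp only: abs_divide abs_numeral)
      also have "\<dots> \<le> 1 / 2 ^ k / 2" using z(2) by (intro divide_right_mono) auto
      finally show ?thesis by simp
      qed
      ultimately show ?thesis by blast
    qed
  qed
  then show ?case using d' by blast
qed

text \<open>One extra step accounts for \<open>Suc k\<close>: whatever x is, some branch of weight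
  at least sin(pi/4)/2 carries it into [1/4, 3/4], where the interior version applies. The constant
  depends on k only, not on f, x or y.\<close>

lemma transfer_pow_reaches:
  "\<exists>\<delta>>0. \<forall>f. (\<forall>x\<in>{0..1}. 0 \<le> f x) \<longrightarrow> (\<forall>x\<in>{0..1}. \<forall>y\<in>{0..1}.
      \<exists>y'\<in>{0..1}. \<bar>y' - y\<bar> \<le> 1 / 2 ^ k \<and> (transfer ^^ Suc k) f x \<ge> \<delta> * f y')"
proof -
  obtain \<delta> where d: "\<delta> > 0" and r: "\<And>f x y. (\<forall>x\<in>{0..1}. 0 \<le> f x) \<Longrightarrow> x\<in>{1/4..1-1/4} \<Longrightarrow> y\<in>{0..1} \<Longrightarrow>
      \<exists>y'\<in>{1 / 4 / 2 ^ k..1 - 1 / 4 / 2 ^ k}. \<bar>y' - y\<bar> \<le> 1 / 2 ^ k \<and> (transfer ^^ k) f x \<ge> \<delta> * f y'"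
    using transfer_pow_reaches_interior[of "1/4" k] by auto
  define s where "s = sin (pi * (1/2) / 2) / 2"
  have s: "s > 0" unfolding s_def using half_sin_ge(2)[of "1/2" 1] by simp
  have sub: "{1 / 4 / 2 ^ k..1 - 1 / 4 / 2 ^ k} \<subseteq> {0..1::real}" by auto
  have "\<exists>y'\<in>{0..1}. \<bar>y' - y\<bar> \<le> 1 / 2 ^ k \<and> (transfer ^^ Suc k) f x \<ge> (s * \<delta>) * f y'"
    if f: "\<forall>x\<in>{0..1}. 0 \<le> f x" and x: "x \<in> {0..1}" and y: "y \<in> {0..1}" for f x y
  proof -
    have pos: "\<forall>x\<in>{0..1}. 0 \<le> (transfer ^^ k) f x" by (induction k) (use f transfer_nonneg in auto)
    obtain z where z: "z \<in> {1/4..1-1/4}" "(transfer ^^ Suc k) f x \<ge> s * (transfer ^^ k) f z"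
    proof (cases "x \<le> 1 / 2")
      case True
      have "s * (transfer ^^ k) f ((x + 1) / 2) \<le> cos (pi * x / 2) / 2 * (transfer ^^ k) f ((x + 1) / 2)"
        unfolding s_def using half_cos_ge[of "1/2" x] True x pos
        by (intro mult_right_mono divide_right_mono) auto
      also have "\<dots> \<le> (transfer ^^ Suc k) f x"
        using transfer_ge_right[of "(transfer ^^ k) f" x] pos x by auto
      finally show ?thesis using that[of "(x + 1) / 2"] True x by auto
    next
      case False
      have "s * (transfer ^^ k) f (x / 2) \<le> sin (pi * x / 2) / 2 * (transfer ^^ k) f (x / 2)"
        unfolding s_def using half_sin_ge(1)[of "1/2" x] False x pos
        by (intro mult_right_mono divide_right_mono) auto
      also have "\<dots> \<le> (transfer ^^ Suc k) f x"
        using transfer_ge_left[of "(transfer ^^ k) f" x] pos x by auto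
      finally show ?thesis using that[of "x / 2"] False x by auto
    qed
    from r[OF f z(1) y] obtain y' where y': "y' \<in> {0..1}" "\<bar>y' - y\<bar> \<le> 1 / 2 ^ k"
      "(transfer ^^ k) f z \<ge> \<delta> * f y'" using sub by blast
    have "s * (\<delta> * f y') \<le> s * (transfer ^^ k) f z" using y' s by (intro mult_left_mono) auto
    with z y' show ?thesis by (intro bexI[of _ y']) (auto simp: mult.assoc)
  qed
  then show ?thesis using d s by (intro exI[of _ "s * \<delta>"]) auto
qed

section \<open>Iterates of the constant function 1\<close>

definition iter1 :: "nat \<Rightarrow> real \<Rightarrow> real" where
  "iter1 n = (transfer ^^ n) (\<lambda>_. 1)"

lemma iter1_0 [simp]: "iter1 0 x = 1"
  by (simp add: iter1_def)

lemma iter1_Suc: "iter1 (Suc n) = transfer (iter1 n)"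
  by (simp add: iter1_def)

lemma iter1_add: "iter1 (k + n) = (transfer ^^ k) (iter1 n)"
  by (simp add: iter1_def funpow_add)

lemma continuous_on_iter1: "continuous_on {0..1} (iter1 n)"
proof (induction n)
  case 0
  show ?case by (simp add: iter1_def)
qed (simp add: iter1_Suc continuous_on_transfer)

lemma iter1_Suc_bounds:
  assumes "x \<in> {0..1}"
  shows "1 / 2 * iter1 n x \<le> iter1 (Suc n) x" "iter1 (Suc n) x \<le> iter1 n x"
proof -
  have eq: "iter1 (Suc n) = (transfer ^^ n) (transfer (\<lambda>_. 1))"
    by (simp add: iter1_def funpow_swap1)
  have "1 / 2 * iter1 n x = (transfer ^^ n) (\<lambda>_. 1 / 2 * 1) x"
    by (subst transfer_pow_scale) (simp add: iter1_def)
  also have "\<dots> \<le> iter1 (Suc n) x"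
    unfolding eq using assms by (intro transfer_pow_mono) (use transfer_const_bounds in auto)
  finally show "1 / 2 * iter1 n x \<le> iter1 (Suc n) x" .
  show "iter1 (Suc n) x \<le> iter1 n x"
    unfolding eq unfolding iter1_def using assms
    by (intro transfer_pow_mono order.trans[OF transfer_const_bounds(2)]) auto
qed

lemma iter1_ge: "x \<in> {0..1} \<Longrightarrow> iter1 n x \<ge> (1 / 2) ^ n"
proof (induction n)
  case (Suc n)
  then show ?case using iter1_Suc_bounds(1)[of x n] by auto
qed simp

lemma iter1_pos: "x \<in> {0..1} \<Longrightarrow> iter1 n x > 0"
  by (rule less_le_trans[OF _ iter1_ge]) auto

text \<open>One step gives only T1 >= 1/2, which would allow the exponent 0. Two steps do better
  than (1/2)^2: sin t + cos t exceeds 1 by at least a multiple of sin 2t, and at the two preimages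
  of x these values sin 2t are exactly the weights of the second step.\<close>

lemma iter1_2_ge:
  assumes "x \<in> {0..1}"
  shows "iter1 2 x \<ge> 7 / 20"
proof -
  let ?s = "sin (pi * x / 2)" and ?c = "cos (pi * x / 2)"
  note b = half_angle_bounds[OF assms]
  \<comment> \<open>From (1 + 2u/5)^2 <= 1 + 24u/25 for 0 <= u <= 1. The constant has to stay below
    sqrt 2 - 1, the limit imposed at u = 1; it leads to (1 + 2/5) / 4 = 7/20.\<close>
  have *: "sin t + cos t \<ge> 1 + 2 / 5 * sin (2 * t)"
    if t: "sin t + cos t \<ge> 0" "sin (2 * t) \<ge> 0" for t :: real
  proof (rule power2_le_imp_le[OF _ t(1)])
    have "(sin (2 * t))\<^sup>2 \<le> sin (2 * t)" using t by (simp add: power2_eq_square mult_left_le)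
    then have "(1 + 2 / 5 * sin (2 * t))\<^sup>2 \<le> 1 + sin (2 * t)"
      using t by (simp add: power2_sum power_mult_distrib power_divide)
    also have "1 + sin (2 * t) = (sin t + cos t)\<^sup>2" by (simp add: power2_sum sin_double)
    finally show "(1 + 2 / 5 * sin (2 * t))\<^sup>2 \<le> (sin t + cos t)\<^sup>2" .
  qed
  have 1: "iter1 1 y = (sin (pi * y / 2) + cos (pi * y / 2)) / 2" for y
    by (simp add: iter1_def transfer_def)
  have s2: "sin (2 * (pi * (x / 2) / 2)) = ?s" by simp
  have c2: "sin (2 * (pi * ((x + 1) / 2) / 2)) = ?c"
    by (simp add: sin_add algebra_simps add_divide_distrib)
  have A: "iter1 1 (x / 2) \<ge> (1 + 2 / 5 * ?s) / 2"
    unfolding 1 using *[of "pi * (x / 2) / 2", unfolded s2] half_angle_bounds(5)[of "x / 2"] assms b(1)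
    by (intro divide_right_mono) auto
  have B: "iter1 1 ((x + 1) / 2) \<ge> (1 + 2 / 5 * ?c) / 2"
    unfolding 1 using *[of "pi * ((x + 1) / 2) / 2", unfolded c2] half_angle_bounds(5)[of "(x + 1) / 2"] assms b(2)
    by (intro divide_right_mono) auto
  have ring: "(a + b + 2 / 5 * (a\<^sup>2 + b\<^sup>2)) / 4 = (a * ((1 + 2 / 5 * a) / 2) + b * ((1 + 2 / 5 * b) / 2)) / 2"
    for a b :: real by (simp add: field_simps power2_eq_square)
  have "7 / 20 \<le> (?s + ?c + 2 / 5) / 4" using b(5) by simp
  also have "\<dots> = (?s + ?c + 2 / 5 * (?s\<^sup>2 + ?c\<^sup>2)) / 4" by simp
  also have "\<dots> = (?s * ((1 + 2 / 5 * ?s) / 2) + ?c * ((1 + 2 / 5 * ?c) / 2)) / 2"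
    by (rule ring)
  also have "\<dots> \<le> (?s * iter1 1 (x / 2) + ?c * iter1 1 ((x + 1) / 2)) / 2"
    using A B b(1,2) by (intro divide_right_mono add_mono mult_left_mono) auto
  also have "\<dots> = iter1 2 x" using fun_cong[OF iter1_Suc[of 1], of x]
    by (simp add: transfer_def numeral_2_eq_2)
  finally show ?thesis .
qed

lemma sine_product_integral_duality:
  "integral {0..1} (\<lambda>x. iter1 k x * sine_product L x) = sine_product_integral (k + L)"
proof (induction k arbitrary: L)
  case 0
  show ?case by (simp add: sine_product_integral_altdef)
next
  case (Suc k)
  have "integral {0..1} (\<lambda>x. iter1 (Suc k) x * sine_product L x)
      = integral {0..1} (\<lambda>x. iter1 k x * sine_product (Suc L) x)"
    unfolding iter1_Suc by (rule transfer_duality[OF continuous_on_iter1, symmetric])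
  also have "\<dots> = sine_product_integral (Suc k + L)" using Suc.IH[of "Suc L"] by simp
  finally show ?case .
qed

lemma sine_product_integral_eq: "sine_product_integral L = integral {0..1} (iter1 L)"
  using sine_product_integral_duality[of L 0] by simp

lemma integral_iter1_mono:
  assumes "\<And>x. x \<in> {0..1} \<Longrightarrow> a * iter1 m x \<le> b * iter1 n x"
  shows "a * sine_product_integral m \<le> b * sine_product_integral n"
proof -
  have "integral {0..1} (\<lambda>x. a * iter1 m x) \<le> integral {0..1} (\<lambda>x. b * iter1 n x)"
    using assms by (intro integral_le integrable_continuous_real continuous_intros continuous_on_iter1) auto
  then show ?thesis by (simp add: sine_product_integral_eq)
qed

definition iter1_sup :: "nat \<Rightarrow> real" where
  "iter1_sup n = Sup (iter1 n ` {0..1})"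

lemma iter1_sup_attained: "\<exists>y\<in>{0..1}. iter1 n y = iter1_sup n"
  and iter1_le_sup: "x \<in> {0..1} \<Longrightarrow> iter1 n x \<le> iter1_sup n"
proof -
  obtain y where y: "y \<in> {0..1}" "\<And>x. x \<in> {0..1} \<Longrightarrow> iter1 n x \<le> iter1 n y"
    using continuous_attains_sup[OF compact_Icc _ continuous_on_iter1[of n]] by auto
  then have "iter1_sup n = iter1 n y"
    unfolding iter1_sup_def by (intro cSup_eq_maximum) auto
  with y show "\<exists>y\<in>{0..1}. iter1 n y = iter1_sup n" "x \<in> {0..1} \<Longrightarrow> iter1 n x \<le> iter1_sup n"
    by auto
qed

lemma iter1_sup_pos: "iter1_sup n > 0"
  using iter1_sup_attained[of n] iter1_pos by metis

lemma iter1_sup_Suc: "iter1_sup n \<le> 2 * iter1_sup (Suc n)" "iter1_sup (Suc n) \<le> iter1_sup n"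
proof -
  obtain y where y: "y \<in> {0..1}" "iter1 n y = iter1_sup n" using iter1_sup_attained by blast
  show "iter1_sup n \<le> 2 * iter1_sup (Suc n)"
    using iter1_Suc_bounds(1)[OF y(1), of n] iter1_le_sup[OF y(1), of "Suc n"] y by simp
  obtain z where z: "z \<in> {0..1}" "iter1 (Suc n) z = iter1_sup (Suc n)" using iter1_sup_attained by blast
  show "iter1_sup (Suc n) \<le> iter1_sup n"
    using iter1_Suc_bounds(2)[OF z(1), of n] iter1_le_sup[OF z(1), of "n"] z by simp
qed

lemma iter1_sup_antimono: "m \<le> n \<Longrightarrow> iter1_sup n \<le> iter1_sup m"
  by (rule lift_Suc_antimono_le[of iter1_sup]) (auto intro: iter1_sup_Suc)

text \<open>The constant 16 reproduces itself: 3/8 * 16 + pi/2 <= 8, and the supremum drops by at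
  most a factor 2 in one step.\<close>

lemma iter1_lipschitz: "(16 * iter1_sup n)-lipschitz_on {0..1} (iter1 n)"
proof (induction n)
  case 0
  show ?case using iter1_sup_pos[of 0] by (intro lipschitz_onI) auto
next
  case (Suc n)
  have lip: "(3 / 8 * (16 * iter1_sup n) + pi / 2 * iter1_sup n)-lipschitz_on {0..1} (iter1 (Suc n))"
    unfolding iter1_Suc using iter1_le_sup iter1_pos
    by (intro transfer_lipschitz Suc) (auto simp: less_imp_le abs_of_pos)
  have "pi / 2 * iter1_sup n \<le> 2 * iter1_sup n"
    using iter1_sup_pos[of n] pi_less_4 by (intro mult_right_mono) auto
  then show ?case
    by (intro lipschitz_on_le[OF lip]) (use iter1_sup_Suc(1)[of n] in linarith)
qed

text \<open>A Harnack inequality with a constant independent of n. Within 2^-5 of a maximum point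
  the Lipschitz constant 16 costs at most half of the supremum, and six steps make such a point
  visible from every x. For n < 6 the trivial bound (1/2)^n takes over.\<close>

lemma iter1_ge_sup: "\<exists>c>0. \<forall>n. \<forall>x\<in>{0..1}. c * iter1_sup n \<le> iter1 n x"
proof -
  obtain \<delta> where d: "\<delta> > 0" and r: "\<And>f x y. (\<forall>x\<in>{0..1}. 0 \<le> f x) \<Longrightarrow> x\<in>{0..1} \<Longrightarrow> y\<in>{0..1} \<Longrightarrow>
      \<exists>y'\<in>{0..1}. \<bar>y' - y\<bar> \<le> 1 / 2 ^ 5 \<and> (transfer ^^ Suc 5) f x \<ge> \<delta> * f y'"
    using transfer_pow_reaches[of 5] by blast
  define c where "c = min (\<delta> / 2) (1 / 64)"
  have "c * iter1_sup n \<le> iter1 n x" if x: "x \<in> {0..1}" for n x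
  proof (cases "n \<ge> 6")
    case True
    define m where "m = n - 6"
    have n: "n = Suc 5 + m" using True by (simp add: m_def)
    obtain y where y: "y \<in> {0..1}" "iter1 m y = iter1_sup m" using iter1_sup_attained by blast
    obtain y' where y': "y' \<in> {0..1}" "\<bar>y' - y\<bar> \<le> 1 / 2 ^ 5" "(transfer ^^ Suc 5) (iter1 m) x \<ge> \<delta> * iter1 m y'"
      using r[of "iter1 m" x y] less_imp_le[OF iter1_pos] x y(1) by blast
    have "\<bar>iter1 m y' - iter1 m y\<bar> \<le> 16 * iter1_sup m * \<bar>y' - y\<bar>"
      using lipschitz_onD[OF iter1_lipschitz y'(1) y(1)] by (simp add: dist_real_def)
    also have "\<dots> \<le> 16 * iter1_sup m * (1 / 2 ^ 5)"
      using y' iter1_sup_pos[of m] by (intro mult_left_mono) auto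
    finally have "\<bar>iter1 m y' - iter1_sup m\<bar> \<le> iter1_sup m / 2" using y(2) by simp
    then have "iter1 m y' \<ge> iter1_sup m / 2" by linarith
    then have "\<delta> * (iter1_sup m / 2) \<le> \<delta> * iter1 m y'" using d by (intro mult_left_mono) auto
    also have "\<dots> \<le> iter1 n x" using y'(3) unfolding n iter1_add by simp
    finally have 1: "\<delta> / 2 * iter1_sup m \<le> iter1 n x" by simp
    have "c * iter1_sup n \<le> c * iter1_sup m"
      using iter1_sup_antimono[of m n] n d by (intro mult_left_mono) (auto simp: c_def)
    also have "\<dots> \<le> \<delta> / 2 * iter1_sup m"
      using iter1_sup_pos[of m] by (intro mult_right_mono) (auto simp: c_def)
    finally show ?thesis using 1 by simp
  next
    case False
    have "c * iter1_sup n \<le> 1 / 64 * 1"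
      using iter1_sup_antimono[of 0 n] iter1_sup_attained[of 0] iter1_sup_pos[of n] d
      by (intro mult_mono) (auto simp: c_def)
    also have "\<dots> = (1 / 2) ^ 6" by (simp add: power_divide)
    also have "\<dots> \<le> (1 / 2) ^ n" using False by (intro power_decreasing) auto
    also have "\<dots> \<le> iter1 n x" using iter1_ge[OF x] .
    finally show ?thesis .
  qed
  moreover have "c > 0" using d by (simp add: c_def)
  ultimately show ?thesis by blast
qed

section \<open>Ratios of consecutive iterates and their oscillation\<close>

definition iter1_ratio :: "nat \<Rightarrow> real \<Rightarrow> real" where
  "iter1_ratio n x = iter1 (Suc n) x / iter1 n x"
definition ratio_inf :: "nat \<Rightarrow> real" where
  "ratio_inf n = Inf (iter1_ratio n ` {0..1})"
definition ratio_sup :: "nat \<Rightarrow> real" where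
  "ratio_sup n = Sup (iter1_ratio n ` {0..1})"

lemma continuous_on_iter1_ratio: "continuous_on {0..1} (iter1_ratio n)"
  unfolding iter1_ratio_def using iter1_pos
  by (intro continuous_intros continuous_on_iter1) (auto simp: less_imp_neq[symmetric] dest: less_imp_neq)

lemma ratio_inf_attained: "\<exists>y\<in>{0..1}. iter1_ratio n y = ratio_inf n"
  and ratio_inf_le: "x \<in> {0..1} \<Longrightarrow> ratio_inf n \<le> iter1_ratio n x"
proof -
  obtain y where y: "y \<in> {0..1}" "\<And>x. x \<in> {0..1} \<Longrightarrow> iter1_ratio n x \<ge> iter1_ratio n y"
    using continuous_attains_inf[OF compact_Icc _ continuous_on_iter1_ratio[of n]] by auto
  then have "ratio_inf n = iter1_ratio n y"
    unfolding ratio_inf_def by (intro cInf_eq_minimum) auto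
  with y show "\<exists>y\<in>{0..1}. iter1_ratio n y = ratio_inf n" "x \<in> {0..1} \<Longrightarrow> ratio_inf n \<le> iter1_ratio n x"
    by auto
qed

lemma ratio_sup_attained: "\<exists>y\<in>{0..1}. iter1_ratio n y = ratio_sup n"
  and ratio_sup_ge: "x \<in> {0..1} \<Longrightarrow> iter1_ratio n x \<le> ratio_sup n"
proof -
  obtain y where y: "y \<in> {0..1}" "\<And>x. x \<in> {0..1} \<Longrightarrow> iter1_ratio n x \<le> iter1_ratio n y"
    using continuous_attains_sup[OF compact_Icc _ continuous_on_iter1_ratio[of n]] by auto
  then have "ratio_sup n = iter1_ratio n y"
    unfolding ratio_sup_def by (intro cSup_eq_maximum) auto
  with y show "\<exists>y\<in>{0..1}. iter1_ratio n y = ratio_sup n" "x \<in> {0..1} \<Longrightarrow> iter1_ratio n x \<le> ratio_sup n"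
    by auto
qed

lemma ratio_bounds:
  assumes "x \<in> {0..1}"
  shows "ratio_inf n * iter1 n x \<le> iter1 (Suc n) x" "iter1 (Suc n) x \<le> ratio_sup n * iter1 n x"
  using ratio_inf_le[OF assms, of n] ratio_sup_ge[OF assms, of n] iter1_pos[OF assms, of n]
  by (simp_all add: iter1_ratio_def field_simps)

lemma ratio_inf_ge_half: "ratio_inf n \<ge> 1 / 2"
proof -
  obtain y where y: "y \<in> {0..1}" "iter1_ratio n y = ratio_inf n" using ratio_inf_attained by blast
  then show ?thesis using iter1_Suc_bounds(1)[OF y(1), of n] iter1_pos[OF y(1), of n]
    by (auto simp: iter1_ratio_def field_simps)
qed

lemma ratio_inf_le_sup: "ratio_inf n \<le> ratio_sup n"
  using ratio_inf_le[of 0 n] ratio_sup_ge[of 0 n] by simp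

text \<open>A positive linear operator preserves the inequality between
  \<open>ratio_inf n * iter1 n\<close> and \<open>iter1 (Suc n)\<close>.\<close>

lemma ratio_inf_Suc: "ratio_inf n \<le> ratio_inf (Suc n)"
proof -
  obtain y where y: "y \<in> {0..1}" "iter1_ratio (Suc n) y = ratio_inf (Suc n)" using ratio_inf_attained by blast
  have "ratio_inf n * iter1 (Suc n) y \<le> iter1 (Suc (Suc n)) y"
    using transfer_mono[of "\<lambda>x. ratio_inf n * iter1 n x" "iter1 (Suc n)" y] ratio_bounds(1) y
    by (simp add: transfer_scale iter1_Suc)
  then show ?thesis using y iter1_pos[OF y(1), of "Suc n"] by (auto simp: iter1_ratio_def field_simps)
qed

lemma ratio_sup_Suc: "ratio_sup (Suc n) \<le> ratio_sup n"
proof -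
  obtain y where y: "y \<in> {0..1}" "iter1_ratio (Suc n) y = ratio_sup (Suc n)" using ratio_sup_attained by blast
  have "ratio_sup n * iter1 (Suc n) y \<ge> iter1 (Suc (Suc n)) y"
    using transfer_mono[of "iter1 (Suc n)" "\<lambda>x. ratio_sup n * iter1 n x" y] ratio_bounds(2) y
    by (simp add: transfer_scale iter1_Suc)
  then show ?thesis using y iter1_pos[OF y(1), of "Suc n"] by (auto simp: iter1_ratio_def field_simps)
qed

definition ratio_osc :: "nat \<Rightarrow> real" where
  "ratio_osc n = ratio_sup n - ratio_inf n"

lemma ratio_osc_nonneg: "ratio_osc n \<ge> 0"
  using ratio_inf_le_sup[of n] by (simp add: ratio_osc_def)

lemma ratio_osc_antimono: "m \<le> n \<Longrightarrow> ratio_osc n \<le> ratio_osc m"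
  by (rule lift_Suc_antimono_le[of ratio_osc])
     (use ratio_inf_Suc ratio_sup_Suc in \<open>auto simp: ratio_osc_def intro: diff_mono\<close>)

text \<open>The excess over the largest multiple of \<open>iter1 n\<close> lying below
  \<open>iter1 (Suc n)\<close>. Being nonnegative, it is open to the minorisation, and where the
  ratio is largest it equals the whole oscillation times \<open>iter1 n\<close>.\<close>

definition ratio_gap :: "nat \<Rightarrow> real \<Rightarrow> real" where
  "ratio_gap n x = iter1 (Suc n) x - ratio_inf n * iter1 n x"

lemma ratio_gap_bounds:
  assumes "x \<in> {0..1}"
  shows "0 \<le> ratio_gap n x" "ratio_gap n x \<le> ratio_osc n * iter1 n x"
  using ratio_bounds[OF assms, of n] by (auto simp: ratio_gap_def ratio_osc_def algebra_simps)

lemma ratio_gap_attained: "\<exists>y\<in>{0..1}. ratio_gap n y = ratio_osc n * iter1 n y"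
proof -
  obtain y where y: "y \<in> {0..1}" "iter1_ratio n y = ratio_sup n" using ratio_sup_attained by blast
  then have "iter1 (Suc n) y = ratio_sup n * iter1 n y"
    using iter1_pos[OF y(1), of n] by (auto simp: iter1_ratio_def field_simps)
  then show ?thesis using y by (auto simp: ratio_gap_def ratio_osc_def algebra_simps)
qed

text \<open>Bounds the Lipschitz constant of \<open>ratio_gap n\<close> in units of
  \<open>iter1_sup n\<close>. The factor 3/4 is 2 * 3/8, the 2 coming from the change of unit; 20 =
  4 + 16, where 4 stems from the variation of the weights (pi/2 <= 2, doubled by the same change)
  and 16 from the increase of \<open>ratio_inf\<close>, which is at most the oscillation.\<close>

fun gap_lip :: "nat \<Rightarrow> real" where
  "gap_lip 0 = 64"
| "gap_lip (Suc n) = 3 / 4 * gap_lip n + 20 * ratio_osc n"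

lemma gap_lip_nonneg: "gap_lip n \<ge> 0"
  by (induction n) (auto simp: ratio_osc_nonneg)

lemma ratio_gap_Suc: "ratio_gap (Suc n) x = transfer (ratio_gap n) x - (ratio_inf (Suc n) - ratio_inf n) * iter1 (Suc n) x"
  unfolding ratio_gap_def[abs_def] transfer_diff_scale by (simp add: iter1_Suc algebra_simps)

lemma ratio_gap_lipschitz: "(gap_lip n * iter1_sup n)-lipschitz_on {0..1} (ratio_gap n)"
proof (induction n)
  case 0
  have 1: "(16 * iter1_sup (Suc 0))-lipschitz_on {0..1} (iter1 (Suc 0))" by (rule iter1_lipschitz)
  have "ratio_gap 0 x = iter1 (Suc 0) x - ratio_inf 0" for x by (simp add: ratio_gap_def)
  then have "(16 * iter1_sup (Suc 0))-lipschitz_on {0..1} (ratio_gap 0)"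
    using 1 by (simp add: lipschitz_on_def dist_real_def)
  then show ?case by (rule lipschitz_on_le)
    (use iter1_sup_Suc(2)[of 0] iter1_sup_pos[of 0] in simp)
next
  case (Suc n)
  have S: "iter1_sup n > 0" "iter1_sup n \<le> 2 * iter1_sup (Suc n)" by (rule iter1_sup_pos iter1_sup_Suc)+
  have inc: "0 \<le> ratio_inf (Suc n) - ratio_inf n" "ratio_inf (Suc n) - ratio_inf n \<le> ratio_osc n"
    using ratio_inf_Suc[of n] ratio_sup_Suc[of n] ratio_inf_le_sup[of "Suc n"] by (auto simp: ratio_osc_def)
  have gap: "\<bar>ratio_gap n x\<bar> \<le> ratio_osc n * iter1_sup n" if "x \<in> {0..1}" for x
    using ratio_gap_bounds[OF that, of n] mult_left_mono[OF iter1_le_sup[OF that] ratio_osc_nonneg] by (auto intro: order.trans)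
  have A: "(3 / 8 * (gap_lip n * iter1_sup n) + pi / 2 * (ratio_osc n * iter1_sup n))-lipschitz_on {0..1} (transfer (ratio_gap n))"
    by (rule transfer_lipschitz[OF Suc gap])
  have B: "((ratio_inf (Suc n) - ratio_inf n) * (16 * iter1_sup (Suc n)))-lipschitz_on {0..1}
      (\<lambda>x. (ratio_inf (Suc n) - ratio_inf n) * iter1 (Suc n) x)"
    using lipschitz_on_cmult_real[OF iter1_lipschitz[of "Suc n"], of "ratio_inf (Suc n) - ratio_inf n"] inc by simp
  have "(3 / 8 * (gap_lip n * iter1_sup n) + pi / 2 * (ratio_osc n * iter1_sup n)
      + (ratio_inf (Suc n) - ratio_inf n) * (16 * iter1_sup (Suc n)))-lipschitz_on {0..1} (ratio_gap (Suc n))"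
    using lipschitz_on_diff[OF A B] by (simp add: ratio_gap_Suc[abs_def])
  then show ?case
  proof (rule lipschitz_on_le)
    have "3 / 8 * (gap_lip n * iter1_sup n) \<le> 3 / 8 * (gap_lip n * (2 * iter1_sup (Suc n)))"
      using S gap_lip_nonneg[of n] by (intro mult_left_mono) auto
    moreover have "pi / 2 * (ratio_osc n * iter1_sup n) \<le> 2 * (ratio_osc n * (2 * iter1_sup (Suc n)))"
      using S ratio_osc_nonneg[of n] pi_less_4 by (intro mult_mono mult_left_mono) auto
    moreover have "(ratio_inf (Suc n) - ratio_inf n) * (16 * iter1_sup (Suc n)) \<le> ratio_osc n * (16 * iter1_sup (Suc n))"
      using inc iter1_sup_pos[of "Suc n"] by (intro mult_right_mono) auto
    ultimately show "3 / 8 * (gap_lip n * iter1_sup n) + pi / 2 * (ratio_osc n * iter1_sup n)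
      + (ratio_inf (Suc n) - ratio_inf n) * (16 * iter1_sup (Suc n)) \<le> gap_lip (Suc n) * iter1_sup (Suc n)"
      by (simp add: algebra_simps)
  qed
qed

text \<open>The constant 80 = 20 / (1 - 3/4) sums the geometric series of source terms, the
  oscillation being nonincreasing.\<close>

lemma gap_lip_add: "gap_lip (n + j) \<le> (3 / 4) ^ j * gap_lip n + 80 * ratio_osc n"
proof (induction j)
  case 0
  show ?case using ratio_osc_nonneg[of n] by simp
next
  case (Suc j)
  have "gap_lip (n + Suc j) = 3 / 4 * gap_lip (n + j) + 20 * ratio_osc (n + j)" by simp
  also have "\<dots> \<le> 3 / 4 * ((3 / 4) ^ j * gap_lip n + 80 * ratio_osc n) + 20 * ratio_osc n"
    using Suc ratio_osc_antimono[of n "n + j"] by (intro add_mono mult_left_mono) auto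
  finally show ?case by (simp add: algebra_simps)
qed

text \<open>Near the point where the gap is full it is at least c * \<open>ratio_osc n\<close> -
  \<open>gap_lip n\<close> / 2^k in units of the supremum; k + 1 steps spread this to every x with
  weight \<delta>, so the infimum of the ratio rises by that much while its supremum does not
  increase. The order of the quantifiers matters: c is the Harnack constant, fixed before k, so k
  can later be chosen in terms of c, whereas \<delta> may shrink with k.\<close>

lemma ratio_osc_step:
  "\<exists>c>0. \<forall>k. \<exists>\<delta>>0. \<forall>n. ratio_osc (n + Suc k) \<le> ratio_osc n - \<delta> * (c * ratio_osc n - gap_lip n / 2 ^ k)"
proof -
  obtain c where c: "c > 0" "\<And>n x. x \<in> {0..1} \<Longrightarrow> c * iter1_sup n \<le> iter1 n x"
    using iter1_ge_sup by blast
  have "\<exists>\<delta>>0. \<forall>n. ratio_osc (n + Suc k) \<le> ratio_osc n - \<delta> * (c * ratio_osc n - gap_lip n / 2 ^ k)" for k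
  proof -
    obtain \<delta> where d: "\<delta> > 0" and r: "\<And>f x y. (\<forall>x\<in>{0..1}. 0 \<le> f x) \<Longrightarrow> x\<in>{0..1} \<Longrightarrow> y\<in>{0..1} \<Longrightarrow>
        \<exists>y'\<in>{0..1}. \<bar>y' - y\<bar> \<le> 1 / 2 ^ k \<and> (transfer ^^ Suc k) f x \<ge> \<delta> * f y'"
      using transfer_pow_reaches[of k] by blast
    have "ratio_osc (n + Suc k) \<le> ratio_osc n - \<delta> * (c * ratio_osc n - gap_lip n / 2 ^ k)" for n
    proof -
      define X where "X = \<delta> * (c * ratio_osc n - gap_lip n / 2 ^ k)"
      obtain x where x: "x \<in> {0..1}" "iter1_ratio (n + Suc k) x = ratio_inf (n + Suc k)"
        using ratio_inf_attained by blast
      obtain y where y: "y \<in> {0..1}" "ratio_gap n y = ratio_osc n * iter1 n y"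
        using ratio_gap_attained by blast
      obtain y' where y': "y' \<in> {0..1}" "\<bar>y' - y\<bar> \<le> 1 / 2 ^ k"
          "(transfer ^^ Suc k) (ratio_gap n) x \<ge> \<delta> * ratio_gap n y'"
        using r[of "ratio_gap n" x y] ratio_gap_bounds(1) x y by blast
      have "\<bar>ratio_gap n y' - ratio_gap n y\<bar> \<le> gap_lip n * iter1_sup n * \<bar>y' - y\<bar>"
        using lipschitz_onD[OF ratio_gap_lipschitz y'(1) y(1)] by (simp add: dist_real_def)
      also have "\<dots> \<le> gap_lip n * iter1_sup n * (1 / 2 ^ k)"
        using y' iter1_sup_pos[of n] gap_lip_nonneg[of n] by (intro mult_left_mono) auto
      finally have "ratio_gap n y' \<ge> ratio_osc n * iter1 n y - gap_lip n * iter1_sup n / 2 ^ k"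
        using y by auto
      moreover have "ratio_osc n * iter1 n y \<ge> ratio_osc n * (c * iter1_sup n)"
        using c(2)[OF y(1), of n] ratio_osc_nonneg[of n] by (intro mult_left_mono) auto
      ultimately have "ratio_gap n y' \<ge> ratio_osc n * (c * iter1_sup n) - gap_lip n * iter1_sup n / 2 ^ k" by linarith
      then have "\<delta> * (ratio_osc n * (c * iter1_sup n) - gap_lip n * iter1_sup n / 2 ^ k) \<le> \<delta> * ratio_gap n y'"
        using d by (intro mult_left_mono) auto
      then have X: "X * iter1_sup n \<le> (transfer ^^ Suc k) (ratio_gap n) x"
        using y'(3) unfolding X_def by (simp add: algebra_simps)
      have h: "(transfer ^^ Suc k) (ratio_gap n) x = iter1 (Suc (n + Suc k)) x - ratio_inf n * iter1 (n + Suc k) x"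
        unfolding ratio_gap_def[abs_def] transfer_pow_diff_scale
        using fun_cong[OF iter1_add[of "Suc k" "Suc n"], of x] fun_cong[OF iter1_add[of "Suc k" n], of x]
        by (simp add: add.commute)
      have pos: "iter1 (n + Suc k) x > 0" using iter1_pos x by blast
      have nn: "(transfer ^^ Suc k) (ratio_gap n) x \<ge> 0"
        using transfer_pow_mono[of "\<lambda>_. 0" "ratio_gap n" x "Suc k"] ratio_gap_bounds(1) x
          transfer_pow_scale[of "Suc k" 0 "\<lambda>_. 0"] by simp
      have "X \<le> ratio_inf (n + Suc k) - ratio_inf n"
      \<comment> \<open>Replacing the supremum by the smaller value at x is legitimate only for
        nonnegative X; for negative X monotonicity of the infimum is enough.\<close>
      proof (cases "X \<ge> 0")
        case True
        have "X * iter1 (n + Suc k) x \<le> X * iter1_sup n"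
          using True iter1_le_sup[OF x(1), of "n + Suc k"] iter1_sup_antimono[of n "n + Suc k"]
          by (intro mult_left_mono) auto
        also have "\<dots> \<le> (ratio_inf (n + Suc k) - ratio_inf n) * iter1 (n + Suc k) x"
          using X unfolding h x(2)[symmetric] using pos by (simp add: iter1_ratio_def algebra_simps)
        finally show ?thesis using pos by simp
      next
        case False
        then show ?thesis
          using lift_Suc_mono_le[of ratio_inf n "n + Suc k"] ratio_inf_Suc by auto
      qed
      moreover have "ratio_sup (n + Suc k) \<le> ratio_sup n"
        using lift_Suc_antimono_le[of ratio_sup n "n + Suc k"] ratio_sup_Suc by auto
      ultimately show ?thesis unfolding X_def by (simp add: ratio_osc_def)
    qed
    then show ?thesis using d by blast
  qed
  then show ?thesis using c by blast
qed

section \<open>Asymptotics of the integrals of the sine products\<close>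

text \<open>Shifting the index by K bounds each partial sum by the first block plus \<rho> times
  itself.\<close>

lemma summable_of_block_contraction:
  fixes f :: "nat \<Rightarrow> real"
  assumes nn: "\<And>n. f n \<ge> 0" and "\<rho> < 1" "\<rho> \<ge> 0" and c: "\<And>n. f (n + K) \<le> \<rho> * f n"
  shows "summable f"
proof (rule summableI_nonneg_bounded)
  show "f n \<ge> 0" for n by (rule nn)
  fix n
  have "sum f {..<n} \<le> sum f {..<n + K}" by (intro sum_mono2 nn) auto
  also have "\<dots> = sum f {..<K} + (\<Sum>i<n. f (i + K))"
    by (induction n) (auto simp: add_ac)
  also have "\<dots> \<le> sum f {..<K} + \<rho> * sum f {..<n}"
    unfolding sum_distrib_left by (intro add_left_mono sum_mono c)
  finally have "(1 - \<rho>) * sum f {..<n} \<le> sum f {..<K}" by (simp add: algebra_simps)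
  then show "sum f {..<n} \<le> sum f {..<K} / (1 - \<rho>)" using assms by (simp add: field_simps)
qed

lemma summable_ratio_osc: "summable ratio_osc"
proof -
  obtain c where c: "c > 0" "\<And>k. \<exists>\<delta>>0. \<forall>n. ratio_osc (n + Suc k) \<le> ratio_osc n - \<delta> * (c * ratio_osc n - gap_lip n / 2 ^ k)"
    using ratio_osc_step by blast
  have "(\<lambda>k. (1 / 2) ^ k :: real) \<longlonglongrightarrow> 0" by (rule LIMSEQ_realpow_zero) auto
  then have "\<forall>\<^sub>F k in sequentially. (1 / 2) ^ k < c / 640"
    by (rule order_tendstoD) (use c in simp)
  moreover have "(\<lambda>k. (3 / 4) ^ k :: real) \<longlonglongrightarrow> 0" by (rule LIMSEQ_realpow_zero) auto
  then have "\<forall>\<^sub>F k in sequentially. (3 / 4) ^ k < (1 / 4 :: real)"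
    by (rule order_tendstoD) simp
  ultimately have "\<forall>\<^sub>F k in sequentially. (1 / 2) ^ k < c / 640 \<and> (3 / 4) ^ k < (1 / 4 :: real)"
    by eventually_elim simp
  then obtain k where k: "(1 / 2) ^ k < c / 640" "(3 / 4) ^ k < (1 / 4 :: real)"
    by (auto simp: eventually_sequentially)
  obtain \<delta>0 where d0: "\<delta>0 > 0" "\<And>n. ratio_osc (n + Suc k) \<le> ratio_osc n - \<delta>0 * (c * ratio_osc n - gap_lip n / 2 ^ k)"
    using c(2)[of k] by blast
  \<comment> \<open>The inequalities for the oscillation and for \<open>gap_lip\<close> are coupled,
    and the combination \<Phi> contracts. With this b, the term 80 b \<open>ratio_osc n\<close>
    spends exactly half of the gain \<delta>0 c \<open>ratio_osc n\<close>; 2^-k < c/640 makes the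
    loss \<delta>0 \<open>gap_lip n\<close> / 2^k at most b \<open>gap_lip n\<close> / 4, and
    (3/4)^k < 1/4 leaves another quarter.\<close>
  define b where "b = \<delta>0 * c / 160"
  have b: "b > 0" using d0 c by (simp add: b_def)
  define \<rho> where "\<rho> = max (1 - \<delta>0 * c / 2) (1 / 2)"
  define \<Phi> where "\<Phi> n = ratio_osc n + b * gap_lip n" for n
  have nn: "\<Phi> n \<ge> 0" for n using ratio_osc_nonneg[of n] gap_lip_nonneg[of n] b by (simp add: \<Phi>_def)
  have "summable \<Phi>"
  proof (rule summable_of_block_contraction[OF nn, where \<rho> = \<rho>])
    show "\<rho> < 1" "\<rho> \<ge> 0" using d0 c by (auto simp: \<rho>_def)
    fix n
    have g: "gap_lip n \<ge> 0" and o: "ratio_osc n \<ge> 0" by (rule gap_lip_nonneg ratio_osc_nonneg)+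
    have "b * gap_lip (n + Suc k) \<le> b * ((3 / 4) ^ Suc k * gap_lip n + 80 * ratio_osc n)"
      using b by (intro mult_left_mono gap_lip_add) auto
    also have "\<dots> \<le> b * (1 / 4 * gap_lip n + 80 * ratio_osc n)"
      using b k(2) g by (intro mult_left_mono add_right_mono mult_right_mono) auto
    finally have 1: "b * gap_lip (n + Suc k) \<le> b * gap_lip n / 4 + \<delta>0 * (c * ratio_osc n) / 2"
      by (simp add: b_def algebra_simps)
    have "\<delta>0 * (gap_lip n * (1 / 2) ^ k) \<le> \<delta>0 * (gap_lip n * (c / 640))"
      using d0 g k by (intro mult_left_mono) auto
    then have 2: "\<delta>0 * (gap_lip n / 2 ^ k) \<le> b * gap_lip n / 4"
      by (simp add: b_def power_one_over field_simps)
    have "ratio_osc (n + Suc k) \<le> ratio_osc n - \<delta>0 * (c * ratio_osc n) + \<delta>0 * (gap_lip n / 2 ^ k)"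
      using d0(2)[of n] by (simp add: right_diff_distrib)
    with 1 2 have "\<Phi> (n + Suc k) \<le> ratio_osc n - \<delta>0 * (c * ratio_osc n) / 2 + b * gap_lip n / 2"
      unfolding \<Phi>_def by linarith
    also have "\<dots> = (1 - \<delta>0 * c / 2) * ratio_osc n + 1 / 2 * (b * gap_lip n)"
      by (simp add: algebra_simps)
    also have "\<dots> \<le> \<rho> * ratio_osc n + \<rho> * (b * gap_lip n)"
      using o g b by (intro add_mono mult_right_mono) (auto simp: \<rho>_def)
    finally show "\<Phi> (n + Suc k) \<le> \<rho> * \<Phi> n" by (simp add: \<Phi>_def algebra_simps)
  qed
  then show ?thesis
    by (rule summable_comparison_test_ev[rotated])
       (use ratio_osc_nonneg gap_lip_nonneg b in \<open>auto simp: \<Phi>_def\<close>)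
qed

text \<open>Integration squeezes I(n+1)/I(n) between \<open>ratio_inf n\<close> and
  \<open>ratio_sup n\<close>, so I(n+1) / (c I(n)) differs from 1 by at most twice the oscillation.
  Convergence of the ratios alone would give only a growth rate; summability makes the infinite
  product converge to a nonzero limit, which is \<kappa>.\<close>

theorem sine_product_integral_asymp:
  "\<exists>\<kappa> c. \<kappa> > 0 \<and> c > 1 / 2 \<and> sine_product_integral \<sim>[at_top] (\<lambda>L. \<kappa> * c ^ L)"
proof -
  let ?I = sine_product_integral
  have Ipos: "?I n > 0" for n by (rule sine_product_integral_pos)
  have I1: "ratio_inf n * ?I n \<le> ?I (Suc n)" for n
    using integral_iter1_mono[of "ratio_inf n" n 1 "Suc n"] ratio_bounds(1) by simp
  have I2: "?I (Suc n) \<le> ratio_sup n * ?I n" for n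
    using integral_iter1_mono[of 1 "Suc n" "ratio_sup n" n] ratio_bounds(2) by simp
  have osc0: "ratio_osc \<longlonglongrightarrow> 0" by (rule summable_LIMSEQ_zero[OF summable_ratio_osc])
  have mono: "incseq ratio_inf" and anti: "decseq ratio_sup"
    by (auto intro!: incseq_SucI decseq_SucI ratio_inf_Suc ratio_sup_Suc)
  have bound: "ratio_inf n \<le> ratio_sup 0" for n
    using ratio_inf_le_sup[of n] decseqD[OF anti, of 0 n] by simp
  obtain c where c: "ratio_inf \<longlonglongrightarrow> c" using incseq_convergent[OF mono] bound by blast
  have cs: "ratio_sup \<longlonglongrightarrow> c"
    using tendsto_add[OF c osc0] by (simp add: ratio_osc_def)
  have ge: "ratio_inf n \<le> c" for n using incseq_le[OF mono c] .
  have le: "c \<le> ratio_sup n" for n using decseq_ge[OF anti cs] .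
  have c2: "c \<ge> 1 / 2" using ge[of 0] ratio_inf_ge_half[of 0] by simp
  define t where "t n = ?I (Suc n) / (c * ?I n)" for n
  have t1: "\<bar>t n - 1\<bar> \<le> 2 * ratio_osc n" for n
  proof -
    have "\<bar>?I (Suc n) - c * ?I n\<bar> \<le> ratio_osc n * ?I n"
    proof -
      have "ratio_inf n * ?I n \<le> c * ?I n" "c * ?I n \<le> ratio_sup n * ?I n"
        using ge le Ipos[of n] by (simp_all add: mult_right_mono)
      then show ?thesis using I1[of n] I2[of n] unfolding ratio_osc_def left_diff_distrib by linarith
    qed
    moreover have "t n - 1 = (?I (Suc n) - c * ?I n) / (c * ?I n)"
      using Ipos[of n] c2 by (simp add: t_def field_simps)
    moreover have "c * ?I n > 0" using Ipos[of n] c2 by simp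
    ultimately have "\<bar>t n - 1\<bar> \<le> ratio_osc n * ?I n / (c * ?I n)"
      by (simp only: abs_div_pos[symmetric] divide_right_mono less_imp_le)
    also have "\<dots> = ratio_osc n / c" using Ipos[of n] by simp
    also have "\<dots> \<le> ratio_osc n / (1 / 2)"
      using c2 ratio_osc_nonneg[of n] by (intro divide_left_mono) auto
    finally show ?thesis by simp
  qed
  have tpos: "t n > 0" for n using Ipos c2 by (simp add: t_def)
  have "summable (\<lambda>n. norm (t n - 1))"
    by (rule summable_comparison_test_ev[OF _ summable_mult[OF summable_ratio_osc, of 2]])
       (use t1 in auto)
  then have conv: "convergent_prod t"
    using abs_convergent_prod_imp_convergent_prod summable_imp_abs_convergent_prod by blast
  have prod: "prod t {..n} = ?I (Suc n) / c ^ Suc n" for n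
  proof (induction n)
    case 0
    show ?case by (simp add: t_def sine_product_integral_eq[of 0] iter1_def)
  next
    case (Suc n)
    have "prod t {..Suc n} = ?I (Suc n) / c ^ Suc n * t (Suc n)" using Suc by simp
    also have "\<dots> = ?I (Suc (Suc n)) / c ^ Suc (Suc n)"
      using Ipos[of "Suc n"] c2 by (simp add: t_def field_simps)
    finally show ?case .
  qed
  define \<kappa> where "\<kappa> = prodinf t"
  have "\<kappa> \<noteq> 0" unfolding \<kappa>_def using prodinf_nonzero[OF conv] tpos by (metis less_irrefl)
  have lim: "(\<lambda>n. ?I (Suc n) / c ^ Suc n) \<longlonglongrightarrow> \<kappa>"
    using convergent_prod_LIMSEQ[OF conv] unfolding prod \<kappa>_def .
  have "\<kappa> \<ge> 0" by (rule LIMSEQ_le_const[OF lim]) (use Ipos c2 in \<open>auto intro!: exI[of _ 0] less_imp_le\<close>)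
  with \<open>\<kappa> \<noteq> 0\<close> have k: "\<kappa> > 0" by simp
  have lim': "(\<lambda>n. ?I n / c ^ n) \<longlonglongrightarrow> \<kappa>" using lim by (rule LIMSEQ_imp_Suc)
  have "(\<lambda>n. ?I n / c ^ n / \<kappa>) \<longlonglongrightarrow> 1" using tendsto_divide[OF lim' tendsto_const, of \<kappa>] k by simp
  then have asym: "?I \<sim>[at_top] (\<lambda>L. \<kappa> * c ^ L)"
    by (intro asymp_equivI') (simp add: mult.commute)
  \<comment> \<open>Serves to exclude c = 1/2: two steps multiply the integral by at least 7/20, so
    c^2 >= 7/20 > 1/4.\<close>
  have step2: "7 / 20 * ?I n \<le> ?I (n + 2)" for n
  proof -
    have "7 / 20 * iter1 n x \<le> iter1 (n + 2) x" if "x \<in> {0..1}" for x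
    proof -
      have "7 / 20 * iter1 n x = (transfer ^^ n) (\<lambda>_. 7 / 20 * 1) x"
        by (subst transfer_pow_scale) (simp add: iter1_def)
      also have "\<dots> \<le> (transfer ^^ n) (iter1 2) x"
        using that by (intro transfer_pow_mono) (use iter1_2_ge in auto)
      finally show ?thesis unfolding iter1_add .
    qed
    then show ?thesis using integral_iter1_mono[of "7/20" n 1 "n + 2"] by simp
  qed
  have r: "(\<lambda>n. ?I (Suc n) / ?I n) \<longlonglongrightarrow> c" using asymp_equiv_geometric_ratio[OF k _ asym] c2 by simp
  from tendsto_mult[OF LIMSEQ_Suc[OF r] r] have "(\<lambda>n. ?I (n + 2) / ?I n) \<longlonglongrightarrow> c * c"
    using Ipos by (simp add: less_imp_neq[symmetric])
  then have "c * c \<ge> 7 / 20"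
    by (rule LIMSEQ_le_const) (use step2 Ipos in \<open>auto simp: field_simps intro!: exI[of _ 0]\<close>)
  moreover have "c * c = 1 / 4" if "c = 1 / 2" unfolding that by simp
  ultimately have "c \<noteq> 1 / 2" by auto
  with c2 have "c > 1 / 2" by simp
  with k asym show ?thesis by blast
qed

corollary fouvry_mauduit_const_asymp:
  "\<exists>\<kappa>>0. sine_product_integral \<sim>[at_top] (\<lambda>L. \<kappa> * fouvry_mauduit_const ^ L)"
  "fouvry_mauduit_const > 1 / 2"
  using sine_product_integral_asymp fouvry_mauduit_const_eqI by auto

section \<open>Discrepancy and exponential sums\<close>

definition unit_exp :: "real \<Rightarrow> complex" where
  "unit_exp x = cis (2 * pi * x)"

lemma unit_exp_0 [simp]: "unit_exp 0 = 1"
  by (simp add: unit_exp_def)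

lemma unit_exp_add: "unit_exp (x + y) = unit_exp x * unit_exp y"
  by (simp add: unit_exp_def cis_mult algebra_simps)

lemma unit_exp_minus: "unit_exp (- x) = cnj (unit_exp x)"
  by (simp add: unit_exp_def cis_cnj)

lemma norm_unit_exp [simp]: "norm (unit_exp x) = 1"
  by (simp add: unit_exp_def)

lemma unit_exp_of_int [simp]: "unit_exp (of_int n) = 1"
  using cis_multiple_2pi[of "of_int n"] by (simp add: unit_exp_def)

lemma unit_exp_1 [simp]: "unit_exp 1 = 1"
  using unit_exp_of_int[of 1] by simp

lemma unit_exp_of_nat [simp]: "unit_exp (real n) = 1"
  using unit_exp_of_int[of "int n"] by simp

lemma unit_exp_frac: "unit_exp (real h * frac x) = unit_exp (real h * x)"
proof -
  have "real h * x = real h * frac x + of_int (int h * \<lfloor>x\<rfloor>)"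
    by (simp add: frac_def algebra_simps)
  then show ?thesis by (simp add: unit_exp_add del: of_int_mult)
qed

lemma unit_exp_power: "unit_exp x ^ n = unit_exp (real n * x)"
  by (simp add: unit_exp_def Complex.DeMoivre algebra_simps)

lemma norm_1_minus_unit_exp: "norm (1 - unit_exp x) = 2 * \<bar>sin (pi * x)\<bar>"
proof -
  have "(norm (1 - unit_exp x))\<^sup>2 = (1 - cos (2 * (pi * x)))\<^sup>2 + (sin (2 * (pi * x)))\<^sup>2"
    by (simp add: cmod_power2 unit_exp_def mult.assoc)
  also have "\<dots> = 1 + (cos (2 * (pi * x)))\<^sup>2 + (sin (2 * (pi * x)))\<^sup>2 - 2 * cos (2 * (pi * x))"
    by (simp add: power2_diff algebra_simps)
  also have "\<dots> = 2 - 2 * cos (2 * (pi * x))"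
    using sin_cos_squared_add2[of "2 * (pi * x)"] by (simp del: sin_cos_squared_add2 sin_cos_squared_add)
  also have "\<dots> = (2 * \<bar>sin (pi * x)\<bar>)\<^sup>2"
    by (simp add: cos_double_sin power_mult_distrib)
  finally show ?thesis by (rule power2_eq_imp_eq) auto
qed

lemma continuous_on_unit_exp [continuous_intros]:
  fixes g :: "real \<Rightarrow> real"
  shows "continuous_on A g \<Longrightarrow> continuous_on A (\<lambda>x. unit_exp (g x))"
  unfolding unit_exp_def by (intro continuous_intros)

lemma has_vector_derivative_unit_exp:
  "((\<lambda>t. unit_exp (c * t)) has_vector_derivative (2 * pi * c * \<i>) * unit_exp (c * t)) (at t within A)"
proof -
  define k where "k = 2 * pi * c * \<i>"
  have eq: "unit_exp (c * t) = exp (k * of_real t)" for t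
    by (simp add: unit_exp_def cis_conv_exp k_def mult_ac)
  have "((\<lambda>z. exp (k * z)) has_field_derivative k * exp (k * of_real t)) (at (of_real t))"
    by (auto intro!: derivative_eq_intros)
  from has_vector_derivative_real_field[OF this] show ?thesis by (simp add: eq k_def)
qed

text \<open>Slope 1 instead of the optimal 2 costs only constants. Up to 1/3 it follows from cos >=
  1/2 and pi >= 2, beyond from sin(pi t) >= sin(pi/6) = 1/2.\<close>

lemma sin_pi_ge:
  assumes "0 \<le> t" "t \<le> 1 / 2"
  shows "t \<le> sin (pi * t)"
proof (cases "t \<le> 1 / 3")
  case True
  have "sin (pi * 0) - 0 \<le> sin (pi * t) - t"
  proof (rule DERIV_nonneg_imp_nondecreasing[OF assms(1)])
    fix s assume s: "0 \<le> s" "s \<le> t"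
    have "pi * s \<le> pi * (1 / 3)" using s True by (intro mult_left_mono) auto
    then have "cos (pi / 3) \<le> cos (pi * s)" using s by (intro cos_monotone_0_pi_le) auto
    then have "pi * (1 / 2) \<le> pi * cos (pi * s)" by (intro mult_left_mono) (auto simp: cos_60)
    then have "0 \<le> cos (pi * s) * pi - 1" using pi_ge_two by (subst mult.commute) linarith
    moreover have "((\<lambda>x. sin (pi * x) - x) has_real_derivative cos (pi * s) * pi - 1) (at s)"
      by (auto intro!: derivative_eq_intros)
    ultimately show "\<exists>y. ((\<lambda>x. sin (pi * x) - x) has_real_derivative y) (at s) \<and> 0 \<le> y" by blast
  qed
  then show ?thesis by simp
next
  case False
  have "pi * (1 / 6) \<le> pi * t" "pi * t \<le> pi * (1 / 2)" using False assms by (auto intro!: mult_left_mono)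
  then have "sin (pi / 6) \<le> sin (pi * t)" by (intro sin_monotone_2pi_le) auto
  then show ?thesis using assms by (simp add: sin_30)
qed

section \<open>The Fejer kernel and smoothed indicators of intervals\<close>

definition fejer :: "nat \<Rightarrow> real \<Rightarrow> real" where
  "fejer M t = (norm (\<Sum>j<M. unit_exp (real j * t)))\<^sup>2 / real M"

lemma fejer_nonneg: "fejer M t \<ge> 0"
  by (simp add: fejer_def)

lemma continuous_on_fejer [continuous_intros]:
  fixes g :: "real \<Rightarrow> real"
  shows "continuous_on A g \<Longrightarrow> continuous_on A (\<lambda>x. fejer M (g x))"
  unfolding fejer_def by (cases "M = 0") (auto intro!: continuous_intros)

lemma fejer_complex: "complex_of_real (fejer M t) = (\<Sum>j<M. \<Sum>k<M. unit_exp ((real j - real k) * t)) / M"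
proof -
  have "complex_of_real ((norm (\<Sum>j<M. unit_exp (real j * t)))\<^sup>2)
      = (\<Sum>j<M. \<Sum>k<M. unit_exp (real j * t) * cnj (unit_exp (real k * t)))"
    by (simp only: complex_norm_square sum_product cnj_sum)
  also have "\<dots> = (\<Sum>j<M. \<Sum>k<M. unit_exp ((real j - real k) * t))"
    by (simp add: unit_exp_add[symmetric] unit_exp_minus[symmetric] left_diff_distrib)
  finally show ?thesis by (simp add: fejer_def)
qed

lemma fejer_cos: "fejer M t = (\<Sum>j<M. \<Sum>k<M. cos (2 * pi * ((real j - real k) * t))) / M"
proof -
  have "fejer M t = Re (complex_of_real (fejer M t))" by simp
  also have "\<dots> = (\<Sum>j<M. \<Sum>k<M. cos (2 * pi * ((real j - real k) * t))) / M"
    unfolding fejer_complex by (simp add: Re_divide_of_nat unit_exp_def)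
  finally show ?thesis .
qed

lemma fejer_minus: "fejer M (- t) = fejer M t"
  by (simp add: fejer_cos)

lemma fejer_le_sin:
  assumes "M > 0" "sin (pi * t) \<noteq> 0"
  shows "fejer M t \<le> 1 / (real M * (sin (pi * t))\<^sup>2)"
proof -
  let ?S = "\<Sum>j<M. unit_exp (real j * t)"
  have "?S * (1 - unit_exp t) = 1 - unit_exp t ^ M"
    using one_diff_power_eq[of "unit_exp t" M] by (simp add: unit_exp_power mult.commute)
  then have "norm ?S * norm (1 - unit_exp t) = norm (1 - unit_exp t ^ M)"
    by (metis norm_mult)
  also have "\<dots> \<le> norm (1::complex) + norm (unit_exp t ^ M)" by (rule norm_triangle_ineq4)
  finally have "norm ?S * \<bar>sin (pi * t)\<bar> \<le> 1"
    by (simp add: norm_1_minus_unit_exp norm_power)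
  then have "(norm ?S * \<bar>sin (pi * t)\<bar>)\<^sup>2 \<le> 1" by (intro power_le_one) auto
  then show ?thesis using assms by (simp add: fejer_def field_simps power_mult_distrib)
qed

lemma fejer_le:
  assumes "M > 0" "0 < \<eta>" "\<eta> \<le> t" "t \<le> 1 - \<eta>"
  shows "fejer M t \<le> 1 / (real M * \<eta>\<^sup>2)"
proof -
  have "\<eta> \<le> sin (pi * t)"
  proof (cases "t \<le> 1 / 2")
    case True
    then show ?thesis using sin_pi_ge[of t] assms by linarith
  next
    case False
    have "sin (pi * t) = sin (pi * (1 - t))" by (simp add: algebra_simps sin_diff)
    then show ?thesis using sin_pi_ge[of "1 - t"] False assms by linarith
  qed
  then have "fejer M t \<le> 1 / (real M * (sin (pi * t))\<^sup>2)"
    using assms by (intro fejer_le_sin) auto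
  also have "\<dots> \<le> 1 / (real M * \<eta>\<^sup>2)"
    using assms \<open>\<eta> \<le> sin (pi * t)\<close> by (intro divide_left_mono mult_left_mono power_mono mult_pos_pos) auto
  finally show ?thesis .
qed

lemma has_integral_cos_window:
  assumes "m \<noteq> 0" "u \<le> v"
  shows "((\<lambda>t. cos (2 * pi * (m * (x - t)))) has_integral
      (sin (2 * pi * (m * (x - u))) - sin (2 * pi * (m * (x - v)))) / (2 * pi * m)) {u..v}"
proof -
  have "((\<lambda>t. cos (2 * pi * (m * (x - t)))) has_integral
      - sin (2 * pi * (m * (x - v))) / (2 * pi * m) - (- sin (2 * pi * (m * (x - u))) / (2 * pi * m))) {u..v}"
    using assms by (intro fundamental_theorem_of_calculus)
      (auto intro!: derivative_eq_intros simp: has_real_derivative_iff_has_vector_derivative[symmetric])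
  then show ?thesis by (simp add: diff_divide_distrib algebra_simps)
qed

lemma integral_cos_window_period:
  assumes "m \<in> \<int>" "m \<noteq> 0"
  shows "((\<lambda>t. cos (2 * pi * (m * (x - t)))) has_integral 0) {u..u + 1}"
proof -
  obtain k where k: "m = of_int k" using assms by (auto elim: Ints_cases)
  have "sin (2 * pi * (m * (x - u))) = sin (2 * pi * (m * (x - (u + 1))) + 2 * pi * of_int k)"
    by (simp add: k algebra_simps)
  also have "\<dots> = sin (2 * pi * (m * (x - (u + 1))))"
    unfolding sin_add by (simp add: sin_int_2pin cos_int_2pin)
  finally show ?thesis using has_integral_cos_window[of m u "u + 1" x] assms by simp
qed

lemma integral_fejer_period:
  assumes "M > 0"
  shows "integral {u..u + 1} (\<lambda>t. fejer M (x - t)) = 1"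
proof -
  have *: "((\<lambda>t. cos (2 * pi * ((real j - real k) * (x - t)))) has_integral (if j = k then 1 else 0)) {u..u + 1}" for j k
  proof (cases "j = k")
    case True
    then show ?thesis using has_integral_const_real[of "1::real" u "u + 1"] by simp
  next
    case False
    then show ?thesis using integral_cos_window_period[of "real j - real k" x u] by simp
  qed
  have "((\<lambda>t. fejer M (x - t)) has_integral (\<Sum>j<M. \<Sum>k<M. (if j = k then 1 else 0)) / real M) {u..u + 1}"
    unfolding fejer_cos by (intro has_integral_divide has_integral_sum *) auto
  then show ?thesis using assms by (simp add: integral_unique)
qed

text \<open>The indicator of [u, v] modulo 1, convolved with the Fejer kernel. As the kernel has
  period 1, u may be negative and v may exceed 1, which is how widened intervals are
  handled.\<close>

definition fejer_window :: "nat \<Rightarrow> real \<Rightarrow> real \<Rightarrow> real \<Rightarrow> real" where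
  "fejer_window M u v x = integral {u..v} (\<lambda>t. fejer M (x - t))"

lemma fejer_integrable: "(\<lambda>t. fejer M (x - t)) integrable_on {u..v}"
  by (intro integrable_continuous_real continuous_intros)

lemma fejer_window_nonneg: "fejer_window M u v x \<ge> 0"
  unfolding fejer_window_def by (intro Henstock_Kurzweil_Integration.integral_nonneg fejer_integrable fejer_nonneg)

lemma fejer_window_mono:
  assumes "u' \<le> u" "v \<le> v'"
  shows "fejer_window M u v x \<le> fejer_window M u' v' x"
  unfolding fejer_window_def
  by (rule integral_subset_le) (use assms fejer_integrable fejer_nonneg in auto)

lemma fejer_window_le_1:
  assumes "M > 0" "v \<le> u + 1"
  shows "fejer_window M u v x \<le> 1"
  using fejer_window_mono[of u u v "u + 1" M x] assms integral_fejer_period[of M u x]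
  by (simp add: fejer_window_def)

lemma fejer_window_le:
  assumes "u \<le> v" "v - u \<le> 1" "\<And>t. t \<in> {u..v} \<Longrightarrow> fejer M (x - t) \<le> B" "0 \<le> B"
  shows "fejer_window M u v x \<le> B"
proof -
  have "fejer_window M u v x \<le> integral {u..v} (\<lambda>_. B)"
    unfolding fejer_window_def by (intro integral_le fejer_integrable assms) auto
  also have "\<dots> = (v - u) * B" using assms by simp
  also have "\<dots> \<le> B" using assms by (intro mult_left_le_one_le) auto
  finally show ?thesis .
qed

text \<open>Over the period starting at x - \<eta> the kernel has mass 1. Away from x by at least
  \<eta> modulo 1 it is at most 1 / (M \<eta>^2), and the remaining mass lies inside the
  window.\<close>

lemma fejer_window_ge:
  assumes "M > 0" "0 < \<eta>" "\<eta> \<le> 1 / 2" "u \<le> x - \<eta>" "x + \<eta> \<le> v"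
  shows "fejer_window M u v x \<ge> 1 - 1 / (real M * \<eta>\<^sup>2)"
proof -
  have "1 = integral {x - \<eta>..x - \<eta> + 1} (\<lambda>t. fejer M (x - t))"
    using integral_fejer_period[OF assms(1)] by simp
  also have "\<dots> = fejer_window M (x - \<eta>) (x + \<eta>) x + fejer_window M (x + \<eta>) (x - \<eta> + 1) x"
    unfolding fejer_window_def
    by (subst Henstock_Kurzweil_Integration.integral_combine) (use assms fejer_integrable in auto)
  also have "fejer_window M (x + \<eta>) (x - \<eta> + 1) x \<le> 1 / (real M * \<eta>\<^sup>2)"
  proof (rule fejer_window_le)
    fix t assume t: "t \<in> {x + \<eta>..x - \<eta> + 1}"
    have "fejer M (x - t) = fejer M (t - x)" using fejer_minus[of M "t - x"] by simp
    also have "\<dots> \<le> 1 / (real M * \<eta>\<^sup>2)" using t assms by (intro fejer_le) auto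
    finally show "fejer M (x - t) \<le> 1 / (real M * \<eta>\<^sup>2)" .
  qed (use assms in auto)
  also have "fejer_window M (x - \<eta>) (x + \<eta>) x \<le> fejer_window M u v x"
    using assms by (intro fejer_window_mono) auto
  finally show ?thesis by simp
qed

text \<open>Each distance |j - k| occurs at most twice, once on each side of j.\<close>

lemma sum_offdiagonal_le:
  fixes g :: "nat \<Rightarrow> real"
  assumes g: "\<And>h. g h \<ge> 0" and j: "j < M"
  shows "(\<Sum>k\<in>{..<M} - {j}. g (nat \<bar>int j - int k\<bar>)) \<le> 2 * (\<Sum>h = 1..M. g h)"
proof -
  have "(\<Sum>k\<in>{..<M} - {j}. g (nat \<bar>int j - int k\<bar>))
      = (\<Sum>k\<in>{..<j}. g (nat \<bar>int j - int k\<bar>)) + (\<Sum>k\<in>{j<..<M}. g (nat \<bar>int j - int k\<bar>))"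
    by (subst sum.union_disjoint[symmetric]) (use j in \<open>auto intro!: sum.cong\<close>)
  also have "(\<Sum>k\<in>{..<j}. g (nat \<bar>int j - int k\<bar>)) = sum g ((\<lambda>k. j - k) ` {..<j})"
    by (subst sum.reindex) (auto intro!: inj_onI sum.cong arg_cong[of _ _ g])
  also have "\<dots> \<le> (\<Sum>h = 1..M. g h)" by (intro sum_mono2 g) (use j in auto)
  also have "(\<Sum>k\<in>{j<..<M}. g (nat \<bar>int j - int k\<bar>)) = sum g ((\<lambda>k. k - j) ` {j<..<M})"
    by (subst sum.reindex) (auto intro!: inj_onI sum.cong arg_cong[of _ _ g])
  also have "\<dots> \<le> (\<Sum>h = 1..M. g h)" by (intro sum_mono2 g) (use j in auto)
  finally show ?thesis by simp
qed

text \<open>In the double sum over (j, k) the diagonal integrates to the expected value, and a pair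
  at distance h contributes at most 1/(2h) times the exponential sum at frequency h, using pi >= 2.
  The two values of k at each distance cancel the 1/2, and the M values of j cancel the
  normalisation.\<close>

lemma sum_fejer_window:
  fixes x :: "nat \<Rightarrow> real"
  assumes "M > 0" "u \<le> v" "finite A"
  shows "\<bar>(\<Sum>n\<in>A. fejer_window M u v (x n)) - real (card A) * (v - u)\<bar>
      \<le> (\<Sum>h = 1..M. norm (\<Sum>n\<in>A. unit_exp (real h * x n)) / real h)"
proof -
  let ?c = "\<lambda>j k n t. cos (2 * pi * ((real j - real k) * (x n - t)))"
  define S where "S h = norm (\<Sum>n\<in>A. unit_exp (real h * x n))" for h :: nat
  define c where "c j k = (\<Sum>n\<in>A. (sin (2 * pi * ((real j - real k) * (x n - u)))
      - sin (2 * pi * ((real j - real k) * (x n - v)))) / (2 * pi * (real j - real k)))" for j k :: nat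
  define d where "d j k = (if j = k then real (card A) * (v - u) else c j k)" for j k
  have 1: "((\<lambda>t. \<Sum>n\<in>A. ?c j k n t) has_integral d j k) {u..v}" for j k
  proof (cases "j = k")
    case True
    then show ?thesis using has_integral_const_real[of "real (card A)" u v] assms by (simp add: d_def mult.commute)
  next
    case False
    have "((\<lambda>t. \<Sum>n\<in>A. ?c j k n t) has_integral c j k) {u..v}"
      unfolding c_def by (intro has_integral_sum has_integral_cos_window assms) (use False in auto)
    then show ?thesis using False by (simp add: d_def)
  qed
  have "((\<lambda>t. (\<Sum>j<M. \<Sum>k<M. \<Sum>n\<in>A. ?c j k n t) / real M)
      has_integral (\<Sum>j<M. \<Sum>k<M. d j k) / real M) {u..v}"
    by (intro has_integral_divide has_integral_sum 1) auto
  moreover have "(\<Sum>j<M. \<Sum>k<M. \<Sum>n\<in>A. ?c j k n t) / real M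
      = (\<Sum>n\<in>A. fejer M (x n - t))" for t
  proof -
    have "(\<Sum>j<M. \<Sum>k<M. \<Sum>n\<in>A. ?c j k n t)
        = (\<Sum>j<M. \<Sum>n\<in>A. \<Sum>k<M. ?c j k n t)"
      by (intro sum.cong refl sum.swap)
    also have "\<dots> = (\<Sum>n\<in>A. \<Sum>j<M. \<Sum>k<M. ?c j k n t)"
      by (rule sum.swap)
    finally show ?thesis unfolding fejer_cos sum_divide_distrib[symmetric] by simp
  qed
  ultimately have "((\<lambda>t. \<Sum>n\<in>A. fejer M (x n - t)) has_integral (\<Sum>j<M. \<Sum>k<M. d j k) / real M) {u..v}"
    by simp
  moreover have "((\<lambda>t. \<Sum>n\<in>A. fejer M (x n - t)) has_integral (\<Sum>n\<in>A. fejer_window M u v (x n))) {u..v}"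
    unfolding fejer_window_def
    by (intro has_integral_sum assms integrable_integral fejer_integrable)
  ultimately have eq: "(\<Sum>n\<in>A. fejer_window M u v (x n)) = (\<Sum>j<M. \<Sum>k<M. d j k) / real M"
    by (rule has_integral_unique[symmetric])
  have cle: "\<bar>c j k\<bar> \<le> S (nat \<bar>int j - int k\<bar>) / (2 * real (nat \<bar>int j - int k\<bar>))" if "j \<noteq> k" for j k
  proof -
    define m where "m = real j - real k"
    define h where "h = nat \<bar>int j - int k\<bar>"
    have h: "real h = \<bar>m\<bar>" "h > 0" using that by (auto simp: m_def h_def)
    have Sm: "norm (\<Sum>n\<in>A. unit_exp (m * x n)) = S h"
    proof (cases "m \<ge> 0")
      case True
      then show ?thesis using h by (simp add: S_def)
    next
      case False
      then have "(\<Sum>n\<in>A. unit_exp (m * x n)) = cnj (\<Sum>n\<in>A. unit_exp (real h * x n))"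
        using h by (simp add: unit_exp_minus[symmetric])
      then have "norm (\<Sum>n\<in>A. unit_exp (m * x n)) = norm (cnj (\<Sum>n\<in>A. unit_exp (real h * x n)))"
        by (rule arg_cong)
      also have "\<dots> = S h" unfolding S_def by (rule complex_mod_cnj)
      finally show ?thesis .
    qed
    define X where "X w = (\<Sum>n\<in>A. sin (2 * pi * (m * (x n - w))))" for w
    have s: "\<bar>X w\<bar> \<le> S h" for w
    proof -
      have "X w = Im (\<Sum>n\<in>A. unit_exp (m * (x n - w)))"
        by (simp add: unit_exp_def X_def)
      also have "(\<Sum>n\<in>A. unit_exp (m * (x n - w))) = unit_exp (- (m * w)) * (\<Sum>n\<in>A. unit_exp (m * x n))"
        by (simp add: sum_distrib_left unit_exp_add[symmetric] algebra_simps)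
      finally have "\<bar>X w\<bar> \<le> norm (unit_exp (- (m * w)) * (\<Sum>n\<in>A. unit_exp (m * x n)))"
        by (simp only: abs_Im_le_cmod)
      also have "\<dots> = S h" by (simp only: norm_mult norm_unit_exp Sm mult_1)
      finally show ?thesis .
    qed
    have "c j k = (X u - X v) / (2 * pi * m)"
      unfolding c_def m_def[symmetric] X_def sum_divide_distrib[symmetric] sum_subtractf ..
    then have "\<bar>c j k\<bar> = \<bar>X u - X v\<bar> / (2 * pi * real h)"
      using h(1) by (simp add: abs_mult)
    also have "\<dots> \<le> (S h + S h) / (2 * pi * real h)"
      using s[of u] s[of v] h by (intro divide_right_mono) auto
    also have "\<dots> = S h / (pi * real h)" by simp
    also have "\<dots> \<le> S h / (2 * real h)"
    proof (rule divide_left_mono)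
      show "2 * real h \<le> pi * real h" using pi_ge_two by (intro mult_right_mono) auto
    qed (use h in \<open>auto simp: S_def\<close>)
    finally show ?thesis by (simp add: h_def)
  qed
  have "(\<Sum>j<M. \<Sum>k<M. d j k) = (\<Sum>j<M. d j j + (\<Sum>k\<in>{..<M} - {j}. d j k))"
    by (intro sum.cong refl sum.remove) auto
  also have "\<dots> = real M * (real (card A) * (v - u)) + (\<Sum>j<M. \<Sum>k\<in>{..<M} - {j}. c j k)"
    by (simp add: sum.distrib d_def cong: sum.cong_simp)
  finally have "(\<Sum>j<M. \<Sum>k<M. d j k) / real M - real (card A) * (v - u) = (\<Sum>j<M. \<Sum>k\<in>{..<M} - {j}. c j k) / real M"
    using assms by (simp add: add_divide_distrib)
  also have "\<bar>\<dots>\<bar> \<le> (\<Sum>j<M. \<Sum>h = 1..M. S h / real h) / real M"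
  proof -
    have "\<bar>\<Sum>j<M. \<Sum>k\<in>{..<M} - {j}. c j k\<bar> \<le> (\<Sum>j<M. \<Sum>k\<in>{..<M} - {j}. \<bar>c j k\<bar>)"
      by (intro order.trans[OF sum_abs] sum_mono) auto
    also have "\<dots> \<le> (\<Sum>j<M. \<Sum>k\<in>{..<M} - {j}. S (nat \<bar>int j - int k\<bar>) / (2 * real (nat \<bar>int j - int k\<bar>)))"
      by (intro sum_mono cle) auto
    also have "\<dots> \<le> (\<Sum>j<M. 2 * (\<Sum>h = 1..M. S h / (2 * real h)))"
      by (intro sum_mono sum_offdiagonal_le[of "\<lambda>h. S h / (2 * real h)"]) (auto simp: S_def)
    also have "\<dots> = (\<Sum>j<M. \<Sum>h = 1..M. S h / real h)"
      by (simp add: sum_distrib_left)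
    finally show ?thesis unfolding abs_divide abs_of_nat by (rule divide_right_mono) simp
  qed
  finally show ?thesis unfolding eq S_def using assms by simp
qed


section \<open>Star-discrepancy against exponential sums\<close>

lemma bdd_above_discrepancy:
  "bdd_above ((\<lambda>a. \<bar>real (card {n \<in> {1..N}. x n \<in> {0..a}}) / real N - a\<bar>) ` {0..1::real})"
proof (rule bdd_aboveI)
  fix y assume "y \<in> (\<lambda>a. \<bar>real (card {n \<in> {1..N}. x n \<in> {0..a}}) / real N - a\<bar>) ` {0..1::real}"
  then obtain a where a: "a \<in> {0..1}" "y = \<bar>real (card {n \<in> {1..N}. x n \<in> {0..a}}) / real N - a\<bar>" by blast
  define c where "c = card {n \<in> {1..N}. x n \<in> {0..a}}"
  have "c \<le> card {1..N}" unfolding c_def by (intro card_mono) auto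
  then have "real c / real N \<le> 1" by (auto simp: divide_le_eq)
  moreover have "real c / real N \<ge> 0" by simp
  moreover have "y = \<bar>real c / real N - a\<bar>" using a by (simp add: c_def)
  ultimately show "y \<le> 1" using a(1)[unfolded atLeastAtMost_iff] by linarith
qed

lemma star_discrepancy_ge:
  assumes "a \<in> {0..1}"
  shows "\<bar>real (card {n \<in> {1..N}. x n \<in> {0..a}}) - real N * a\<bar> \<le> real N * star_discrepancy x N"
proof (cases "N = 0")
  case False
  define c where "c = card {n \<in> {1..N}. x n \<in> {0..a}}"
  have "\<bar>real c / real N - a\<bar> \<le> star_discrepancy x N"
    unfolding star_discrepancy_def c_def by (rule cSUP_upper[OF assms bdd_above_discrepancy])
  then have "real N * \<bar>real c / real N - a\<bar> \<le> real N * star_discrepancy x N"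
    by (intro mult_left_mono) auto
  moreover have "real N * \<bar>real c / real N - a\<bar> = \<bar>real N * (real c / real N - a)\<bar>"
    by (simp add: abs_mult)
  ultimately show ?thesis using False unfolding c_def[symmetric] by (simp add: right_diff_distrib)
qed simp

lemma star_discrepancy_le:
  assumes "N > 0" "\<And>a. a \<in> {0..1} \<Longrightarrow> \<bar>real (card {n \<in> {1..N}. x n \<in> {0..a}}) - real N * a\<bar> \<le> B"
  shows "real N * star_discrepancy x N \<le> B"
proof -
  let ?c = "\<lambda>a. card {n \<in> {1..N}. x n \<in> {0..a}}"
  have "star_discrepancy x N \<le> B / real N"
    unfolding star_discrepancy_def
  proof (rule cSUP_least)
    fix a :: real assume a: "a \<in> {0..1}"
    have "\<bar>real c / real N - a\<bar> = \<bar>real c - real N * a\<bar> / real N" for c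
    proof -
      have "real c / real N - a = (real c - real N * a) / real N"
        using assms(1) by (simp add: field_simps)
      then show ?thesis by (simp only: abs_divide abs_of_nat)
    qed
    also have "\<bar>real (?c a) - real N * a\<bar> / real N \<le> B / real N"
      using assms(2)[OF a] by (intro divide_right_mono) auto
    finally show "\<bar>real (?c a) / real N - a\<bar> \<le> B / real N" .
  qed auto
  then show ?thesis using assms(1) by (simp add: field_simps)
qed

text \<open>The count is compared from above with the window widened by \<eta> on both sides, and
  from below with the window narrowed by \<eta>. The simple Fejer kernel in place of extremal
  majorants leaves \<eta> as a free parameter, to be balanced against M.\<close>

theorem erdos_turan:
  assumes N: "N > 0" and M: "M > 0" and eta: "0 < \<eta>" "\<eta> \<le> 1 / 2"
    and x: "\<And>n. n \<in> {1..N} \<Longrightarrow> 0 \<le> x n \<and> x n < 1"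
  shows "real N * star_discrepancy x N \<le> 2 * \<eta> * real N + real N / (real M * \<eta>\<^sup>2)
      + (\<Sum>h = 1..M. norm (\<Sum>n = 1..N. unit_exp (real h * x n)) / real h)"
    (is "_ \<le> _ + _ + ?R")
proof (rule star_discrepancy_le[OF N])
  fix a :: real assume a: "a \<in> {0..1}"
  define \<tau> where "\<tau> = 1 / (real M * \<eta>\<^sup>2)"
  have t0: "\<tau> \<ge> 0" by (simp add: \<tau>_def)
  define C where "C = {n \<in> {1..N}. x n \<in> {0..a}}"
  have C: "C \<subseteq> {1..N}" "finite C" by (auto simp: C_def)
  have cN: "card C \<le> N" using card_mono[OF _ C(1)] by simp
  have ind: "(\<Sum>n = 1..N. if n \<in> C then b else d) = real (card C) * b + real (N - card C) * d" for b d :: real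
  proof -
    have "{1..N} \<inter> {n. n \<in> C} = C" "{1..N} \<inter> - {n. n \<in> C} = {1..N} - C" using C by auto
    then show ?thesis using C by (simp add: sum.If_cases card_Diff_subset)
  qed
  have R: "\<bar>(\<Sum>n = 1..N. fejer_window M u v (x n)) - real N * (v - u)\<bar> \<le> ?R" if "u \<le> v" for u v
    using sum_fejer_window[OF M that, of "{1..N}" x] by simp
  have R0: "?R \<ge> 0" by (intro sum_nonneg) auto
  have upper: "real (card C) \<le> real N * a + 2 * \<eta> * real N + real N * \<tau> + ?R"
  proof -
    have "real (card C) * (1 - \<tau>) = (\<Sum>n = 1..N. if n \<in> C then 1 - \<tau> else 0)"
      using ind[of "1 - \<tau>" 0] by simp
    also have "\<dots> \<le> (\<Sum>n = 1..N. fejer_window M (- \<eta>) (a + \<eta>) (x n))"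
      unfolding \<tau>_def using eta
      by (intro sum_mono) (auto simp: C_def fejer_window_nonneg intro!: fejer_window_ge M)
    also have "\<dots> \<le> real N * (a + \<eta> - (- \<eta>)) + ?R"
      using R[of "- \<eta>" "a + \<eta>"] a eta by auto
    finally have "real (card C) \<le> real N * a + 2 * \<eta> * real N + real (card C) * \<tau> + ?R"
      by (simp add: algebra_simps)
    moreover have "real (card C) * \<tau> \<le> real N * \<tau>" using cN t0 by (intro mult_right_mono) auto
    ultimately show ?thesis by linarith
  qed
  have lower: "real N * a \<le> real (card C) + 2 * \<eta> * real N + real N * \<tau> + ?R"
  proof (cases "2 * \<eta> \<le> a")
    case True
    have w1: "fejer_window M \<eta> (a - \<eta>) y \<le> 1" for y
      using True a eta by (intro fejer_window_le_1 M) auto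
    have w2: "fejer_window M \<eta> (a - \<eta>) (x n) \<le> \<tau>" if "n \<in> {1..N}" "n \<notin> C" for n
    proof (rule fejer_window_le)
      \<comment> \<open>Narrowing at 0 as well as at a keeps \<open>x n - t\<close> at most 1 -
        \<eta>, so points beyond a stay away from the window also across the end of the
        period.\<close>
      fix t assume t: "t \<in> {\<eta>..a - \<eta>}"
      have "a < x n" "x n < 1" using x[OF that(1)] that by (auto simp: C_def)
      then show "fejer M (x n - t) \<le> \<tau>" unfolding \<tau>_def using t a eta by (intro fejer_le M) auto
    qed (use True a eta t0 in auto)
    have "real N * (a - \<eta> - \<eta>) - ?R \<le> (\<Sum>n = 1..N. fejer_window M \<eta> (a - \<eta>) (x n))"
      using R[of \<eta> "a - \<eta>"] True by auto
    also have "\<dots> \<le> (\<Sum>n = 1..N. if n \<in> C then 1 else \<tau>)"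
      using w1 w2 by (intro sum_mono) auto
    also have "\<dots> = real (card C) + real (N - card C) * \<tau>" using ind[of 1 \<tau>] by simp
    also have "\<dots> \<le> real (card C) + real N * \<tau>" using t0 by (intro add_left_mono mult_right_mono) auto
    finally show ?thesis by (simp add: algebra_simps)
  next
    case False
    have "real N * a \<le> real N * (2 * \<eta>)" using False by (intro mult_left_mono) auto
    moreover have "real N * \<tau> \<ge> 0" using t0 by simp
    moreover have "real N * (2 * \<eta>) = 2 * \<eta> * real N" by simp
    ultimately show ?thesis using R0 by linarith
  qed
  show "\<bar>real (card {n \<in> {1..N}. x n \<in> {0..a}}) - real N * a\<bar> \<le> 2 * \<eta> * real N + real N / (real M * \<eta>\<^sup>2) + ?R"
    using upper lower by (auto simp: C_def \<tau>_def abs_le_iff)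
qed

lemma has_integral_unit_exp:
  assumes "c \<noteq> 0" "u \<le> v"
  shows "((\<lambda>t. (2 * pi * c * \<i>) * unit_exp (c * t)) has_integral unit_exp (c * v) - unit_exp (c * u)) {u..v}"
  using assms by (intro fundamental_theorem_of_calculus has_vector_derivative_unit_exp)

text \<open>Let f be the derivative of t -> e(ht). Integrating the counting function c(t) against f
  gives the sum of the 1 - e(h x n), and integrating N t against f gives N, because e(h) = 1 and
  e(ht) has mean 0. The difference is minus the exponential sum, while |f| = 2 pi h and |c(t) - N t|
  is at most N times the discrepancy.\<close>

theorem koksma_unit_exp:
  assumes h: "h > 0" and x: "\<And>n. n \<in> {1..N} \<Longrightarrow> x n \<in> {0..1}"
  shows "norm (\<Sum>n = 1..N. unit_exp (real h * x n)) \<le> 2 * pi * real h * (real N * star_discrepancy x N)"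
proof -
  let ?S = "\<Sum>n = 1..N. unit_exp (real h * x n)" and ?D = "2 * pi * real h * (real N * star_discrepancy x N)"
  define f where "f t = (2 * pi * real h * \<i>) * unit_exp (real h * t)" for t
  define c where "c t = real (card {n \<in> {1..N}. x n \<in> {0..t}})" for t
  have "((\<lambda>t. if t \<in> {x n..1} then f t else 0) has_integral 1 - unit_exp (real h * x n)) {0..1}"
    if n: "n \<in> {1..N}" for n
  proof -
    have "(f has_integral unit_exp (real h * 1) - unit_exp (real h * x n)) {x n..1}"
      unfolding f_def using h x[OF n] has_integral_unit_exp[of "real h" "x n" 1] by simp
    then show ?thesis using x[OF n] by (subst has_integral_restrict) auto
  qed
  then have "((\<lambda>t. \<Sum>n = 1..N. if t \<in> {x n..1} then f t else 0) has_integral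
      (\<Sum>n = 1..N. 1 - unit_exp (real h * x n))) {0..1}"
    by (intro has_integral_sum) auto
  moreover have "(\<Sum>n = 1..N. if t \<in> {x n..1} then f t else 0) = of_real (c t) * f t" if "t \<in> {0..1}" for t
  proof -
    have "(\<Sum>n = 1..N. if t \<in> {x n..1} then f t else 0) = (\<Sum>n \<in> {n \<in> {1..N}. x n \<in> {0..t}}. f t)"
      by (rule sum.mono_neutral_cong_right) (use x that in auto)
    then show ?thesis by (simp add: c_def)
  qed
  ultimately have 1: "((\<lambda>t. of_real (c t) * f t) has_integral (\<Sum>n = 1..N. 1 - unit_exp (real h * x n))) {0..1}"
    by (rule has_integral_eq[rotated])
  have "((\<lambda>t. t *\<^sub>R f t) has_integral
      ((1 *\<^sub>R unit_exp (real h * 1) - unit_exp (real h * 1) / (2 * pi * real h * \<i>))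
      - (0 *\<^sub>R unit_exp (real h * 0) - unit_exp (real h * 0) / (2 * pi * real h * \<i>)))) {0..1}"
  proof (rule fundamental_theorem_of_calculus)
    fix t :: real
    show "((\<lambda>t. t *\<^sub>R unit_exp (real h * t) - unit_exp (real h * t) / (2 * pi * real h * \<i>))
        has_vector_derivative t *\<^sub>R f t) (at t within {0..1})"
    proof (rule has_vector_derivative_eq_rhs)
      have d: "((\<lambda>t. unit_exp (real h * t)) has_vector_derivative f t) (at t within {0..1})"
        unfolding f_def using has_vector_derivative_unit_exp[of "real h" t "{0..1}"] by simp
      show "((\<lambda>t. t *\<^sub>R unit_exp (real h * t) - unit_exp (real h * t) / (2 * pi * real h * \<i>))
          has_vector_derivative (t *\<^sub>R f t + 1 *\<^sub>R unit_exp (real h * t)) - f t / (2 * pi * real h * \<i>)) (at t within {0..1})"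
        by (rule has_vector_derivative_diff[OF has_vector_derivative_scaleR[OF DERIV_ident d] has_vector_derivative_divide[OF d]])
      show "(t *\<^sub>R f t + 1 *\<^sub>R unit_exp (real h * t)) - f t / (2 * pi * real h * \<i>) = t *\<^sub>R f t"
        unfolding f_def using h by simp
    qed
  qed auto
  then have "((\<lambda>t. t *\<^sub>R f t) has_integral 1) {0..1}" by simp
  from has_integral_cmul[OF this, of "real N"]
  have 2: "((\<lambda>t. real N *\<^sub>R t *\<^sub>R f t) has_integral of_nat N) {0..1}" by (simp add: scaleR_conv_of_real)
  have 3: "((\<lambda>t. of_real (c t) * f t - real N *\<^sub>R t *\<^sub>R f t) has_integral
      - ?S) {0..1}"
    using has_integral_diff[OF 1 2] by (simp add: sum_subtractf)
  have "norm (- ?S)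
      \<le> ?D * measure lborel (cbox 0 (1::real))"
  proof (rule has_integral_bound)
    show "0 \<le> ?D"
      by (intro mult_nonneg_nonneg order.trans[OF abs_ge_zero star_discrepancy_ge[of 0]]) auto
    fix t :: real assume t: "t \<in> cbox 0 1"
    have "of_real (c t) * f t - real N *\<^sub>R t *\<^sub>R f t = of_real (c t - real N * t) * f t"
      by (simp add: scaleR_conv_of_real algebra_simps)
    then have "norm (of_real (c t) * f t - real N *\<^sub>R t *\<^sub>R f t) = \<bar>c t - real N * t\<bar> * (2 * pi * real h)"
      by (simp only: norm_mult norm_of_real) (simp add: f_def norm_mult)
    also have "\<dots> \<le> (real N * star_discrepancy x N) * (2 * pi * real h)"
      unfolding c_def using star_discrepancy_ge[of t N x] t by (intro mult_right_mono) auto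
    finally show "norm (of_real (c t) * f t - real N *\<^sub>R t *\<^sub>R f t) \<le> ?D"
      by (simp add: mult.commute)
  qed (use 3 in auto)
  then show ?thesis by simp
qed

section \<open>Exponential sums along the Thue--Morse integers\<close>

lemma binary_digit_sum_0 [simp]: "binary_digit_sum 0 = 0"
  by (simp add: binary_digit_sum.simps[of 0])

lemma binary_digit_sum_double [simp]: "binary_digit_sum (2 * n) = binary_digit_sum n"
  by (cases "n = 0") (auto simp: binary_digit_sum.simps[of "2 * n"])

lemma binary_digit_sum_Suc_double [simp]: "binary_digit_sum (Suc (2 * n)) = Suc (binary_digit_sum n)"
  by (subst binary_digit_sum.simps) simp

lemma binary_digit_sum_add_power:
  assumes "r < 2 ^ k"
  shows "binary_digit_sum (2 ^ k + r) = Suc (binary_digit_sum r)"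
  using assms
proof (induction k arbitrary: r)
  case 0
  then show ?case using binary_digit_sum_Suc_double[of 0] by simp
next
  case (Suc k)
  have IH: "binary_digit_sum (2 ^ k + r div 2) = Suc (binary_digit_sum (r div 2))"
    using Suc.prems by (intro Suc.IH) auto
  show ?case
  proof (cases "even r")
    case True
    then have r: "r = 2 * (r div 2)" by simp
    have "2 ^ Suc k + r = 2 * (2 ^ k + r div 2)" using r by simp
    then have "binary_digit_sum (2 ^ Suc k + r) = binary_digit_sum (2 * (2 ^ k + r div 2))"
      by (rule arg_cong)
    also have "\<dots> = Suc (binary_digit_sum (2 * (r div 2)))" unfolding binary_digit_sum_double IH ..
    finally show ?thesis using r by simp
  next
    case False
    then have r: "r = Suc (2 * (r div 2))" by simp
    have "2 ^ Suc k + r = Suc (2 * (2 ^ k + r div 2))"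
      by (subst r) (simp add: distrib_left)
    then have "binary_digit_sum (2 ^ Suc k + r) = binary_digit_sum (Suc (2 * (2 ^ k + r div 2)))"
      by (rule arg_cong)
    also have "\<dots> = Suc (binary_digit_sum (Suc (2 * (r div 2))))"
      unfolding binary_digit_sum_Suc_double using IH by simp
    finally show ?thesis using r by simp
  qed
qed

lemma enumerate_range_strict_mono:
  fixes f :: "nat \<Rightarrow> nat"
  assumes f: "strict_mono f"
  shows "Infinite_Set.enumerate (range f) n = f n"
proof (induction n)
  case 0
  show ?case unfolding enumerate_0
    by (rule Least_equality) (use f in \<open>auto simp: strict_mono_less_eq\<close>)
next
  case (Suc n)
  have "infinite (range f)" using f by (simp add: range_inj_infinite strict_mono_imp_inj_on)
  then show ?case unfolding enumerate_Suc''[OF \<open>infinite (range f)\<close>] Suc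
    by (intro Least_equality) (use f in \<open>auto simp: strict_mono_less_eq strict_mono_less\<close>)
qed

text \<open>The integers 2n and 2n + 1 differ only in the last binary digit, so exactly one of them
  has an even digit sum.\<close>

lemma thue_morse_int_Suc: "thue_morse_int (Suc n) = 2 * n + binary_digit_sum n mod 2"
proof -
  define f where "f n = 2 * n + binary_digit_sum n mod 2" for n
  have f: "strict_mono f"
    unfolding strict_mono_Suc_iff f_def
    by (auto intro: less_le_trans[of _ "2 * Suc n" for n])
  have "range f = thue_morse_set"
  proof (intro equalityI subsetI)
    fix m assume "m \<in> range f"
    then obtain n where "m = f n" by blast
    then show "m \<in> thue_morse_set"
      by (cases "even (binary_digit_sum n)") (auto simp: f_def thue_morse_set_def odd_iff_mod_2_eq_one)
  next
    fix m assume m: "m \<in> thue_morse_set"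
    show "m \<in> range f"
    proof (cases "even m")
      case True
      then obtain n where n: "m = 2 * n" by (auto elim: evenE)
      then have "m = f n" using m by (auto simp: f_def thue_morse_set_def)
      then show ?thesis by blast
    next
      case False
      then obtain n where n: "m = Suc (2 * n)" by (auto elim: oddE)
      then have "m = f n" using m by (auto simp: f_def thue_morse_set_def odd_iff_mod_2_eq_one)
      then show ?thesis by blast
    qed
  qed
  then show ?thesis
    using enumerate_range_strict_mono[OF f, of n] by (simp add: thue_morse_int_def f_def)
qed

text \<open>The parameter e is -1 for the Thue-Morse polynomial and 1 for the Dirichlet kernel. Both
  arise from the indicator of even digit sums, and they obey the same binary recursions.\<close>

definition digit_poly :: "complex \<Rightarrow> nat \<Rightarrow> real \<Rightarrow> complex" where
  "digit_poly e N x = (\<Sum>n<N. e ^ binary_digit_sum n * unit_exp (real n * x))"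

lemma continuous_on_digit_poly [continuous_intros]:
  fixes g :: "real \<Rightarrow> real"
  shows "continuous_on A g \<Longrightarrow> continuous_on A (\<lambda>x. digit_poly e N (g x))"
  unfolding digit_poly_def by (intro continuous_intros)

lemma digit_poly_add_1: "digit_poly e N (x + 1) = digit_poly e N x"
  by (simp add: digit_poly_def unit_exp_add distrib_left)

lemma digit_poly_power_add:
  assumes "r \<le> 2 ^ l"
  shows "digit_poly e (2 ^ l + r) x = digit_poly e (2 ^ l) x + e * unit_exp (2 ^ l * x) * digit_poly e r x"
  using assms
proof (induction r)
  case 0
  show ?case by (simp add: digit_poly_def)
next
  case (Suc r)
  have "digit_poly e (2 ^ l + Suc r) x = digit_poly e (2 ^ l + r) x
      + e ^ binary_digit_sum (2 ^ l + r) * unit_exp (real (2 ^ l + r) * x)"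
    by (simp add: digit_poly_def)
  also have "e ^ binary_digit_sum (2 ^ l + r) * unit_exp (real (2 ^ l + r) * x)
      = e * unit_exp (2 ^ l * x) * (e ^ binary_digit_sum r * unit_exp (real r * x))"
    using Suc.prems by (simp add: binary_digit_sum_add_power unit_exp_add distrib_right)
  finally show ?case using Suc by (simp add: digit_poly_def algebra_simps)
qed

lemma digit_poly_power_0 [simp]: "digit_poly e (Suc 0) x = 1"
  by (simp add: digit_poly_def)

lemma digit_poly_power_Suc:
  "digit_poly e (2 ^ Suc l) x = digit_poly e (2 ^ l) x * (1 + e * unit_exp (2 ^ l * x))"
  using digit_poly_power_add[of "2 ^ l" l e x] by (simp add: algebra_simps mult_2)

text \<open>Stripping the leading binary digit of N leaves, up to a unimodular factor, a shorter sum
  of the same kind. The bound depends on L alone and is therefore uniform in N < 2^L.\<close>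

lemma norm_digit_poly_le:
  assumes e: "norm e = 1" and "N < 2 ^ L"
  shows "norm (digit_poly e N x) \<le> (\<Sum>l<L. norm (digit_poly e (2 ^ l) x))"
  using assms(2)
proof (induction L arbitrary: N)
  case 0
  then show ?case by (simp add: digit_poly_def)
next
  case (Suc L)
  show ?case
  proof (cases "N < 2 ^ L")
    case True
    then show ?thesis using Suc.IH[OF True] by (simp add: add_increasing2)
  next
    case False
    define r where "r = N - 2 ^ L"
    have N: "N = 2 ^ L + r" "r < 2 ^ L" using False Suc.prems by (auto simp: r_def)
    have "norm (digit_poly e N x) = norm (digit_poly e (2 ^ L) x + e * unit_exp (2 ^ L * x) * digit_poly e r x)"
      unfolding N using N by (simp add: digit_poly_power_add)
    also have "\<dots> \<le> norm (digit_poly e (2 ^ L) x) + norm (e * unit_exp (2 ^ L * x) * digit_poly e r x)"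
      by (rule norm_triangle_ineq)
    also have "norm (e * unit_exp (2 ^ L * x) * digit_poly e r x) = norm (digit_poly e r x)"
      using e by (simp add: norm_mult)
    also have "\<dots> \<le> (\<Sum>l<L. norm (digit_poly e (2 ^ l) x))" by (rule Suc.IH[OF N(2)])
    finally show ?thesis by simp
  qed
qed

lemma norm_digit_poly_minus_1: "norm (digit_poly (-1) (2 ^ L) x) = 2 ^ L * sine_product L x"
proof (induction L)
  case (Suc L)
  have "norm (digit_poly (-1) (2 ^ Suc L) x) = norm (digit_poly (-1) (2 ^ L) x) * norm (1 - unit_exp (2 ^ L * x))"
    unfolding digit_poly_power_Suc by (simp add: norm_mult)
  also have "\<dots> = 2 ^ Suc L * sine_product (Suc L) x"
    unfolding Suc norm_1_minus_unit_exp by (simp add: sine_product_def mult_ac)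
  finally show ?case .
qed simp

text \<open>Each pair {2n, 2n + 1} contains one Thue-Morse integer, so the first N of them are those
  below 2N: hence the doubled length.\<close>

lemma sum_thue_morse_unit_exp:
  "2 * (\<Sum>k = 1..N. unit_exp (real (thue_morse_int k) * x)) = digit_poly 1 (2 * N) x + digit_poly (-1) (2 * N) x"
proof (induction N)
  case 0
  show ?case by (simp add: digit_poly_def)
next
  case (Suc N)
  have "digit_poly e (2 * Suc N) x = digit_poly e (2 * N) x + e ^ binary_digit_sum N * unit_exp (real (2 * N) * x)
      + e ^ Suc (binary_digit_sum N) * unit_exp (real (Suc (2 * N)) * x)" for e
    by (simp add: digit_poly_def)
  moreover have "2 * unit_exp (real (thue_morse_int (Suc N)) * x)
      = (1 + (-1) ^ binary_digit_sum N) * unit_exp (real (2 * N) * x)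
      + (1 + (-1) ^ Suc (binary_digit_sum N)) * unit_exp (real (Suc (2 * N)) * x)"
    by (cases "even (binary_digit_sum N)") (auto simp: thue_morse_int_Suc odd_iff_mod_2_eq_one)
  ultimately show ?case using Suc by (simp add: algebra_simps)
qed

section \<open>Integrals of exponential sums and the Borel--Cantelli argument\<close>

lemma integral_periodic_scale:
  fixes g :: "real \<Rightarrow> real"
  assumes cont: "continuous_on UNIV g" and per: "\<And>x. g (x + 1) = g x" and h: "h > 0"
  shows "integral {0..1} (\<lambda>x. g (real h * x)) = integral {0..1} g"
proof -
  have int: "g integrable_on {a..b}" for a b
    by (intro integrable_continuous_real continuous_on_subset[OF cont]) auto
  have pern: "g (x + real n) = g x" for n x
    by (induction n) (use per[of "x + real n" for n] in \<open>auto simp: add_ac\<close>)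
  have "integral {0..real n} g = real n * integral {0..1} g" for n
  proof (induction n)
    case (Suc n)
    have "integral {0..real (Suc n)} g = integral {0..real n} g + integral {real n..real n + 1} g"
      by (subst Henstock_Kurzweil_Integration.integral_combine) (use int in \<open>auto simp: add.commute\<close>)
    also have "integral {real n..real n + 1} g = integral {0..1} (\<lambda>x. g (1 * x + real n))"
      using integral_affine[OF int[of "real n" "real n + 1"], of 1 "real n"] by simp
    also have "\<dots> = integral {0..1} g" using pern by simp
    finally show ?case using Suc by (simp add: algebra_simps)
  qed simp
  moreover have "integral {0..1} (\<lambda>x. g (real h * x)) = integral {0..real h} g / real h"
    using integral_affine[OF int[of 0 "real h"], of "real h" 0] h by (simp add: divide_inverse_commute)
  ultimately show ?thesis using h by simp
qed

text \<open>The L1 norm of the Dirichlet kernel is logarithmic in its length. The bounds 2^L and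
  1/|sin(pi x)| are merged into 2 / (\<delta> + y) with y the distance to the nearer end; adding the
  terms of both ends gives a majorant with an explicit antiderivative.\<close>

lemma integral_norm_digit_poly_1_le:
  "integral {0..1} (\<lambda>x. norm (digit_poly 1 (2 ^ L) x)) \<le> 4 * (real L + 1)"
proof -
  let ?D = "\<lambda>x. norm (digit_poly 1 (2 ^ L) x)"
  define \<delta> :: real where "\<delta> = 1 / 2 ^ L"
  have d: "\<delta> > 0" "\<delta> \<le> 1" by (simp_all add: \<delta>_def)
  have D1: "?D x * \<delta> \<le> 1" for x
  proof -
    have "?D x \<le> (\<Sum>n<2 ^ L. norm ((1::complex) ^ binary_digit_sum n * unit_exp (real n * x)))"
      unfolding digit_poly_def by (rule norm_sum)
    then show ?thesis by (simp add: norm_mult \<delta>_def)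
  qed
  have D2: "?D x * \<bar>sin (pi * x)\<bar> \<le> 1" for x
  proof -
    have "digit_poly 1 (2 ^ L) x * (1 - unit_exp x) = 1 - unit_exp x ^ (2 ^ L)"
      using one_diff_power_eq[of "unit_exp x" "2 ^ L"] by (simp add: digit_poly_def unit_exp_power mult.commute)
    then have "?D x * norm (1 - unit_exp x) = norm (1 - unit_exp x ^ (2 ^ L))"
      by (metis norm_mult)
    also have "\<dots> \<le> norm (1::complex) + norm (unit_exp x ^ (2 ^ L))" by (rule norm_triangle_ineq4)
    finally show ?thesis by (simp add: norm_1_minus_unit_exp norm_power)
  qed
  have bound: "?D x \<le> 2 / (\<delta> + x) + 2 / (\<delta> + (1 - x))" if x: "x \<in> {0..1}" for x
  proof -
    have "?D x \<le> 2 / (\<delta> + y)" if y: "0 \<le> y" "y \<le> \<bar>sin (pi * x)\<bar>" for y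
    proof -
      have "?D x * y \<le> ?D x * \<bar>sin (pi * x)\<bar>"
        using y by (intro mult_left_mono) auto
      then have "?D x * (\<delta> + y) \<le> 2"
        using D1[of x] D2[of x] unfolding distrib_left by linarith
      then show ?thesis using d y by (simp add: field_simps)
    qed
    note * = this
    show ?thesis
    proof (cases "x \<le> 1 / 2")
      case True
      have "?D x \<le> 2 / (\<delta> + x)"
        using *[of x] sin_pi_ge[of x] True x by auto
      moreover have "2 / (\<delta> + (1 - x)) \<ge> 0" using d x by simp
      ultimately show ?thesis by linarith
    next
      case False
      have "sin (pi * x) = sin (pi * (1 - x))" by (simp add: algebra_simps sin_diff)
      then have "?D x \<le> 2 / (\<delta> + (1 - x))"
        using *[of "1 - x"] sin_pi_ge[of "1 - x"] False x by auto
      moreover have "2 / (\<delta> + x) \<ge> 0" using d x by simp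
      ultimately show ?thesis by linarith
    qed
  qed
  have I: "((\<lambda>x. 2 / (\<delta> + x) + 2 / (\<delta> + (1 - x))) has_integral
      (2 * ln (\<delta> + 1) - 2 * ln (\<delta> + (1 - 1))) - (2 * ln (\<delta> + 0) - 2 * ln (\<delta> + (1 - 0)))) {0..1}"
    by (rule fundamental_theorem_of_calculus)
       (use d in \<open>auto intro!: derivative_eq_intros simp: has_real_derivative_iff_has_vector_derivative[symmetric] field_simps\<close>)
  have "integral {0..1} ?D \<le> integral {0..1} (\<lambda>x. 2 / (\<delta> + x) + 2 / (\<delta> + (1 - x)))"
    using I by (intro integral_le bound integrable_continuous_real continuous_intros has_integral_integrable[OF I]) auto
  also have "\<dots> = 4 * (ln (\<delta> + 1) - ln \<delta>)" using integral_unique[OF I] by simp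
  finally have "integral {0..1} ?D \<le> 4 * (ln (\<delta> + 1) - ln \<delta>)" .
  moreover have "ln (\<delta> + 1) \<le> 1" using ln_add_one_self_le_self[of \<delta>] d by (simp add: add.commute)
  moreover have "- ln \<delta> = real L * ln 2" by (simp add: \<delta>_def ln_div ln_realpow)
  moreover have "real L * ln 2 \<le> real L * 1" using ln_le_minus_one[of 2] by (intro mult_left_mono) auto
  ultimately show ?thesis by simp
qed

text \<open>Borel-Cantelli in integral form: by monotone convergence the sum of the functions has a
  finite integral, so it is finite almost everywhere.\<close>

lemma AE_tendsto_0_of_summable_integral:
  fixes f :: "nat \<Rightarrow> real \<Rightarrow> real"
  assumes cont: "\<And>n. continuous_on {0..1} (f n)"
    and nn: "\<And>n x. x \<in> {0..1} \<Longrightarrow> 0 \<le> f n x"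
    and sm: "summable (\<lambda>n. integral {0..1} (f n))"
  shows "AE x in lebesgue_on {0<..<1}. (\<lambda>n. f n x) \<longlonglongrightarrow> 0"
proof -
  let ?M = "lebesgue_on {0..1::real}"
  have int: "integrable ?M (f n)" for n
    using continuous_imp_integrable_real[OF cont] .
  have I: "(\<integral>\<^sup>+x. ennreal (f n x) \<partial>?M) = ennreal (integral {0..1} (f n))" for n
  proof -
    have "(\<integral>\<^sup>+x. ennreal (f n x) \<partial>?M) = ennreal (integral\<^sup>L ?M (f n))"
      by (intro nn_integral_eq_integral int AE_I2) (auto simp: space_restrict_space intro: nn)
    also have "integral\<^sup>L ?M (f n) = integral {0..1} (f n)"
      by (rule lebesgue_integral_eq_integral[OF int]) auto
    finally show ?thesis .
  qed
  have I0: "integral {0..1} (f n) \<ge> 0" for n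
    by (intro Henstock_Kurzweil_Integration.integral_nonneg integrable_continuous_real cont nn)
  have meas: "(\<lambda>x. ennreal (f n x)) \<in> borel_measurable ?M" for n
    using int[of n] by measurable
  have "(\<integral>\<^sup>+x. (\<Sum>n. ennreal (f n x)) \<partial>?M) = (\<Sum>n. ennreal (integral {0..1} (f n)))"
    by (subst nn_integral_suminf[OF meas]) (simp add: I)
  also have "\<dots> = ennreal (\<Sum>n. integral {0..1} (f n))" by (rule suminf_ennreal2[OF I0 sm])
  finally have "(\<integral>\<^sup>+x. (\<Sum>n. ennreal (f n x)) \<partial>?M) \<noteq> \<infinity>" by simp
  then have "AE x in ?M. (\<Sum>n. ennreal (f n x)) \<noteq> \<infinity>"
    by (intro nn_integral_PInf_AE borel_measurable_suminf_order meas)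
  then have "AE x in ?M. (\<lambda>n. f n x) \<longlonglongrightarrow> 0"
  proof (rule AE_mp[OF _ AE_I2], intro impI)
    fix x assume x: "x \<in> space ?M" "(\<Sum>n. ennreal (f n x)) \<noteq> \<infinity>"
    then have "summable (\<lambda>n. f n x)"
      by (intro summable_suminf_not_top) (auto simp: space_restrict_space intro: nn)
    then show "(\<lambda>n. f n x) \<longlonglongrightarrow> 0" by (rule summable_LIMSEQ_zero)
  qed
  then show ?thesis
    by (subst (asm) AE_restrict_space_iff, simp, subst AE_restrict_space_iff) (auto elim: AE_mp)
qed

section \<open>The upper bound\<close>

abbreviation tm_discrepancy :: "real \<Rightarrow> nat \<Rightarrow> real" where
  "tm_discrepancy x N \<equiv> real N * star_discrepancy (\<lambda>k. frac (real (thue_morse_int k) * x)) N"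

definition tm_exponent :: real where
  "tm_exponent = 1 + ln fouvry_mauduit_const / ln 2"

lemma tm_exponent_pos: "tm_exponent > 0"
proof -
  have "ln (1 / 2) < ln fouvry_mauduit_const"
    using fouvry_mauduit_const_asymp(2) by (subst ln_less_cancel_iff) auto
  then have "- 1 < ln fouvry_mauduit_const / ln 2" by (simp add: ln_div field_simps)
  then show ?thesis by (simp add: tm_exponent_def)
qed

lemma powr_tm_exponent: "2 powr (tm_exponent * real L) = 2 ^ L * fouvry_mauduit_const ^ L"
proof -
  have "2 powr tm_exponent = 2 * fouvry_mauduit_const"
    unfolding tm_exponent_def powr_add using fouvry_mauduit_const_asymp(2) by (simp add: powr_def)
  then have "2 powr (tm_exponent * real L) = (2 * fouvry_mauduit_const) powr real L"
    by (simp only: powr_powr[symmetric])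
  also have "\<dots> = (2 * fouvry_mauduit_const) ^ L"
    using fouvry_mauduit_const_asymp(2) by (intro powr_realpow) simp
  finally show ?thesis by (simp only: power_mult_distrib)
qed

definition tm_norm1 :: "nat \<Rightarrow> real" where
  "tm_norm1 L = integral {0..1} (\<lambda>x. norm (digit_poly (-1) (2 ^ L) x))"

lemma tm_norm1_eq: "tm_norm1 L = 2 ^ L * sine_product_integral L"
  by (simp add: tm_norm1_def norm_digit_poly_minus_1 sine_product_integral_altdef)

text \<open>Holds for every L and not only eventually: the quotient by the asymptotic form is
  positive and tends to 1, so it and its inverse are bounded sequences.\<close>

lemma tm_norm1_bounds:
  "\<exists>c1>0. \<exists>c2>0. \<forall>L. c1 * 2 powr (tm_exponent * real L) \<le> tm_norm1 L
      \<and> tm_norm1 L \<le> c2 * 2 powr (tm_exponent * real L)"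
proof -
  let ?c = fouvry_mauduit_const
  have c: "?c > 0" using fouvry_mauduit_const_asymp(2) by simp
  obtain \<kappa> where k: "\<kappa> > 0" "sine_product_integral \<sim>[at_top] (\<lambda>L. \<kappa> * ?c ^ L)"
    using fouvry_mauduit_const_asymp(1) by blast
  define q where "q L = sine_product_integral L / (\<kappa> * ?c ^ L)" for L
  have q0: "q L > 0" for L unfolding q_def using sine_product_integral_pos c k by simp
  have q1: "q \<longlonglongrightarrow> 1"
    unfolding q_def using asymp_equivD_strong[OF k(2)] c k(1) by simp
  have "Bseq q" by (rule convergent_imp_Bseq[OF convergentI[OF q1]])
  then obtain K1 where K1: "\<And>L. \<bar>q L\<bar> \<le> K1" unfolding Bseq_def real_norm_def by blast
  have "(\<lambda>L. inverse (q L)) \<longlonglongrightarrow> inverse 1" by (intro tendsto_inverse q1) simp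
  then have "Bseq (\<lambda>L. inverse (q L))" by (intro convergent_imp_Bseq convergentI)
  then obtain K2 where K2: "\<And>L. \<bar>inverse (q L)\<bar> \<le> K2" unfolding Bseq_def real_norm_def by blast
  have K10: "K1 > 0" using K1[of 0] q0[of 0] by linarith
  have K20: "K2 > 0" using K2[of 0] q0[of 0] by (metis abs_of_pos inverse_positive_iff_positive less_le_trans)
  have eq: "tm_norm1 L = \<kappa> * q L * 2 powr (tm_exponent * real L)" for L
    unfolding tm_norm1_eq powr_tm_exponent using k c by (simp add: q_def)
  have lo: "inverse K2 \<le> q L" for L
    using K2[of L] q0[of L] K20 by (simp add: field_simps abs_if split: if_splits)
  have hi: "q L \<le> K1" for L using K1[of L] by simp
  show ?thesis
  proof (intro exI conjI allI)
    show "\<kappa> * inverse K2 > 0" "\<kappa> * K1 > 0" using k K10 K20 by simp_all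
    fix L
    show "\<kappa> * inverse K2 * 2 powr (tm_exponent * real L) \<le> tm_norm1 L"
      unfolding eq using lo k by (intro mult_right_mono mult_left_mono) auto
    show "tm_norm1 L \<le> \<kappa> * K1 * 2 powr (tm_exponent * real L)"
      unfolding eq using hi k by (intro mult_right_mono mult_left_mono) auto
  qed
qed

lemma sum_inverse_le: "(\<Sum>h = 1..2 ^ k. 1 / real h) \<le> real k + 1"
proof (induction k)
  case (Suc k)
  let ?J = "{2 ^ k + 1..2 ^ k + 2 ^ k::nat}"
  have "(\<Sum>h = 1..2 ^ Suc k. 1 / real h) = (\<Sum>h = 1..2 ^ k. 1 / real h) + (\<Sum>h\<in>?J. 1 / real h)"
    using sum.ub_add_nat[of 1 "2 ^ k" "\<lambda>h. 1 / real h" "2 ^ k"] by (simp add: mult_2)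
  also have "(\<Sum>h\<in>?J. 1 / real h) \<le> (\<Sum>h\<in>?J. 1 / 2 ^ k)"
  proof (intro sum_mono divide_left_mono)
    fix h assume "h \<in> ?J"
    then have "2 ^ k \<le> h" by simp
    then have "real (2 ^ k) \<le> real h" by (simp only: of_nat_le_iff)
    then show *: "(2::real) ^ k \<le> real h" by simp
    show "0 < real h * (2::real) ^ k" by (intro mult_pos_pos less_le_trans[OF _ *]) auto
  qed auto
  also have "\<dots> = 1" by simp
  finally show ?case using Suc by simp
qed simp

text \<open>Majorises the exponential sums of the Erdos-Turan bound for all N with 2N < 2^L at once,
  so that Borel-Cantelli runs over L instead of N. The cutoff 8^L is the kernel length used
  there.\<close>

definition metric_sum :: "nat \<Rightarrow> real \<Rightarrow> real" where
  "metric_sum L x = (\<Sum>h = 1..8 ^ L. (\<Sum>l<L. norm (digit_poly 1 (2 ^ l) (real h * x))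
      + norm (digit_poly (-1) (2 ^ l) (real h * x))) / real h)"

lemma continuous_on_metric_sum: "continuous_on A (metric_sum L)"
  unfolding metric_sum_def[abs_def] by (intro continuous_intros) auto

lemma integral_norm_digit_poly_scale:
  assumes "h > 0"
  shows "integral {0..1} (\<lambda>x. norm (digit_poly e N (real h * x))) = integral {0..1} (\<lambda>x. norm (digit_poly e N x))"
  by (rule integral_periodic_scale[where g = "\<lambda>x. norm (digit_poly e N x)"])
     (use assms in \<open>auto intro!: continuous_intros simp: digit_poly_add_1\<close>)

text \<open>The three factors \<open>real L + 1\<close> come from the number of dyadic lengths, the
  logarithm in the Dirichlet kernel and the harmonic sum over h.\<close>

lemma integral_metric_sum_le:
  "\<exists>C. \<forall>L. integral {0..1} (metric_sum L) \<le> C * (real L + 1) ^ 3 * 2 powr (tm_exponent * real L)"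
proof -
  let ?D = "\<lambda>l. integral {0..1} (\<lambda>x. norm (digit_poly 1 (2 ^ l) x))"
  obtain c2 where c2: "c2 > 0" "\<And>L. tm_norm1 L \<le> c2 * 2 powr (tm_exponent * real L)"
    using tm_norm1_bounds by blast
  have ci: "(\<lambda>x. norm (digit_poly e N (c * x))) integrable_on {0..1}" for e N c
    by (intro integrable_continuous_real continuous_intros)
  have "integral {0..1} (metric_sum L) \<le> (3 * (4 + c2)) * (real L + 1) ^ 3 * 2 powr (tm_exponent * real L)" for L
  proof -
    define E where "E = 2 powr (tm_exponent * real L)"
    have E1: "E \<ge> 1" unfolding E_def using tm_exponent_pos by (intro ge_one_powr_ge_zero) auto
    define B where "B = (real L + 1) * ((4 + c2) * (real L + 1) * E)"
    have B0: "B \<ge> 0" using c2 E1 by (simp add: B_def)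
    have I: "((\<lambda>x. (\<Sum>l<L. norm (digit_poly 1 (2 ^ l) (real h * x)) + norm (digit_poly (-1) (2 ^ l) (real h * x))) / real h)
        has_integral (\<Sum>l<L. ?D l + tm_norm1 l) / real h) {0..1}"
      if "h > 0" for h
      unfolding tm_norm1_def integral_norm_digit_poly_scale[OF that, symmetric]
      by (intro has_integral_divide has_integral_sum has_integral_add integrable_integral ci) auto
    have le: "(\<Sum>l<L. ?D l + tm_norm1 l) \<le> B"
    proof -
      have "(\<Sum>l<L. ?D l + tm_norm1 l) \<le> (\<Sum>l<L. (4 + c2) * (real L + 1) * E)"
      proof (rule sum_mono)
        fix l assume l: "l \<in> {..<L}"
        have "?D l \<le> 4 * (real l + 1)" by (rule integral_norm_digit_poly_1_le)
        also have "\<dots> \<le> 4 * (real L + 1) * 1" using l by simp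
        also have "\<dots> \<le> 4 * (real L + 1) * E" using E1 by (intro mult_left_mono) auto
        finally have 1: "?D l \<le> 4 * (real L + 1) * E" .
        have "tm_norm1 l \<le> c2 * 2 powr (tm_exponent * real l)" by (rule c2)
        also have "\<dots> \<le> c2 * E" unfolding E_def using l tm_exponent_pos c2 by (intro mult_left_mono powr_mono) auto
        also have "\<dots> \<le> c2 * (real L + 1) * E" using c2 E1 by (simp add: mult_left_mono mult_right_mono)
        finally show "?D l + tm_norm1 l \<le> (4 + c2) * (real L + 1) * E"
          using 1 by (simp add: algebra_simps)
      qed
      also have "\<dots> = real L * ((4 + c2) * (real L + 1) * E)" by simp
      also have "\<dots> \<le> B" unfolding B_def using c2 E1 by (intro mult_right_mono) auto
      finally show ?thesis .
    qed
    have "integral {0..1} (metric_sum L) = (\<Sum>h = 1..8 ^ L. (\<Sum>l<L. ?D l + tm_norm1 l) / real h)"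
      unfolding metric_sum_def[abs_def] by (intro integral_unique has_integral_sum I) auto
    also have "\<dots> \<le> (\<Sum>h = 1..8 ^ L. B / real h)" using le by (intro sum_mono divide_right_mono) auto
    also have "\<dots> = B * (\<Sum>h = 1..2 ^ (3 * L). 1 / real h)"
      by (simp add: sum_distrib_left power_mult)
    also have "\<dots> \<le> B * (real (3 * L) + 1)" using B0 by (intro mult_left_mono sum_inverse_le) auto
    also have "\<dots> \<le> B * (3 * (real L + 1))" using B0 by (intro mult_left_mono) auto
    also have "\<dots> = (3 * (4 + c2)) * (real L + 1) ^ 3 * E" by (simp add: B_def power3_eq_cube algebra_simps)
    finally show ?thesis by (simp add: E_def)
  qed
  then show ?thesis by blast
qed

lemma summable_cubic_geometric:
  fixes r :: real
  assumes "0 < r" "r < 1"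
  shows "summable (\<lambda>n. (real n + 1) ^ 3 * r ^ n)"
proof -
  have "(\<lambda>n. ((real n + 2) / (real n + 1)) ^ 3) \<longlonglongrightarrow> 1" by real_asymp
  then have "(\<lambda>n. ((real n + 2) / (real n + 1)) ^ 3 * r) \<longlonglongrightarrow> 1 * r" by (intro tendsto_mult tendsto_const)
  then have "eventually (\<lambda>n. ((real n + 2) / (real n + 1)) ^ 3 * r < (1 + r) / 2) sequentially"
    by (rule order_tendstoD) (use assms in auto)
  then obtain n0 where n0: "\<And>n. n \<ge> n0 \<Longrightarrow> ((real n + 2) / (real n + 1)) ^ 3 * r < (1 + r) / 2"
    by (auto simp: eventually_sequentially)
  show ?thesis
  proof (rule summable_ratio_test)
    show "(1 + r) / 2 < 1" using assms by simp
    fix n assume "n0 \<le> n"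
    have "(real (Suc n) + 1) ^ 3 * r ^ Suc n = ((real n + 2) / (real n + 1)) ^ 3 * r * ((real n + 1) ^ 3 * r ^ n)"
      by (simp add: power_divide add_ac)
    also have "\<dots> \<le> (1 + r) / 2 * ((real n + 1) ^ 3 * r ^ n)"
      using n0[OF \<open>n0 \<le> n\<close>] assms by (intro mult_right_mono) auto
    finally show "norm ((real (Suc n) + 1) ^ 3 * r ^ Suc n) \<le> (1 + r) / 2 * norm ((real n + 1) ^ 3 * r ^ n)"
      using assms by (simp add: abs_mult)
  qed
qed

text \<open>The quotients \<open>f n / w n\<close> have summable integrals, hence tend to 0 almost
  everywhere and are eventually below 1. The cubic factor covers the polynomial losses of all
  applications.\<close>

lemma AE_eventually_le_of_integral_le:
  fixes f :: "nat \<Rightarrow> real \<Rightarrow> real" and w :: "nat \<Rightarrow> real"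
  assumes cont: "\<And>n. continuous_on {0..1} (f n)"
    and nn: "\<And>n x. x \<in> {0..1} \<Longrightarrow> 0 \<le> f n x"
    and w: "\<And>n. w n > 0" and r: "0 < r" "r < 1"
    and le: "\<And>n. integral {0..1} (f n) \<le> C * (real n + 1) ^ 3 * r ^ n * w n"
  shows "AE x in lebesgue_on {0<..<1}. \<forall>\<^sub>F n in sequentially. f n x \<le> w n"
proof -
  have "AE x in lebesgue_on {0<..<1}. (\<lambda>n. f n x / w n) \<longlonglongrightarrow> 0"
  proof (rule AE_tendsto_0_of_summable_integral)
    show "continuous_on {0..1} (\<lambda>x. f n x / w n)" for n
      using w[of n] by (intro continuous_intros cont) auto
    show "0 \<le> f n x / w n" if "x \<in> {0..1}" for n x using nn[OF that] w[of n] by simp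
    show "summable (\<lambda>n. integral {0..1} (\<lambda>x. f n x / w n))"
    proof (rule summable_comparison_test_ev[OF always_eventually])
      show "summable (\<lambda>n. C * ((real n + 1) ^ 3 * r ^ n))" by (intro summable_mult summable_cubic_geometric r)
      show "\<forall>n. norm (integral {0..1} (\<lambda>x. f n x / w n)) \<le> C * ((real n + 1) ^ 3 * r ^ n)"
      proof
        fix n
        have "integral {0..1} (\<lambda>x. f n x / w n) = integral {0..1} (f n) / w n" by (rule integral_divide)
        moreover have "integral {0..1} (f n) \<ge> 0"
          by (intro Henstock_Kurzweil_Integration.integral_nonneg integrable_continuous_real cont nn)
        ultimately have "norm (integral {0..1} (\<lambda>x. f n x / w n)) = integral {0..1} (f n) / w n"
          using w[of n] by simp
        also have "\<dots> \<le> C * (real n + 1) ^ 3 * r ^ n * w n / w n"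
          using le[of n] w[of n] by (intro divide_right_mono) auto
        also have "\<dots> = C * ((real n + 1) ^ 3 * r ^ n)" using w[of n] by simp
        finally show "norm (integral {0..1} (\<lambda>x. f n x / w n)) \<le> C * ((real n + 1) ^ 3 * r ^ n)" .
      qed
    qed
  qed
  then show ?thesis
  proof (rule AE_mp[OF _ AE_I2], intro impI)
    fix x assume "(\<lambda>n. f n x / w n) \<longlonglongrightarrow> 0"
    then have "\<forall>\<^sub>F n in sequentially. f n x / w n < 1" by (rule order_tendstoD) simp
    then show "\<forall>\<^sub>F n in sequentially. f n x \<le> w n"
      by eventually_elim (use w in \<open>simp add: divide_less_eq\<close>)
  qed
qed

lemma powr_mult_power: "2 powr (a * real n) = (2 powr a) ^ n"
  by (simp add: powr_powr[symmetric] powr_realpow)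

lemma two_powr_less_1: "a < 0 \<Longrightarrow> 2 powr a < (1::real)"
  using powr_less_mono[of a 0 2] by simp

lemma AE_metric_sum_le:
  assumes "\<epsilon> > 0"
  shows "AE x in lebesgue_on {0<..<1}. \<forall>\<^sub>F L in sequentially. metric_sum L x \<le> 2 powr ((tm_exponent + \<epsilon>) * real L)"
proof -
  obtain C where C: "\<And>L. integral {0..1} (metric_sum L) \<le> C * (real L + 1) ^ 3 * 2 powr (tm_exponent * real L)"
    using integral_metric_sum_le by blast
  show ?thesis
  proof (rule AE_eventually_le_of_integral_le)
    show "0 \<le> metric_sum L x" for L x
      unfolding metric_sum_def by (intro sum_nonneg divide_nonneg_nonneg add_nonneg_nonneg) auto
    show "2 powr (- \<epsilon>) < 1" using assms by (intro two_powr_less_1) simp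
    fix L
    have "2 powr (tm_exponent * real L) = (2 powr (- \<epsilon>)) ^ L * 2 powr ((tm_exponent + \<epsilon>) * real L)"
      unfolding powr_mult_power[symmetric] powr_add[symmetric] by (simp add: algebra_simps)
    then show "integral {0..1} (metric_sum L) \<le> C * (real L + 1) ^ 3 * (2 powr (- \<epsilon>)) ^ L * 2 powr ((tm_exponent + \<epsilon>) * real L)"
      using C[of L] by (simp only: mult.assoc)
  qed (auto intro: continuous_on_metric_sum)
qed

lemma sum_thue_morse_frac:
  "2 * (\<Sum>k = 1..N. unit_exp (real h * frac (real (thue_morse_int k) * x)))
    = digit_poly 1 (2 * N) (real h * x) + digit_poly (-1) (2 * N) (real h * x)"
proof -
  have "unit_exp (real h * frac (real (thue_morse_int k) * x)) = unit_exp (real (thue_morse_int k) * (real h * x))" for k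
    by (simp add: unit_exp_frac mult_ac)
  then show ?thesis using sum_thue_morse_unit_exp[where N = N and x = "real h * x"] by simp
qed

text \<open>With \<eta> = 2^-L and M = 8^L the term 2 \<eta> N is at most 1 because 2N < 2^L, and M
  \<eta>^2 = 2^L makes the second term at most 1.\<close>

lemma tm_discrepancy_le_metric_sum:
  assumes "N > 0" "2 * N < 2 ^ L"
  shows "tm_discrepancy x N \<le> 2 + metric_sum L x"
proof -
  have L: "L \<ge> 1" using assms by (cases L) auto
  have N: "2 * real N \<le> 2 ^ L" using assms(2) by (metis less_imp_le of_nat_le_iff of_nat_mult of_nat_numeral of_nat_power)
  have "tm_discrepancy x N \<le> 2 * (1 / 2 ^ L) * real N + real N / (real (8 ^ L) * (1 / 2 ^ L)\<^sup>2)
      + (\<Sum>h = 1..8 ^ L. norm (\<Sum>n = 1..N. unit_exp (real h * frac (real (thue_morse_int n) * x))) / real h)"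
  proof (rule erdos_turan)
    have "(2::real) ^ 1 \<le> 2 ^ L" using L by (intro power_increasing) auto
    then show "1 / 2 ^ L \<le> (1 / 2 :: real)" by (simp add: field_simps)
  qed (use assms frac_lt_1 in auto)
  also have "2 * (1 / 2 ^ L) * real N \<le> 1" using N by (simp add: field_simps)
  also have "real N / (real (8 ^ L) * (1 / 2 ^ L)\<^sup>2) \<le> 1"
  proof -
    have "(8::real) ^ L = 2 ^ L * (2 ^ L * 2 ^ L)" by (simp flip: power_mult_distrib)
    then have "real (8 ^ L) * (1 / 2 ^ L)\<^sup>2 = 2 ^ L" by (simp add: power2_eq_square)
    moreover have "real N \<le> 2 ^ L" using N by linarith
    ultimately show ?thesis by (simp only: divide_le_eq_1_pos zero_less_power zero_less_numeral)
  qed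
  also have "(\<Sum>h = 1..8 ^ L. norm (\<Sum>n = 1..N. unit_exp (real h * frac (real (thue_morse_int n) * x))) / real h)
      \<le> metric_sum L x"
    unfolding metric_sum_def
  proof (intro sum_mono divide_right_mono)
    fix h :: nat
    let ?P = "\<lambda>l. norm (digit_poly 1 (2 ^ l) (real h * x))" and ?Q = "\<lambda>l. norm (digit_poly (-1) (2 ^ l) (real h * x))"
    let ?S = "\<Sum>n = 1..N. unit_exp (real h * frac (real (thue_morse_int n) * x))"
    have "2 * norm ?S = norm (2 * ?S)" by (simp add: norm_mult)
    also have "\<dots> \<le> norm (digit_poly 1 (2 * N) (real h * x)) + norm (digit_poly (-1) (2 * N) (real h * x))"
      unfolding sum_thue_morse_frac by (rule norm_triangle_ineq)
    also have "\<dots> \<le> (\<Sum>l<L. ?P l) + (\<Sum>l<L. ?Q l)"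
      by (intro add_mono norm_digit_poly_le assms) auto
    finally have "2 * norm ?S \<le> (\<Sum>l<L. ?P l + ?Q l)"
      by (simp add: sum.distrib)
    then show "norm ?S \<le> (\<Sum>l<L. ?P l + ?Q l)"
      using norm_ge_zero[of ?S] by linarith
  qed auto
  finally show ?thesis by simp
qed

lemma ex_power_of_2_between:
  assumes "N > 0"
  shows "\<exists>L. 2 * N < 2 ^ L \<and> 2 ^ L \<le> 4 * (N::nat)"
proof -
  define L where "L = (LEAST L. 2 * N < 2 ^ L)"
  have ex: "2 * N < 2 ^ (2 * N)" by (rule less_exp)
  have 1: "2 * N < 2 ^ L" unfolding L_def by (rule LeastI[of "\<lambda>L. 2 * N < 2 ^ L", OF ex])
  then obtain k where k: "L = Suc k" using assms by (cases L) auto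
  then have "\<not> 2 * N < 2 ^ k" using not_less_Least[of k "\<lambda>L. 2 * N < 2 ^ L"] unfolding L_def by simp
  then show ?thesis using 1 k by (intro exI[of _ L]) auto
qed

theorem AE_tm_discrepancy_upper:
  assumes "\<epsilon> > 0"
  shows "AE x in lebesgue_on {0<..<1}. tm_discrepancy x \<in> O(\<lambda>N. real N powr (tm_exponent + \<epsilon>))"
proof (rule AE_mp[OF AE_metric_sum_le[OF assms] AE_I2], intro impI)
  fix x assume "\<forall>\<^sub>F L in sequentially. metric_sum L x \<le> 2 powr ((tm_exponent + \<epsilon>) * real L)"
  then obtain L0 where L0: "\<And>L. L \<ge> L0 \<Longrightarrow> metric_sum L x \<le> 2 powr ((tm_exponent + \<epsilon>) * real L)"
    by (auto simp: eventually_sequentially)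
  let ?e = "tm_exponent + \<epsilon>"
  have e: "?e > 0" using tm_exponent_pos assms by simp
  have "tm_discrepancy x N \<le> 3 * 4 powr ?e * real N powr ?e" if N: "N \<ge> 2 ^ L0" for N
  proof -
    have N0: "N > 0" using N by (metis gr0I le_zero_eq power_not_zero zero_neq_numeral)
    obtain L where L: "2 * N < 2 ^ L" "2 ^ L \<le> 4 * N" using ex_power_of_2_between[OF N0] by blast
    have "(2::nat) ^ L0 < 2 ^ L" using N L by linarith
    then have "L0 < L" by simp
    have "tm_discrepancy x N \<le> 2 + metric_sum L x" by (rule tm_discrepancy_le_metric_sum[OF N0 L(1)])
    also have "\<dots> \<le> 2 + 2 powr (?e * real L)" using L0[of L] \<open>L0 < L\<close> by simp
    also have "\<dots> \<le> 3 * 2 powr (?e * real L)"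
      using e ge_one_powr_ge_zero[of 2 "?e * real L"] by simp
    also have "2 powr (?e * real L) = (2 ^ L) powr ?e"
    proof -
      have "(2::real) ^ L = 2 powr real L" by (simp add: powr_realpow)
      then show ?thesis by (simp only: powr_powr mult.commute)
    qed
    also have "\<dots> \<le> (4 * real N) powr ?e"
    proof (rule powr_mono2)
      show "(2::real) ^ L \<le> 4 * real N" using L(2) by (metis of_nat_le_iff of_nat_mult of_nat_numeral of_nat_power)
    qed (use e in auto)
    also have "\<dots> = 4 powr ?e * real N powr ?e" by (simp add: powr_mult)
    finally show ?thesis by simp
  qed
  note upper = this
  have nonneg: "tm_discrepancy x N \<ge> 0" for N
    by (rule order.trans[OF abs_ge_zero star_discrepancy_ge[of 0]]) auto
  show "tm_discrepancy x \<in> O(\<lambda>N. real N powr ?e)"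
  proof (rule bigoI, rule eventually_sequentiallyI)
    fix N :: nat assume "2 ^ L0 \<le> N"
    then show "norm (tm_discrepancy x N) \<le> (3 * 4 powr ?e) * norm (real N powr ?e)"
      unfolding real_norm_def using upper[of N] nonneg[of N] by (simp only: abs_of_nonneg powr_ge_zero)
  qed
qed

section \<open>Second moments of dilated periodic functions\<close>

lemma card_divisors_prime_power_mult_le:
  fixes p m :: nat
  assumes p: "prime p" and m: "m > 0"
  shows "card {d. d dvd p ^ a * m} \<le> (a + 1) * card {d. d dvd m}"
proof -
  have fin: "finite {d. d dvd m}" using m by (simp add: finite_divisors_nat)
  have "{d. d dvd p ^ a * m} \<subseteq> (\<lambda>(i, e). p ^ i * e) ` ({..a} \<times> {d. d dvd m})"
  proof
    fix d assume "d \<in> {d. d dvd p ^ a * m}"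
    then obtain b c where d: "d = b * c" "b dvd p ^ a" "c dvd m" using division_decomp by blast
    then obtain i where "i \<le> a" "b = p ^ i" using p by (auto simp: divides_primepow_nat)
    with d show "d \<in> (\<lambda>(i, e). p ^ i * e) ` ({..a} \<times> {d. d dvd m})" by auto
  qed
  then have "card {d. d dvd p ^ a * m} \<le> card ((\<lambda>(i, e). p ^ i * e) ` ({..a} \<times> {d. d dvd m}))"
    using fin by (intro card_mono) auto
  also have "\<dots> \<le> card ({..a} \<times> {d. d dvd m})" using fin by (intro card_image_le) auto
  finally show ?thesis by (simp add: card_cartesian_product)
qed

text \<open>Prime powers are removed one at a time. The factor a + 1 is at most p^(a \<delta>) once
  p >= 2^(1/\<delta>), and at most K p^(a \<delta>) for every prime. The weaker estimate is used
  only for primes up to B, so K^B bounds the total loss.\<close>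

lemma card_divisors_le:
  fixes \<delta> :: real
  assumes d: "\<delta> > 0"
  shows "\<exists>C>0. \<forall>n>0. real (card {d. d dvd n}) \<le> C * real n powr \<delta>"
proof -
  let ?d = "\<lambda>n. real (card {d. d dvd n})"
  \<comment> \<open>From 1 + a \<delta> ln 2 <= 2^(a \<delta>): multiplying the left side by this K
    gives at least a + 1.\<close>
  define K where "K = 1 + 1 / (\<delta> * ln 2)"
  have K: "K \<ge> 1" using d by (simp add: K_def)
  define B where "B = nat \<lceil>2 powr (1 / \<delta>)\<rceil>"
  have local: "real a + 1 \<le> (if p \<le> B then K else 1) * real (p ^ a) powr \<delta>" if p: "prime p" for p a :: nat
  proof -
    have p2: "p \<ge> 2" using p by (rule prime_ge_2_nat)
    have pa: "real (p ^ a) powr \<delta> = (real p powr \<delta>) ^ a"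
      using p2 by (simp add: powr_power powr_powr[symmetric] powr_realpow[symmetric] mult.commute powr_powr_swap)
    show ?thesis
    proof (cases "p \<le> B")
      case True
      have "1 + real a * (\<delta> * ln 2) \<le> exp (real a * (\<delta> * ln 2))" by (rule exp_ge_add_one_self)
      also have "\<dots> = (2 powr \<delta>) ^ a" by (simp add: powr_def exp_of_nat_mult)
      also have "\<dots> \<le> (real p powr \<delta>) ^ a" using p2 d by (intro power_mono powr_mono2) auto
      finally have "K * (1 + real a * (\<delta> * ln 2)) \<le> K * (real p powr \<delta>) ^ a" using K by (intro mult_left_mono) auto
      moreover have "K * (1 + real a * (\<delta> * ln 2)) = 1 + real a + real a * (\<delta> * ln 2) + 1 / (\<delta> * ln 2)"
        using d by (simp add: K_def field_simps)
      moreover have "real a * (\<delta> * ln 2) \<ge> 0" "1 / (\<delta> * ln 2) \<ge> 0" using d by simp_all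
      ultimately have "real a + 1 \<le> K * (real p powr \<delta>) ^ a" by linarith
      then show ?thesis using True unfolding pa by simp
    next
      case False
      then have "2 powr (1 / \<delta>) \<le> real p" by (simp add: B_def) linarith
      then have "(2 powr (1 / \<delta>)) powr \<delta> \<le> real p powr \<delta>" using d by (intro powr_mono2) auto
      then have "2 \<le> real p powr \<delta>" using d by (simp add: powr_powr)
      then have "2 ^ a \<le> (real p powr \<delta>) ^ a" by (intro power_mono) auto
      moreover have "real a + 1 \<le> 2 ^ a"
      proof -
        have "a + 1 \<le> 2 ^ a" using less_exp[of a] by (simp add: Suc_le_eq)
        then have "real (a + 1) \<le> real (2 ^ a)" by (simp only: of_nat_le_iff)
        then show ?thesis by simp
      qed
      ultimately show ?thesis using False unfolding pa by simp
    qed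
  qed
  have main: "?d n \<le> K ^ card {p. prime p \<and> p \<le> B \<and> p dvd n} * real n powr \<delta>" if "n > 0" for n :: nat
    using that
  proof (induction n rule: less_induct)
    case (less n)
    show ?case
    proof (cases "n = 1")
      case True
      then show ?thesis using K by (simp add: one_le_power)
    next
      case False
      then obtain p where p: "prime p" "p dvd n" using prime_factor_nat by blast
      define a where "a = multiplicity p n"
      obtain m where m: "n = p ^ a * m" "\<not> p dvd m"
        unfolding a_def by (rule multiplicity_decompose'[of n p]) (use p less.prems in auto)
      have m0: "m > 0" using m less.prems by (cases m) auto
      have "a \<noteq> 0" using m p by (metis mult_1 power_0)
      then have "p ^ a > 1" by (intro one_less_power prime_gt_1_nat p) simp
      then have "m < n" using m m0 by simp
      define c where "c n = card {p. prime p \<and> p \<le> B \<and> p dvd n}" for n :: nat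
      have cn: "(if p \<le> B then K else 1) * K ^ c m \<le> K ^ c n"
      proof (cases "p \<le> B")
        case True
        have "insert p {q. prime q \<and> q \<le> B \<and> q dvd m} \<subseteq> {q. prime q \<and> q \<le> B \<and> q dvd n}"
          using True p m by auto
        then have "card (insert p {q. prime q \<and> q \<le> B \<and> q dvd m}) \<le> c n"
          unfolding c_def by (intro card_mono) auto
        then have "Suc (c m) \<le> c n" unfolding c_def using m by (subst (asm) card_insert_disjoint) auto
        then have "K ^ Suc (c m) \<le> K ^ c n" using K by (intro power_increasing) auto
        then show ?thesis using True by simp
      next
        case False
        have "c m \<le> c n" unfolding c_def by (intro card_mono) (auto simp: m)
        then show ?thesis using False K by (simp add: power_increasing)
      qed
      have "card {d. d dvd n} \<le> (a + 1) * card {d. d dvd m}"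
        unfolding m(1) by (rule card_divisors_prime_power_mult_le[OF p(1) m0])
      then have "?d n \<le> real ((a + 1) * card {d. d dvd m})" by (simp only: of_nat_le_iff)
      also have "\<dots> = (real a + 1) * ?d m" by (simp only: of_nat_mult of_nat_add of_nat_1)
      also have "\<dots> \<le> ((if p \<le> B then K else 1) * real (p ^ a) powr \<delta>) * (K ^ c m * real m powr \<delta>)"
        using local[OF p(1), of a] less.IH[OF \<open>m < n\<close> m0] K unfolding c_def by (intro mult_mono) auto
      also have "\<dots> = ((if p \<le> B then K else 1) * K ^ c m) * real n powr \<delta>"
        unfolding m(1) of_nat_mult by (simp add: powr_mult)
      also have "\<dots> \<le> K ^ c n * real n powr \<delta>" by (intro mult_right_mono cn) auto
      finally show ?thesis by (simp add: c_def)
    qed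
  qed
  have "?d n \<le> K ^ B * real n powr \<delta>" if "n > 0" for n :: nat
  proof -
    have "card {p. prime p \<and> p \<le> B \<and> p dvd n} \<le> card {1..B}"
      by (intro card_mono) (auto dest: prime_ge_1_nat)
    then have "K ^ card {p. prime p \<and> p \<le> B \<and> p dvd n} * real n powr \<delta> \<le> K ^ B * real n powr \<delta>"
      using K by (intro mult_right_mono power_increasing) auto
    then show ?thesis using main[OF that] by linarith
  qed
  moreover have "K ^ B > 0" using K by simp
  ultimately show ?thesis by blast
qed

section \<open>Fejer means and their variance along the multiples of a point\<close>

lemma fejer_add_int: "fejer M (t + of_int n) = fejer M t"
proof -
  have "unit_exp (real j * (t + of_int n)) = unit_exp (real j * t)" for j
  proof -
    have "real j * (t + of_int n) = real j * t + of_int (int j * n)" by (simp add: algebra_simps)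
    then show ?thesis by (simp only: unit_exp_add unit_exp_of_int mult_1_right)
  qed
  then show ?thesis by (simp add: fejer_def)
qed

lemma periodic_add_int:
  fixes g :: "real \<Rightarrow> 'a"
  assumes "\<And>x. g (x + 1) = g x"
  shows "g (x + of_int n) = g x"
proof -
  have *: "g (x + real k) = g x" for x k
    by (induction k) (use assms[of "x + real k" for k] in \<open>auto simp: add_ac\<close>)
  show ?thesis
  proof (cases "n \<ge> 0")
    case True
    then show ?thesis using *[of x "nat n"] by simp
  next
    case False
    then show ?thesis using *[of "x + of_int n" "nat (- n)"] by simp
  qed
qed

text \<open>Smoothing turns g into a trigonometric polynomial with frequencies below M in absolute
  value. The products of these frequencies with h <= H are at most H M, and this makes a uniform
  divisor bound available.\<close>

definition fejer_mean :: "nat \<Rightarrow> (real \<Rightarrow> real) \<Rightarrow> real \<Rightarrow> real" where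
  "fejer_mean M g x = integral {0..1} (\<lambda>t. g t * fejer M (x - t))"

lemma has_integral_fejer:
  "M > 0 \<Longrightarrow> ((\<lambda>t. fejer M (x - t)) has_integral 1) {0..1}"
  using integral_fejer_period[of M 0 x] fejer_integrable[of M x 0 1] by (simp add: has_integral_iff)

text \<open>Modulo 1, either t is within \<eta> of x, where g varies by at most C \<eta>, or it is
  farther away, where the kernel is at most 1 / (M \<eta>^2) and g varies by at most 1.\<close>

lemma fejer_mean_approx:
  fixes g :: "real \<Rightarrow> real"
  assumes cont: "continuous_on UNIV g" and per: "\<And>x. g (x + 1) = g x"
    and g01: "\<And>x. 0 \<le> g x \<and> g x \<le> 1" and lip: "\<And>x y. \<bar>g x - g y\<bar> \<le> C * \<bar>x - y\<bar>"
    and M: "M > 0" and eta: "0 < \<eta>" "\<eta> \<le> 1 / 2" and C: "C \<ge> 0"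
  shows "\<bar>fejer_mean M g x - g x\<bar> \<le> C * \<eta> + 1 / (real M * \<eta>\<^sup>2)"
proof -
  have gi: "(\<lambda>t. g t * fejer M (x - t)) integrable_on {0..1}"
    by (intro integrable_continuous_real continuous_intros continuous_on_subset[OF cont]) auto
  have pt: "\<bar>(g t - g x) * fejer M (x - t)\<bar> \<le> C * \<eta> * fejer M (x - t) + 1 / (real M * \<eta>\<^sup>2)" for t
  proof -
    define r where "r = frac (x - t)"
    define n where "n = \<lfloor>x - t\<rfloor>"
    have x: "x = t + r + of_int n" by (simp add: r_def n_def frac_def)
    have r: "0 \<le> r" "r < 1" by (auto simp: r_def frac_lt_1)
    have K0: "fejer M (x - t) \<ge> 0" by (rule fejer_nonneg)
    have B0: "1 / (real M * \<eta>\<^sup>2) \<ge> 0" by simp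
    have gx: "g x = g (t + r)" unfolding x using periodic_add_int[of g, OF per] by simp
    consider "r \<le> \<eta>" | "\<eta> \<le> r" "r \<le> 1 - \<eta>" | "1 - \<eta> \<le> r" by linarith
    then show ?thesis
    proof cases
      case 1
      have "\<bar>g t - g x\<bar> \<le> C * \<bar>t - (t + r)\<bar>" unfolding gx by (rule lip)
      also have "\<dots> \<le> C * \<eta>" using 1 r C by (intro mult_left_mono) auto
      finally have "\<bar>g t - g x\<bar> * fejer M (x - t) \<le> C * \<eta> * fejer M (x - t)" using K0 by (rule mult_right_mono)
      then show ?thesis unfolding abs_mult abs_of_nonneg[OF K0] using B0 by linarith
    next
      case 2
      have "fejer M (x - t) = fejer M (r + of_int n)" by (simp add: x)
      also have "\<dots> = fejer M r" by (rule fejer_add_int)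
      also have "\<dots> \<le> 1 / (real M * \<eta>\<^sup>2)" using 2 eta M by (intro fejer_le) auto
      finally have "fejer M (x - t) \<le> 1 / (real M * \<eta>\<^sup>2)" .
      moreover have "\<bar>g t - g x\<bar> \<le> 1" using g01[of t] g01[of x] by linarith
      ultimately have "\<bar>g t - g x\<bar> * fejer M (x - t) \<le> 1 * (1 / (real M * \<eta>\<^sup>2))"
        using K0 by (intro mult_mono) auto
      moreover have "C * \<eta> * fejer M (x - t) \<ge> 0" using C eta K0 by simp
      ultimately show ?thesis using K0 by (simp add: abs_mult)
    next
      case 3
      have "g (t + r) = g ((t + r - 1) + 1)" by simp
      also have "\<dots> = g (t + r - 1)" by (rule per)
      finally have gx': "g (t + r) = g (t + r - 1)" .
      have "\<bar>g t - g x\<bar> \<le> C * \<bar>t - (t + r - 1)\<bar>" unfolding gx gx' by (rule lip)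
      also have "\<dots> \<le> C * \<eta>" using 3 r C by (intro mult_left_mono) auto
      finally have "\<bar>g t - g x\<bar> * fejer M (x - t) \<le> C * \<eta> * fejer M (x - t)" using K0 by (rule mult_right_mono)
      then show ?thesis unfolding abs_mult abs_of_nonneg[OF K0] using B0 by linarith
    qed
  qed
  have 1: "((\<lambda>t. (g t - g x) * fejer M (x - t)) has_integral fejer_mean M g x - g x) {0..1}"
    using has_integral_diff[OF integrable_integral[OF gi] has_integral_mult_right[OF has_integral_fejer[OF M, of x], of "g x"]]
    by (simp add: fejer_mean_def left_diff_distrib)
  have 2: "((\<lambda>t. C * \<eta> * fejer M (x - t) + 1 / (real M * \<eta>\<^sup>2)) has_integral C * \<eta> * 1 + 1 / (real M * \<eta>\<^sup>2)) {0..1}"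
    using has_integral_const_real[of "1 / (real M * \<eta>\<^sup>2)" 0 "1::real"]
    by (intro has_integral_add has_integral_mult_right has_integral_fejer M) simp
  have "norm (integral {0..1} (\<lambda>t. (g t - g x) * fejer M (x - t)))
      \<le> integral {0..1} (\<lambda>t. C * \<eta> * fejer M (x - t) + 1 / (real M * \<eta>\<^sup>2))"
    by (rule integral_norm_bound_integral)
       (use 1 2 pt in \<open>auto simp: has_integral_integrable\<close>)
  then show ?thesis using integral_unique[OF 1] integral_unique[OF 2] by simp
qed

lemma fejer_mean_bounds:
  fixes g :: "real \<Rightarrow> real"
  assumes cont: "continuous_on UNIV g" and g01: "\<And>x. 0 \<le> g x \<and> g x \<le> 1" and M: "M > 0"
  shows "0 \<le> fejer_mean M g x" "fejer_mean M g x \<le> 1"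
proof -
  have gi: "(\<lambda>t. g t * fejer M (x - t)) integrable_on {0..1}"
    by (intro integrable_continuous_real continuous_intros continuous_on_subset[OF cont]) auto
  show "0 \<le> fejer_mean M g x" unfolding fejer_mean_def
    by (intro Henstock_Kurzweil_Integration.integral_nonneg gi) (use g01 fejer_nonneg in auto)
  have "fejer_mean M g x \<le> integral {0..1} (\<lambda>t. fejer M (x - t))"
    unfolding fejer_mean_def
    by (intro integral_le gi fejer_integrable) (use g01 fejer_nonneg in \<open>auto intro: mult_left_le_one_le\<close>)
  then show "fejer_mean M g x \<le> 1" using integral_fejer_period[OF M, of 0 x] by simp
qed

text \<open>Of the coefficients only the mean is identified, as b 0; the sizes of the others are
  later controlled through Parseval.\<close>

lemma fejer_mean_fourier:
  fixes g :: "real \<Rightarrow> real"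
  assumes cont: "continuous_on UNIV g" and M: "M > 0"
  shows "\<exists>b. b 0 = complex_of_real (integral {0..1} g) \<and>
    (\<forall>x. complex_of_real (fejer_mean M g x) = (\<Sum>m\<in>{- int M<..<int M}. b m * unit_exp (of_int m * x)))"
proof -
  define c where "c m = integral {0..1} (\<lambda>t. complex_of_real (g t) * unit_exp (- of_int m * t))" for m :: int
  define P where "P = {..<M} \<times> {..<M}"
  define D where "D = (\<lambda>(j::nat, k::nat). int j - int k)"
  define b where "b m = (\<Sum>p\<in>{p \<in> P. D p = m}. c m / of_nat M)" for m
  have cg: "continuous_on {0..1} g" by (rule continuous_on_subset[OF cont]) auto
  have c: "((\<lambda>t. complex_of_real (g t) * unit_exp (- of_int m * t)) has_integral c m) {0..1}" for m
    unfolding c_def by (intro integrable_integral integrable_continuous_real continuous_intros cg)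
  have b0: "b 0 = complex_of_real (integral {0..1} g)"
  proof -
    have "{p \<in> P. D p = 0} = (\<lambda>j. (j, j)) ` {..<M}" by (auto simp: P_def D_def)
    then have "card {p \<in> P. D p = 0} = M" by (simp add: card_image inj_on_def)
    moreover have "c 0 = complex_of_real (integral {0..1} g)"
    proof -
      have "(g has_integral integral {0..1} g) {0..1}"
        by (intro integrable_integral integrable_continuous_real cg)
      then have "((complex_of_real \<circ> g) has_integral complex_of_real (integral {0..1} g)) {0..1}"
        by (rule has_integral_linear) (rule bounded_linear_of_real)
      then show ?thesis by (simp add: c_def o_def integral_unique)
    qed
    ultimately show ?thesis using M by (simp add: b_def)
  qed
  have "complex_of_real (fejer_mean M g x) = (\<Sum>m\<in>{- int M<..<int M}. b m * unit_exp (of_int m * x))" for x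
  proof -
    let ?s = "\<lambda>t p. complex_of_real (g t) * unit_exp (- of_int (D p) * t) * (unit_exp (of_int (D p) * x) / of_nat M)"
    have "((\<lambda>t. g t * fejer M (x - t)) has_integral fejer_mean M g x) {0..1}"
      unfolding fejer_mean_def by (intro integrable_integral integrable_continuous_real continuous_intros cg)
    then have "((complex_of_real \<circ> (\<lambda>t. g t * fejer M (x - t))) has_integral complex_of_real (fejer_mean M g x)) {0..1}"
      by (rule has_integral_linear) (rule bounded_linear_of_real)
    moreover have "(complex_of_real \<circ> (\<lambda>t. g t * fejer M (x - t))) t
        = (\<Sum>p\<in>P. ?s t p)" if "t \<in> {0..1}" for t
    proof -
      have "complex_of_real (fejer M (x - t)) = (\<Sum>p\<in>P. unit_exp (of_int (D p) * (x - t))) / of_nat M"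
        unfolding fejer_complex P_def by (simp add: sum.cartesian_product D_def case_prod_beta)
      moreover have "unit_exp (of_int d * (x - t)) = unit_exp (- of_int d * t) * unit_exp (of_int d * x)" for d
        by (simp add: unit_exp_add[symmetric] algebra_simps)
      ultimately have "(complex_of_real \<circ> (\<lambda>t. g t * fejer M (x - t))) t
          = complex_of_real (g t) * ((\<Sum>p\<in>P. unit_exp (- of_int (D p) * t) * unit_exp (of_int (D p) * x)) / of_nat M)"
        by (simp only: o_def of_real_mult)
      also have "\<dots> = (\<Sum>p\<in>P. ?s t p)"
        unfolding sum_divide_distrib sum_distrib_left by (intro sum.cong refl) (simp only: times_divide_eq_right mult.assoc)
      finally show ?thesis .
    qed
    ultimately have "((\<lambda>t. \<Sum>p\<in>P. ?s t p)
        has_integral complex_of_real (fejer_mean M g x)) {0..1}" by (rule has_integral_eq[rotated])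
    moreover have "((\<lambda>t. \<Sum>p\<in>P. ?s t p)
        has_integral (\<Sum>p\<in>P. c (D p) * (unit_exp (of_int (D p) * x) / of_nat M))) {0..1}"
      by (intro has_integral_sum has_integral_mult_left c) (simp add: P_def)
    ultimately have "complex_of_real (fejer_mean M g x) = (\<Sum>p\<in>P. c (D p) * (unit_exp (of_int (D p) * x) / of_nat M))"
      by (rule has_integral_unique)
    also have "\<dots> = (\<Sum>m\<in>{- int M<..<int M}. \<Sum>p\<in>{p \<in> P. D p = m}. c (D p) * (unit_exp (of_int (D p) * x) / of_nat M))"
      by (rule sum.group[symmetric]) (auto simp: P_def D_def)
    also have "\<dots> = (\<Sum>m\<in>{- int M<..<int M}. b m * unit_exp (of_int m * x))"
      unfolding b_def sum_distrib_right by (intro sum.cong refl) auto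
    finally show ?thesis .
  qed
  with b0 show ?thesis by blast
qed

lemma has_integral_unit_exp_period:
  "((\<lambda>x. unit_exp (of_int n * x)) has_integral (if n = 0 then 1 else 0)) {0..1}"
proof (cases "n = 0")
  case True
  then show ?thesis using has_integral_const_real[of "1::complex" 0 1] by simp
next
  case False
  have "((\<lambda>t. (2 * pi * of_int n * \<i>) * unit_exp (of_int n * t)) has_integral
      unit_exp (of_int n * 1) - unit_exp (of_int n * 0)) {0..1}"
    using has_integral_unit_exp[of "of_int n" 0 1] False by simp
  from has_integral_divide[OF this, of "2 * pi * of_int n * \<i>"] False
  show ?thesis by simp
qed

text \<open>Indices and frequencies are kept apart because several indices may share a frequency, as
  the products h m do below.\<close>

lemma integral_norm_trig_sum:
  fixes \<nu> :: "'i \<Rightarrow> int" and c :: "'i \<Rightarrow> complex"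
  assumes fin: "finite I"
  shows "integral {0..1} (\<lambda>x. (norm (\<Sum>i\<in>I. c i * unit_exp (of_int (\<nu> i) * x)))\<^sup>2)
    = (\<Sum>i\<in>I. \<Sum>j\<in>I. if \<nu> j = \<nu> i then Re (c i * cnj (c j)) else 0)"
proof -
  define f where "f x = (norm (\<Sum>i\<in>I. c i * unit_exp (of_int (\<nu> i) * x)))\<^sup>2" for x
  have expand: "complex_of_real (f x) = (\<Sum>i\<in>I. \<Sum>j\<in>I. c i * cnj (c j) * unit_exp (of_int (\<nu> i - \<nu> j) * x))" for x
  proof -
    have "complex_of_real (f x) = (\<Sum>i\<in>I. \<Sum>j\<in>I. (c i * unit_exp (of_int (\<nu> i) * x)) * cnj (c j * unit_exp (of_int (\<nu> j) * x)))"
      unfolding f_def by (simp only: complex_norm_square sum_product cnj_sum)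
    also have "\<dots> = (\<Sum>i\<in>I. \<Sum>j\<in>I. c i * cnj (c j) * unit_exp (of_int (\<nu> i - \<nu> j) * x))"
    proof (intro sum.cong refl)
      fix i j
      have "unit_exp (of_int (\<nu> i - \<nu> j) * x) = unit_exp (of_int (\<nu> i) * x) * cnj (unit_exp (of_int (\<nu> j) * x))"
        by (simp add: unit_exp_minus[symmetric] unit_exp_add[symmetric] algebra_simps)
      then show "(c i * unit_exp (of_int (\<nu> i) * x)) * cnj (c j * unit_exp (of_int (\<nu> j) * x))
          = c i * cnj (c j) * unit_exp (of_int (\<nu> i - \<nu> j) * x)"
        by (simp only: complex_cnj_mult mult_ac)
    qed
    finally show ?thesis .
  qed
  have "((\<lambda>x. complex_of_real (f x)) has_integral
      (\<Sum>i\<in>I. \<Sum>j\<in>I. c i * cnj (c j) * (if \<nu> i - \<nu> j = 0 then 1 else 0))) {0..1}"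
    unfolding expand by (intro has_integral_sum has_integral_mult_right has_integral_unit_exp_period fin)
  then have "((Re \<circ> (\<lambda>x. complex_of_real (f x))) has_integral
      Re (\<Sum>i\<in>I. \<Sum>j\<in>I. c i * cnj (c j) * (if \<nu> i - \<nu> j = 0 then 1 else 0))) {0..1}"
    by (rule has_integral_linear) (rule bounded_linear_Re)
  then have "integral {0..1} f = Re (\<Sum>i\<in>I. \<Sum>j\<in>I. c i * cnj (c j) * (if \<nu> i - \<nu> j = 0 then 1 else 0))"
    by (simp add: o_def integral_unique)
  also have "\<dots> = (\<Sum>i\<in>I. \<Sum>j\<in>I. if \<nu> j = \<nu> i then Re (c i * cnj (c j)) else 0)"
    unfolding Re_sum by (intro sum.cong refl) auto
  finally show ?thesis by (simp add: f_def[abs_def])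
qed

(* Only pairs of indices with equal frequency survive the integration; there
   Re (c i * cnj (c j)) is at most the average of the squared norms. *)
lemma integral_norm_trig_sum_le:
  fixes \<nu> :: "'i \<Rightarrow> int" and c :: "'i \<Rightarrow> complex"
  assumes fin: "finite I" and D: "\<And>i. i \<in> I \<Longrightarrow> real (card {j \<in> I. \<nu> j = \<nu> i}) \<le> D"
  shows "integral {0..1} (\<lambda>x. (norm (\<Sum>i\<in>I. c i * unit_exp (of_int (\<nu> i) * x)))\<^sup>2) \<le> D * (\<Sum>i\<in>I. (norm (c i))\<^sup>2)"
proof -
  let ?P = "\<lambda>x. (norm (\<Sum>i\<in>I. c i * unit_exp (of_int (\<nu> i) * x)))\<^sup>2" and ?n = "\<lambda>i. (norm (c i))\<^sup>2 / 2"
    and ?r = "\<lambda>i j. Re (c i * cnj (c j))"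
  have "integral {0..1} ?P
      = (\<Sum>i\<in>I. \<Sum>j\<in>I. if \<nu> j = \<nu> i then ?r i j else 0)"
    by (rule integral_norm_trig_sum[OF fin])
  also have "\<dots> \<le> (\<Sum>i\<in>I. \<Sum>j\<in>I. if \<nu> j = \<nu> i then ?n i + ?n j else 0)"
  proof (intro sum_mono)
    fix i j
    have "?r i j \<le> norm (c i) * norm (c j)"
      using complex_Re_le_cmod[of "c i * cnj (c j)"] by (simp add: norm_mult)
    also have "\<dots> \<le> ?n i + ?n j"
      using zero_le_power2[of "norm (c i) - norm (c j)"] by (simp add: power2_diff)
    finally show "(if \<nu> j = \<nu> i then ?r i j else 0)
        \<le> (if \<nu> j = \<nu> i then ?n i + ?n j else 0)" by simp
  qed
  also have "\<dots> = (\<Sum>i\<in>I. \<Sum>j\<in>I. if \<nu> j = \<nu> i then ?n i else 0)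
      + (\<Sum>i\<in>I. \<Sum>j\<in>I. if \<nu> j = \<nu> i then ?n j else 0)"
    unfolding sum.distrib[symmetric] by (intro sum.cong refl) auto
  also have "(\<Sum>i\<in>I. \<Sum>j\<in>I. if \<nu> j = \<nu> i then ?n j else 0)
      = (\<Sum>i\<in>I. \<Sum>j\<in>I. if \<nu> j = \<nu> i then ?n i else 0)"
    by (subst sum.swap) (intro sum.cong refl, auto)
  also have "(\<Sum>i\<in>I. \<Sum>j\<in>I. if \<nu> j = \<nu> i then ?n i else 0)
      = (\<Sum>i\<in>I. real (card {j \<in> I. \<nu> j = \<nu> i}) * (?n i))"
  proof (intro sum.cong refl)
    fix i
    have "I \<inter> {j. \<nu> j = \<nu> i} = {j \<in> I. \<nu> j = \<nu> i}" by auto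
    then show "(\<Sum>j\<in>I. if \<nu> j = \<nu> i then ?n i else 0) = real (card {j \<in> I. \<nu> j = \<nu> i}) * (?n i)"
      using fin by (simp add: sum.If_cases)
  qed
  also have "\<dots> \<le> (\<Sum>i\<in>I. D * (?n i))"
    by (intro sum_mono mult_right_mono D) auto
  finally have "integral {0..1} ?P \<le> (\<Sum>i\<in>I. D * (?n i)) + (\<Sum>i\<in>I. D * (?n i))" by simp
  also have "\<dots> = D * (\<Sum>i\<in>I. (norm (c i))\<^sup>2)"
    by (simp add: sum_distrib_left sum.distrib[symmetric])
  finally show ?thesis .
qed

text \<open>With the mean removed, the sum over h is a trigonometric sum indexed by pairs (h, m)
  with nonzero frequency h m. Such a frequency is divisible by h, and h determines m, so it is
  repeated at most D times. The bound is linear in \<mu> because the smoothed function takes values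
  in [0, 1], so its square has integral at most \<mu>; relative to (H \<mu>)^2 it is D / (H
  \<mu>).\<close>

lemma fejer_mean_variance:
  fixes g :: "real \<Rightarrow> real" and H M :: nat
  assumes cont: "continuous_on UNIV g" and g01: "\<And>x. 0 \<le> g x \<and> g x \<le> 1" and M: "M > 0"
    and D: "\<And>n. 0 < n \<Longrightarrow> n \<le> H * M \<Longrightarrow> real (card {d. d dvd n}) \<le> D"
    and "D \<ge> 0"
  defines "\<mu> \<equiv> integral {0..1} g"
  shows "continuous_on A (fejer_mean M g)"
    "integral {0..1} (\<lambda>x. ((\<Sum>h = 1..H. fejer_mean M g (real h * x)) - real H * \<mu>)\<^sup>2) \<le> real H * D * \<mu>"
proof -
  let ?V = "\<lambda>x. ((\<Sum>h = 1..H. fejer_mean M g (real h * x)) - real H * \<mu>)\<^sup>2"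
  define F where "F = {- int M<..<int M}"
  define B where "B = F - {0}"
  have fin: "finite F" "finite B" "0 \<in> F" using M by (auto simp: F_def B_def)
  obtain b where b0: "b 0 = complex_of_real \<mu>"
    and b: "\<And>x. complex_of_real (fejer_mean M g x) = (\<Sum>m\<in>F. b m * unit_exp (of_int m * x))"
    using fejer_mean_fourier[OF cont M] unfolding \<mu>_def F_def by blast
  have re: "fejer_mean M g x = Re (\<Sum>m\<in>F. b m * unit_exp (of_int m * x))" for x
    unfolding b[symmetric] by simp
  show cm: "continuous_on A (fejer_mean M g)" for A
    unfolding re[abs_def] by (intro continuous_intros)
  have "((\<lambda>x. complex_of_real (fejer_mean M g x)) has_integral (\<Sum>m\<in>F. b m * (if m = 0 then 1 else 0))) {0..1}"
    unfolding b by (intro has_integral_sum has_integral_mult_right has_integral_unit_exp_period fin)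
  then have "((Re \<circ> (\<lambda>x. complex_of_real (fejer_mean M g x))) has_integral
      Re (\<Sum>m\<in>F. b m * (if m = 0 then 1 else 0))) {0..1}"
    by (rule has_integral_linear) (rule bounded_linear_Re)
  moreover have "(\<Sum>m\<in>F. b m * (if m = 0 then 1 else 0)) = b 0"
    using fin by (simp add: if_distrib[of "\<lambda>z. b _ * z"] sum.delta cong: if_cong)
  ultimately have mean: "integral {0..1} (fejer_mean M g) = \<mu>"
    by (simp add: o_def b0 integral_unique)
  have parseval: "(\<Sum>m\<in>F. (norm (b m))\<^sup>2) \<le> \<mu>"
  proof -
    have "(\<Sum>m\<in>F. (norm (b m))\<^sup>2) = (\<Sum>m\<in>F. \<Sum>k\<in>F. if k = m then Re (b m * cnj (b k)) else 0)"
      using fin by (intro sum.cong refl) (simp add: sum.delta complex_mult_cnj cmod_power2)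
    also have "\<dots> = integral {0..1} (\<lambda>x. (norm (\<Sum>m\<in>F. b m * unit_exp (of_int m * x)))\<^sup>2)"
      using integral_norm_trig_sum[OF fin(1), of b "\<lambda>m. m"] by simp
    also have "\<dots> = integral {0..1} (\<lambda>x. (fejer_mean M g x)\<^sup>2)"
      unfolding b[symmetric] by simp
    also have "\<dots> \<le> integral {0..1} (fejer_mean M g)"
      using fejer_mean_bounds[OF cont g01 M]
      by (intro integral_le integrable_continuous_real continuous_intros cm)
         (auto simp: power2_eq_square mult_left_le)
    finally show ?thesis using mean by simp
  qed
  define I where "I = {1..H} \<times> B"
  define \<nu> where "\<nu> = (\<lambda>(h, m). int h * m)"
  have V: "norm (\<Sum>i\<in>I. b (snd i) * unit_exp (of_int (\<nu> i) * x)) ^ 2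
      = ?V x" for x
  proof -
    have "complex_of_real (fejer_mean M g y - \<mu>) = (\<Sum>m\<in>B. b m * unit_exp (of_int m * y))" for y
      unfolding of_real_diff b B_def using fin by (subst sum.remove[of F 0]) (auto simp: b0)
    then have "(\<Sum>h = 1..H. complex_of_real (fejer_mean M g (real h * x) - \<mu>))
        = (\<Sum>h = 1..H. \<Sum>m\<in>B. b m * unit_exp (of_int m * (real h * x)))" by simp
    also have "\<dots> = (\<Sum>i\<in>I. b (snd i) * unit_exp (of_int (\<nu> i) * x))"
      unfolding I_def by (simp add: sum.cartesian_product \<nu>_def case_prod_beta mult_ac)
    also have "(\<Sum>h = 1..H. complex_of_real (fejer_mean M g (real h * x) - \<mu>))
        = complex_of_real ((\<Sum>h = 1..H. fejer_mean M g (real h * x)) - real H * \<mu>)"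
      by (simp add: sum_subtractf)
    finally show ?thesis by (metis norm_of_real power2_abs)
  qed
  have "integral {0..1} ?V
      \<le> D * (\<Sum>i\<in>I. (norm (b (snd i)))\<^sup>2)"
    unfolding V[symmetric]
  proof (rule integral_norm_trig_sum_le)
    show "finite I" using fin by (simp add: I_def)
    fix i assume i: "i \<in> I"
    define n where "n = nat \<bar>\<nu> i\<bar>"
    have n0: "n > 0" using i by (auto simp: n_def \<nu>_def I_def B_def)
    have nH: "n \<le> H * M"
    proof -
      obtain h m where i': "i = (h, m)" by (cases i)
      then have hm: "h \<le> H" "\<bar>m\<bar> \<le> int M" using i by (auto simp: I_def B_def F_def)
      then have "int h * \<bar>m\<bar> \<le> int H * int M" by (intro mult_mono) auto
      then show ?thesis using i' by (simp add: n_def \<nu>_def abs_mult nat_le_iff)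
    qed
    have "inj_on fst {j \<in> I. \<nu> j = \<nu> i}"
    proof (rule inj_onI)
      fix j k assume j: "j \<in> {j \<in> I. \<nu> j = \<nu> i}" and k: "k \<in> {j \<in> I. \<nu> j = \<nu> i}" and eq: "fst j = fst k"
      then have "int (fst j) * snd j = int (fst j) * snd k" by (simp add: \<nu>_def case_prod_beta)
      moreover have "fst j > 0" using j by (auto simp: I_def)
      ultimately show "j = k" using eq by (simp add: prod_eq_iff)
    qed
    then have c1: "card {j \<in> I. \<nu> j = \<nu> i} = card (fst ` {j \<in> I. \<nu> j = \<nu> i})" by (simp add: card_image)
    have "fst ` {j \<in> I. \<nu> j = \<nu> i} \<subseteq> {d. d dvd n}"
    proof
      fix d assume "d \<in> fst ` {j \<in> I. \<nu> j = \<nu> i}"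
      then obtain j where "\<nu> j = \<nu> i" "d = fst j" by blast
      then have "\<nu> i = int d * snd j" unfolding \<nu>_def case_prod_beta by simp
      then have "int d dvd \<bar>\<nu> i\<bar>" by simp
      then have "int d dvd int n" by (simp add: n_def)
      then show "d \<in> {d. d dvd n}" by simp
    qed
    then have "card (fst ` {j \<in> I. \<nu> j = \<nu> i}) \<le> card {d. d dvd n}"
      using n0 by (intro card_mono finite_divisors_nat)
    then have "real (card {j \<in> I. \<nu> j = \<nu> i}) \<le> real (card {d. d dvd n})" using c1 by simp
    then show "real (card {j \<in> I. \<nu> j = \<nu> i}) \<le> D" using D[OF n0 nH] by linarith
  qed
  also have "(\<Sum>i\<in>I. (norm (b (snd i)))\<^sup>2) = real H * (\<Sum>m\<in>B. (norm (b m))\<^sup>2)"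
    unfolding I_def by (simp add: sum.cartesian_product[symmetric, where g = "\<lambda>h m. (norm (b m))\<^sup>2", unfolded case_prod_beta])
  also have "D * (real H * (\<Sum>m\<in>B. (norm (b m))\<^sup>2)) \<le> D * (real H * \<mu>)"
  proof (intro mult_left_mono)
    have "(\<Sum>m\<in>B. (norm (b m))\<^sup>2) \<le> (\<Sum>m\<in>F. (norm (b m))\<^sup>2)"
      using fin by (intro sum_mono2) (auto simp: B_def)
    then show "(\<Sum>m\<in>B. (norm (b m))\<^sup>2) \<le> \<mu>" using parseval by linarith
  qed (use \<open>D \<ge> 0\<close> in auto)
  finally show "integral {0..1} ?V \<le> real H * D * \<mu>"
    by (simp add: mult_ac)
qed

section \<open>The lower bound\<close>

lemma norm_unit_exp_diff_le: "norm (unit_exp a - unit_exp b) \<le> 2 * pi * \<bar>a - b\<bar>"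
proof -
  have "unit_exp a - unit_exp b = unit_exp a * (1 - unit_exp (b - a))"
    by (simp add: right_diff_distrib unit_exp_add[symmetric])
  then have "norm (unit_exp a - unit_exp b) = 2 * \<bar>sin (pi * (b - a))\<bar>"
    by (simp only: norm_mult norm_unit_exp norm_1_minus_unit_exp mult_1)
  also have "\<dots> \<le> 2 * \<bar>pi * (b - a)\<bar>" by (intro mult_left_mono abs_sin_x_le_abs_x) auto
  also have "\<dots> = 2 * pi * \<bar>a - b\<bar>" by (simp add: abs_mult abs_minus_commute)
  finally show ?thesis .
qed

section \<open>Level sets of the twisted sum\<close>

definition tm_amp :: "nat \<Rightarrow> real \<Rightarrow> real" where
  "tm_amp L x = norm (digit_poly (-1) (2 ^ L) x)"

lemma continuous_on_tm_amp [continuous_intros]: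
  fixes g :: "real \<Rightarrow> real"
  shows "continuous_on A g \<Longrightarrow> continuous_on A (\<lambda>x. tm_amp L (g x))"
  unfolding tm_amp_def by (intro continuous_intros)

lemma tm_amp_le: "tm_amp L x \<le> 2 ^ L"
proof -
  have "tm_amp L x \<le> (\<Sum>n<2 ^ L. norm ((-1::complex) ^ binary_digit_sum n * unit_exp (real n * x)))"
    unfolding tm_amp_def digit_poly_def by (rule norm_sum)
  then show ?thesis by (simp add: norm_mult norm_power)
qed

lemma tm_amp_lipschitz: "\<bar>tm_amp L x - tm_amp L y\<bar> \<le> 8 * 4 ^ L * \<bar>x - y\<bar>"
proof -
  let ?d = "\<lambda>n. (-1) ^ binary_digit_sum n * (unit_exp (real n * x) - unit_exp (real n * y))"
  have "\<bar>tm_amp L x - tm_amp L y\<bar> \<le> norm (digit_poly (-1) (2 ^ L) x - digit_poly (-1) (2 ^ L) y)"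
    unfolding tm_amp_def by (rule norm_triangle_ineq3)
  also have "\<dots> = norm (\<Sum>n<2 ^ L. ?d n)"
    by (simp add: digit_poly_def sum_subtractf right_diff_distrib)
  also have "\<dots> \<le> (\<Sum>n<2 ^ L. norm (?d n))"
    by (rule norm_sum)
  also have "\<dots> \<le> (\<Sum>n<2 ^ L::nat. 8 * 2 ^ L * \<bar>x - y\<bar>)"
  proof (rule sum_mono)
    fix n :: nat assume "n \<in> {..<2 ^ L}"
    then have "real n \<le> real (2 ^ L)" by (simp only: of_nat_le_iff lessThan_iff less_imp_le)
    then have n: "real n \<le> 2 ^ L" by simp
    have "norm (?d n)
        = norm (unit_exp (real n * x) - unit_exp (real n * y))" by (simp add: norm_mult norm_power)
    also have "\<dots> \<le> 2 * pi * \<bar>real n * x - real n * y\<bar>" by (rule norm_unit_exp_diff_le)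
    also have "\<dots> = 2 * pi * real n * \<bar>x - y\<bar>" by (simp add: right_diff_distrib[symmetric] abs_mult)
    also have "\<dots> \<le> 8 * 2 ^ L * \<bar>x - y\<bar>" using n pi_less_4 by (intro mult_right_mono mult_mono) auto
    finally show "norm (?d n) \<le> 8 * 2 ^ L * \<bar>x - y\<bar>" .
  qed
  also have "\<dots> = 8 * 4 ^ L * \<bar>x - y\<bar>"
  proof -
    have "(4::real) ^ L = 2 ^ L * 2 ^ L" by (simp flip: power_mult_distrib)
    then show ?thesis by simp
  qed
  finally show ?thesis .
qed

lemma tm_norm1_alt: "tm_norm1 L = integral {0..1} (tm_amp L)"
  unfolding tm_norm1_def tm_amp_def[abs_def] ..

text \<open>Keeps the dyadic levels used below at least 1/2, which in turn bounds the Lipschitz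
  constant of the cutoff.\<close>

lemma tm_norm1_ge_1: "tm_norm1 L \<ge> 1"
proof -
  have "integral {0..1} (\<lambda>x::real. (1 / 2) ^ L) \<le> integral {0..1} (iter1 L)"
    by (intro integral_le iter1_ge integrable_continuous_real continuous_intros continuous_on_iter1) auto
  then have "(1 / 2) ^ L \<le> sine_product_integral L" by (simp add: sine_product_integral_eq)
  then have "2 ^ L * (1 / 2) ^ L \<le> tm_norm1 L" unfolding tm_norm1_eq by (intro mult_left_mono) auto
  then show ?thesis by (simp flip: power_mult_distrib)
qed

lemma tm_norm1_le: "tm_norm1 L \<le> 2 ^ L"
proof -
  have "integral {0..1} (tm_amp L) \<le> integral {0..1} (\<lambda>x::real. 2 ^ L)"
    by (intro integral_le tm_amp_le integrable_continuous_real continuous_intros continuous_on_tm_amp[of _ "\<lambda>x. x"])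
  then show ?thesis by (simp add: tm_norm1_alt)
qed

(* A continuous substitute for the indicator of the level set tm_amp L x >= T. *)
definition level_cutoff :: "nat \<Rightarrow> real \<Rightarrow> real \<Rightarrow> real" where
  "level_cutoff L T x = min 1 (max 0 (2 * tm_amp L x / T - 1))"

lemma level_cutoff_bounds: "0 \<le> level_cutoff L T x \<and> level_cutoff L T x \<le> 1"
  by (auto simp: level_cutoff_def)

lemma continuous_on_level_cutoff: "T > 0 \<Longrightarrow> continuous_on A (level_cutoff L T)"
  unfolding level_cutoff_def[abs_def] by (intro continuous_intros continuous_on_tm_amp[of _ "\<lambda>x. x"]) auto

lemma level_cutoff_add_1: "level_cutoff L T (x + 1) = level_cutoff L T x"
  by (simp add: level_cutoff_def tm_amp_def digit_poly_add_1)

lemma level_cutoff_lipschitz: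
  assumes "T \<ge> 1 / 2"
  shows "\<bar>level_cutoff L T x - level_cutoff L T y\<bar> \<le> 32 * 4 ^ L * \<bar>x - y\<bar>"
proof -
  have "\<bar>level_cutoff L T x - level_cutoff L T y\<bar> \<le> \<bar>(2 * tm_amp L x / T - 1) - (2 * tm_amp L y / T - 1)\<bar>"
    unfolding level_cutoff_def by linarith
  also have "(2 * tm_amp L x / T - 1) - (2 * tm_amp L y / T - 1) = (2 / T) * (tm_amp L x - tm_amp L y)"
    by (simp add: right_diff_distrib)
  also have "\<bar>\<dots>\<bar> = (2 / T) * \<bar>tm_amp L x - tm_amp L y\<bar>" unfolding abs_mult using assms by simp
  also have "\<dots> \<le> 4 * (8 * 4 ^ L * \<bar>x - y\<bar>)"
    using assms by (intro mult_mono tm_amp_lipschitz) (auto simp: divide_le_eq)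
  finally show ?thesis by simp
qed

lemma level_cutoff_pos: "T > 0 \<Longrightarrow> level_cutoff L T x > 0 \<Longrightarrow> tm_amp L x > T / 2"
  by (auto simp: level_cutoff_def min_def max_def field_simps split: if_splits)

lemma level_cutoff_eq_1: "T > 0 \<Longrightarrow> T \<le> tm_amp L x \<Longrightarrow> level_cutoff L T x = 1"
  by (auto simp: level_cutoff_def min_def max_def field_simps)

text \<open>Dyadic pigeonholing. Values below half the mean contribute at most half of the integral;
  the others lie in L + 2 dyadic ranges, since the mean is at least 1 and the maximum at most 2^L.
  Some range carries at least a 1/(L + 2) share of the other half.\<close>

lemma ex_good_level:
  "\<exists>T\<ge>1 / 2. T \<le> 4 ^ L \<and> T * integral {0..1} (level_cutoff L T) \<ge> tm_norm1 L / (4 * (real L + 2))"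
proof (rule ccontr)
  let ?q = "tm_norm1 L / (4 * (real L + 2))" and ?\<chi> = "level_cutoff L"
  define a where "a = tm_norm1 L / 2"
  have a: "a \<ge> 1 / 2" "a \<le> 2 ^ L / 2" using tm_norm1_ge_1[of L] tm_norm1_le[of L] by (auto simp: a_def)
  assume "\<not> ?thesis"
  then have neg: "T * integral {0..1} (?\<chi> T) < ?q" if "T \<ge> 1 / 2" "T \<le> 4 ^ L" for T
    using that by force
  define T where "T j = 2 ^ j * a" for j :: nat
  have T12: "T j \<ge> 1 / 2" for j
    using mult_mono[of 1 "2 ^ j" "1/2" a] a by (simp add: T_def)
  have T0: "T j > 0" for j using T12[of j] by linarith
  have T4: "T j \<le> 4 ^ L" if "j < L + 2" for j
  proof -
    have "T j \<le> 2 ^ (L + 1) * (2 ^ L / 2)"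
      unfolding T_def using a that by (intro mult_mono power_increasing) auto
    also have "\<dots> = (2 * 2) ^ L" by (simp only: power_mult_distrib) simp
    finally show ?thesis by simp
  qed
  \<comment> \<open>When \<open>tm_amp L x\<close> lies between 2^n a and 2^(n+1) a, the cutoff at
    level \<open>T n\<close> equals 1, and its single term 2 \<open>T n\<close> dominates.\<close>
  have pt: "tm_amp L x < 2 ^ n * a \<Longrightarrow> tm_amp L x \<le> a + (\<Sum>j<n. 2 * T j * ?\<chi> (T j) x)" for n x
  proof (induction n)
    case (Suc n)
    have nn: "0 \<le> (\<Sum>j<n. 2 * T j * ?\<chi> (T j) x)"
      using T0 level_cutoff_bounds by (intro sum_nonneg mult_nonneg_nonneg) (auto intro: less_imp_le)
    show ?case
    proof (cases "tm_amp L x < 2 ^ n * a")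
      case True
      have "0 \<le> 2 * T n * ?\<chi> (T n) x"
        using T0[of n] level_cutoff_bounds[of L "T n" x] by (intro mult_nonneg_nonneg) auto
      then show ?thesis using Suc.IH[OF True] by simp
    next
      case False
      then have "?\<chi> (T n) x = 1" by (intro level_cutoff_eq_1 T0) (simp add: T_def)
      then have "tm_amp L x \<le> 2 * T n * ?\<chi> (T n) x" using Suc.prems by (simp add: T_def)
      then show ?thesis using nn a by simp
    qed
  qed simp
  have big: "tm_amp L x < 2 ^ (L + 2) * a" for x
  proof -
    have "(2::real) ^ L * 2 \<le> 2 ^ (L + 2) * a" using a by (simp add: power_add)
    then show ?thesis using tm_amp_le[of L x] by (smt (verit) zero_less_power)
  qed
  have I: "((\<lambda>x. a + (\<Sum>j<L + 2. 2 * T j * ?\<chi> (T j) x)) has_integral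
      (1 - 0) *\<^sub>R a + (\<Sum>j<L + 2. 2 * T j * integral {0..1} (?\<chi> (T j)))) {0..1}"
    by (intro has_integral_add has_integral_sum has_integral_mult_right integrable_integral
        integrable_continuous_real continuous_on_level_cutoff T0) (use has_integral_const_real[of a 0 1] in auto)
  have "tm_norm1 L \<le> (1 - 0) *\<^sub>R a + (\<Sum>j<L + 2. 2 * T j * integral {0..1} (?\<chi> (T j)))"
    unfolding tm_norm1_alt integral_unique[OF I, symmetric]
    by (intro integral_le has_integral_integrable[OF I] pt big integrable_continuous_real continuous_on_tm_amp[of _ "\<lambda>x. x"] continuous_intros)
  also have "\<dots> < (1 - 0) *\<^sub>R a + (\<Sum>j<L + 2. 2 * (?q))"
  proof (intro add_strict_left_mono sum_strict_mono)
    fix j assume "j \<in> {..<L + 2}"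
    then have "T j * integral {0..1} (?\<chi> (T j)) < ?q"
      using neg[OF T12 T4] by simp
    then show "2 * T j * integral {0..1} (?\<chi> (T j)) < 2 * (?q)"
      by linarith
  qed auto
  also have "\<dots> = a + (real L + 2) * (2 * (?q))" by simp
  also have "\<dots> = tm_norm1 L" by (simp add: a_def field_simps)
  finally show False by simp
qed

section \<open>Large twisted sums at multiples of almost every point\<close>

text \<open>Controls the untwisted sum at all h simultaneously, since the h that makes the twisted
  sum large depends on x. The range 2^(5L) contains every h selected below.\<close>

definition dirichlet_sum :: "nat \<Rightarrow> real \<Rightarrow> real" where
  "dirichlet_sum L x = (\<Sum>h = 1..2 ^ (5 * L). norm (digit_poly 1 (2 ^ L) (real h * x)) / real h)"

lemma AE_dirichlet_sum_le:
  assumes "\<delta> > 0"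
  shows "AE x in lebesgue_on {0<..<1}. \<forall>\<^sub>F L in sequentially. dirichlet_sum L x \<le> 2 powr (\<delta> * real L)"
proof (rule AE_eventually_le_of_integral_le)
  have ci: "(\<lambda>x. norm (digit_poly e N (c * x))) integrable_on {0..1}" for e N c
    by (intro integrable_continuous_real continuous_intros)
  show "continuous_on {0..1} (dirichlet_sum L)" for L
    unfolding dirichlet_sum_def[abs_def] by (intro continuous_intros) auto
  show "0 \<le> dirichlet_sum L x" for L x unfolding dirichlet_sum_def by (intro sum_nonneg) auto
  show "2 powr (- \<delta>) < 1" using assms by (intro two_powr_less_1) simp
  fix L
  define J where "J = integral {0..1} (\<lambda>x. norm (digit_poly 1 (2 ^ L) x))"
  have J: "0 \<le> J" "J \<le> 4 * (real L + 1)"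
    using integral_norm_digit_poly_1_le ci[of 1 "2 ^ L" 1]
    by (auto simp: J_def intro!: Henstock_Kurzweil_Integration.integral_nonneg)
  have I: "((\<lambda>x. norm (digit_poly 1 (2 ^ L) (real h * x)) / real h) has_integral J / real h) {0..1}" if "h > 0" for h
    unfolding J_def integral_norm_digit_poly_scale[OF that, symmetric]
    by (intro has_integral_divide integrable_integral ci)
  have "integral {0..1} (dirichlet_sum L) = (\<Sum>h = 1..2 ^ (5 * L). J / real h)"
    unfolding dirichlet_sum_def[abs_def] by (intro integral_unique has_integral_sum I) auto
  also have "\<dots> = J * (\<Sum>h = 1..2 ^ (5 * L). 1 / real h)" by (simp add: sum_distrib_left)
  also have "\<dots> \<le> (4 * (real L + 1)) * (real (5 * L) + 1)"
    using J by (intro mult_mono sum_inverse_le) (auto intro!: sum_nonneg)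
  also have "\<dots> \<le> (4 * (real L + 1)) * (5 * (real L + 1))" by (intro mult_left_mono) auto
  also have "\<dots> \<le> (4 * (real L + 1)) * (5 * (real L + 1)) * (real L + 1)"
    using mult_left_mono[of 1 "real L + 1" "(4 * (real L + 1)) * (5 * (real L + 1))"] by simp
  also have "\<dots> = 20 * (real L + 1) ^ 3 * ((2 powr (- \<delta>)) ^ L * 2 powr (\<delta> * real L))"
    unfolding powr_mult_power[symmetric] powr_add[symmetric] by (simp add: power3_eq_cube algebra_simps)
  finally show "integral {0..1} (dirichlet_sum L) \<le> 20 * (real L + 1) ^ 3 * (2 powr (- \<delta>)) ^ L * 2 powr (\<delta> * real L)"
    by (simp only: mult.assoc)
qed auto

text \<open>The smoothed cutoff, summed over H multiples, has mean H \<mu>, about 2^(\<delta>L), and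
  relative variance at most D / (H \<mu>). The divisor bound makes D of order 2^(\<delta>L/2), so
  the relative variances are summable in L. At a hit, h <= 2 * 2^(\<delta>L) / \<mu> turns T / (2h)
  into at least T \<mu> / (4 * 2^(\<delta>L)), and the choice of the level supplies the remaining 1
  / (4 (L + 2)).\<close>

lemma AE_ex_large_tm_amp:
  assumes \<delta>: "0 < \<delta>" "\<delta> \<le> 1"
  shows "AE x in lebesgue_on {0<..<1}. \<forall>\<^sub>F L in sequentially.
    \<exists>h\<in>{1..2 ^ (5 * L)}. tm_amp L (real h * x) / real h \<ge> tm_norm1 L / (16 * (real L + 2)) * 2 powr (- \<delta> * real L)"
proof -
  have "\<forall>L. \<exists>T. T \<ge> 1 / 2 \<and> T \<le> 4 ^ L \<and> T * integral {0..1} (level_cutoff L T) \<ge> tm_norm1 L / (4 * (real L + 2))"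
    using ex_good_level by blast
  then obtain T where T: "\<And>L. T L \<ge> 1 / 2" "\<And>L. T L \<le> 4 ^ L"
      "\<And>L. T L * integral {0..1} (level_cutoff L (T L)) \<ge> tm_norm1 L / (4 * (real L + 2))"
    by metis
  have T0: "T L > 0" for L using T(1)[of L] by linarith
  define g where "g L = level_cutoff L (T L)" for L
  define \<mu> where "\<mu> L = integral {0..1} (g L)" for L
  define H where "H L = nat \<lceil>2 powr (\<delta> * real L) / \<mu> L\<rceil>" for L
  \<comment> \<open>With \<eta> = 2^(-5L) below, M \<eta>^2 = 2^(3L) and the Lipschitz term is 32 *
    2^(-3L). The smoothing error 33 * 2^(-3L) is below \<mu>/2 for large L, because \<mu> >= 4^(-L)
    / (4 (L + 2)).\<close>
  define M :: "nat \<Rightarrow> nat" where "M L = 2 ^ (13 * L)" for L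
  have g01: "0 \<le> g L x \<and> g L x \<le> 1" for L x unfolding g_def by (rule level_cutoff_bounds)
  have gc: "continuous_on A (g L)" for A L unfolding g_def by (intro continuous_on_level_cutoff T0)
  have M0: "M L > 0" for L by (simp add: M_def)
  have \<mu>_ge: "\<mu> L \<ge> 1 / (4 * (real L + 2) * 4 ^ L)" for L
  proof -
    have "1 / (4 * (real L + 2)) \<le> tm_norm1 L / (4 * (real L + 2))"
      using tm_norm1_ge_1[of L] by (intro divide_right_mono) auto
    also have "\<dots> \<le> T L * \<mu> L" unfolding \<mu>_def g_def by (rule T)
    finally have 1: "1 / (4 * (real L + 2)) \<le> T L * \<mu> L" .
    then have "T L * \<mu> L > 0" by (rule less_le_trans[rotated]) simp
    then have "\<mu> L > 0" using T0[of L] by (simp add: zero_less_mult_iff)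
    then have "T L * \<mu> L \<le> 4 ^ L * \<mu> L" using T(2)[of L] by (intro mult_right_mono) auto
    then have "1 / (4 * (real L + 2)) / 4 ^ L \<le> 4 ^ L * \<mu> L / 4 ^ L" using 1 by (intro divide_right_mono) auto
    then show ?thesis by simp
  qed
  have \<mu>0: "\<mu> L > 0" for L by (rule less_le_trans[OF _ \<mu>_ge]) simp
  have \<mu>1: "\<mu> L \<le> 1" for L
  proof -
    have "\<mu> L \<le> integral {0..1} (\<lambda>x::real. 1)"
      unfolding \<mu>_def using g01 by (intro integral_le integrable_continuous_real gc) auto
    then show ?thesis by simp
  qed
  have E1: "2 powr (\<delta> * real L) \<ge> 1" for L using \<delta> by (intro ge_one_powr_ge_zero) auto
  have q1: "2 powr (\<delta> * real L) / \<mu> L \<ge> 1" for L using E1[of L] \<mu>0[of L] \<mu>1[of L] by (simp add: le_divide_eq)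
  have H_ge: "real (H L) \<ge> 2 powr (\<delta> * real L) / \<mu> L" for L unfolding H_def by linarith
  have H_le: "real (H L) \<le> 2 * 2 powr (\<delta> * real L) / \<mu> L" for L
    using q1[of L] unfolding H_def by linarith
  have H0: "H L > 0" for L using H_ge[of L] q1[of L] by (cases "H L") auto
  have H\<mu>: "real (H L) * \<mu> L \<ge> 2 powr (\<delta> * real L)" for L using H_ge[of L] \<mu>0[of L] by (simp add: field_simps)
  \<comment> \<open>The exponent 4L collects 2^L from 2^(\<delta>L), 4^L from the levels in 1/\<mu>
    and 2^L from L + 2.\<close>
  have Hbound: "real (H L) \<le> 16 * 2 ^ (4 * L)" for L
  proof -
    have "2 powr (\<delta> * real L) \<le> 2 powr (1 * real L)" using \<delta> by (intro powr_mono mult_right_mono) auto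
    then have e: "2 powr (\<delta> * real L) \<le> 2 ^ L" by (simp add: powr_realpow)
    have "1 / \<mu> L \<le> 1 / (1 / (4 * (real L + 2) * 4 ^ L))"
      using \<mu>0[of L] by (intro divide_left_mono \<mu>_ge mult_pos_pos) auto
    then have \<mu>_inv: "1 / \<mu> L \<le> 4 * (real L + 2) * 4 ^ L" by simp
    have "real (H L) \<le> 2 * (2 powr (\<delta> * real L) * (1 / \<mu> L))" using H_le[of L] by simp
    also have "\<dots> \<le> 2 * (2 ^ L * (4 * (real L + 2) * 4 ^ L))"
      using e \<mu>_inv \<mu>0[of L] by (intro mult_left_mono mult_mono) auto
    also have "\<dots> \<le> 2 * (2 ^ L * (4 * (2 * 2 ^ L) * 4 ^ L))"
    proof -
      have "L + 1 \<le> 2 ^ L" using less_exp[of L] by (simp add: Suc_le_eq)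
      then have "real (L + 1) \<le> real (2 ^ L)" by (simp only: of_nat_le_iff)
      then have "real L + 2 \<le> 2 * 2 ^ L" by simp
      then show ?thesis by (intro mult_left_mono mult_right_mono) auto
    qed
    also have "\<dots> = 16 * 2 ^ (4 * L)"
    proof -
      have "(2::real) ^ (4 * L) = (2 * 2 * 4) ^ L" by (simp add: power_mult)
      then show ?thesis by (simp only: power_mult_distrib)
    qed
    finally show ?thesis .
  qed
  define \<sigma> where "\<sigma> L = fejer_mean (M L) (g L)" for L
  define V where "V L x = ((\<Sum>h = 1..H L. \<sigma> L (real h * x)) - real (H L) * \<mu> L)\<^sup>2" for L x
  \<comment> \<open>Chosen because H M <= 16 * 2^(17L) and 17 \<gamma> = \<delta>/2.\<close>
  define \<gamma> where "\<gamma> = \<delta> / 34"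
  obtain C where C: "C > 0" "\<And>n. n > 0 \<Longrightarrow> real (card {d. d dvd n}) \<le> C * real n powr \<gamma>"
    using card_divisors_le[of \<gamma>] \<delta> by (auto simp: \<gamma>_def)
  define D where "D L = C * 16 powr \<gamma> * 2 powr (\<delta> / 2 * real L)" for L
  have D0: "D L \<ge> 0" for L using C by (simp add: D_def)
  have D: "real (card {d. d dvd n}) \<le> D L" if "0 < n" "n \<le> H L * M L" for n L
  proof -
    have "real n \<le> real (H L * M L)" using that by (simp only: of_nat_le_iff)
    also have "\<dots> \<le> (16 * 2 ^ (4 * L)) * 2 ^ (13 * L)"
      using Hbound[of L] by (simp add: M_def)
    also have "\<dots> = 16 * 2 ^ (17 * L)" by (simp flip: power_add)
    also have "\<dots> = 16 * 2 powr (17 * real L)" using powr_realpow[of 2 "17 * L"] by simp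
    finally have "real n powr \<gamma> \<le> (16 * 2 powr (17 * real L)) powr \<gamma>"
      using \<delta> by (intro powr_mono2) (auto simp: \<gamma>_def)
    also have "\<dots> = 16 powr \<gamma> * 2 powr (\<delta> / 2 * real L)"
      by (simp add: powr_mult powr_powr \<gamma>_def)
    finally have "C * real n powr \<gamma> \<le> D L" unfolding D_def mult.assoc using C by (intro mult_left_mono) auto
    then show ?thesis using C(2)[OF that(1)] by linarith
  qed
  have \<sigma>c: "continuous_on A (\<sigma> L)" for A L
    unfolding \<sigma>_def by (rule fejer_mean_variance(1)[OF gc g01 M0 D D0])
  have V_le: "integral {0..1} (V L) \<le> real (H L) * D L * \<mu> L" for L
    unfolding V_def[abs_def] \<sigma>_def \<mu>_def by (rule fejer_mean_variance(2)[OF gc g01 M0 D D0])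
  \<comment> \<open>A deviation of at most a quarter of the mean leaves some h with smoothed value
    at least 3/4 \<mu>, of which the smoothing error takes at most \<mu>/2.\<close>
  define w where "w L = (real (H L) * \<mu> L / 4)\<^sup>2" for L
  have AE_V: "AE x in lebesgue_on {0<..<1}. \<forall>\<^sub>F L in sequentially. V L x \<le> w L"
  proof (rule AE_eventually_le_of_integral_le)
    show "continuous_on {0..1} (V L)" for L
      unfolding V_def[abs_def] by (intro continuous_intros continuous_on_compose2[OF \<sigma>c[of UNIV]]) auto
    show "w L > 0" for L using H0 \<mu>0[of L] by (simp add: w_def)
    show "2 powr (- \<delta> / 2) < 1" using \<delta> by (intro two_powr_less_1) simp
    fix L
    define K where "K = 16 * (C * 16 powr \<gamma>)"
    have K: "K \<ge> 0" using C by (simp add: K_def)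
    have p0: "real (H L) * \<mu> L > 0" using H0 \<mu>0[of L] by simp
    have "integral {0..1} (V L) \<le> real (H L) * D L * \<mu> L" by (rule V_le)
    also have "\<dots> = K * (2 powr (\<delta> / 2 * real L) / (real (H L) * \<mu> L)) * w L"
      using p0 by (simp add: w_def D_def K_def power2_eq_square)
    also have "\<dots> \<le> K * (2 powr (\<delta> / 2 * real L) / 2 powr (\<delta> * real L)) * w L"
      using p0 H\<mu>[of L] K H0[of L] \<mu>0[of L] by (intro mult_right_mono mult_left_mono divide_left_mono mult_pos_pos) (auto simp: w_def)
    also have "2 powr (\<delta> / 2 * real L) / 2 powr (\<delta> * real L) = (2 powr (- \<delta> / 2)) ^ L"
      unfolding powr_mult_power[symmetric] powr_diff[symmetric] by simp
    also have "K * (2 powr (- \<delta> / 2)) ^ L * w L \<le> K * (real L + 1) ^ 3 * (2 powr (- \<delta> / 2)) ^ L * w L"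
    proof (intro mult_right_mono)
      show "K \<le> K * (real L + 1) ^ 3" using mult_left_mono[of 1 "(real L + 1) ^ 3" K] K by (simp add: one_le_power)
    qed (auto simp: w_def)
    finally show "integral {0..1} (V L) \<le> K * (real L + 1) ^ 3 * (2 powr (- \<delta> / 2)) ^ L * w L" .
  qed (auto simp: V_def)
  have "\<forall>\<^sub>F L::nat in sequentially. 264 * (real L + 2) \<le> 2 ^ L" by real_asymp
  moreover have "\<forall>\<^sub>F L::nat in sequentially. L \<ge> 4" by (rule eventually_ge_at_top)
  ultimately have ev: "\<forall>\<^sub>F L::nat in sequentially. 264 * (real L + 2) \<le> 2 ^ L \<and> L \<ge> 4" by eventually_elim simp
  show ?thesis
  proof (rule AE_mp[OF AE_V AE_I2], intro impI)
    fix x assume "\<forall>\<^sub>F L in sequentially. V L x \<le> w L"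
    with ev show "\<forall>\<^sub>F L in sequentially. \<exists>h\<in>{1..2 ^ (5 * L)}. tm_amp L (real h * x) / real h
        \<ge> tm_norm1 L / (16 * (real L + 2)) * 2 powr (- \<delta> * real L)"
    proof eventually_elim
      case (elim L)
      let ?S = "\<Sum>h = 1..H L. \<sigma> L (real h * x)"
      have p0: "real (H L) * \<mu> L > 0" using H0 \<mu>0[of L] by simp
      have "\<bar>?S - real (H L) * \<mu> L\<bar> \<le> real (H L) * \<mu> L / 4"
        using elim(2) p0 unfolding V_def w_def by (simp add: abs_le_square_iff[symmetric])
      then have s: "?S \<ge> 3 / 4 * (real (H L) * \<mu> L)" by linarith
      obtain h where h: "h \<in> {1..H L}" "\<sigma> L (real h * x) \<ge> 3 / 4 * \<mu> L"
      proof (rule ccontr)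
        assume "\<not> thesis"
        then have "\<And>h. h \<in> {1..H L} \<Longrightarrow> \<sigma> L (real h * x) < 3 / 4 * \<mu> L" using that by force
        then have "?S < (\<Sum>h = 1..H L. 3 / 4 * \<mu> L)"
          using H0[of L] by (intro sum_strict_mono) auto
        then show False using s by simp
      qed
      define \<eta> :: real where "\<eta> = 1 / 2 ^ (5 * L)"
      have "\<bar>\<sigma> L (real h * x) - g L (real h * x)\<bar> \<le> 32 * 4 ^ L * \<eta> + 1 / (real (M L) * \<eta>\<^sup>2)"
        unfolding \<sigma>_def
      proof (rule fejer_mean_approx[OF gc _ g01 _ M0])
        show "g L (y + 1) = g L y" for y unfolding g_def by (rule level_cutoff_add_1)
        show "\<bar>g L y - g L z\<bar> \<le> 32 * 4 ^ L * \<bar>y - z\<bar>" for y z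
          unfolding g_def by (rule level_cutoff_lipschitz[OF T(1)])
        have "(2::real) ^ 1 \<le> 2 ^ (5 * L)" using elim by (intro power_increasing) auto
        then show "\<eta> \<le> 1 / 2" by (simp add: \<eta>_def field_simps)
      qed (auto simp: \<eta>_def)
      also have "32 * 4 ^ L * \<eta> + 1 / (real (M L) * \<eta>\<^sup>2) = 33 / 2 ^ (3 * L)"
      proof -
        have a: "(4::real) ^ L = 2 ^ (2 * L)" by (simp add: power_mult)
        have b: "(2::real) ^ (5 * L) = 2 ^ (2 * L) * 2 ^ (3 * L)" by (simp flip: power_add)
        have c: "(2::real) ^ (13 * L) = (2 ^ (5 * L))\<^sup>2 * 2 ^ (3 * L)"
          by (simp add: power_add[symmetric] power_mult[symmetric])
        have "32 * 4 ^ L * \<eta> = 32 / 2 ^ (3 * L)" unfolding \<eta>_def a b by simp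
        moreover have "1 / (real (M L) * \<eta>\<^sup>2) = 1 / 2 ^ (3 * L)"
          unfolding \<eta>_def M_def of_nat_power of_nat_numeral c by (simp add: power_divide)
        ultimately show ?thesis by simp
      qed
      also have "\<dots> \<le> \<mu> L / 2"
      proof -
        have "33 * (8 * (real L + 2) * 4 ^ L) \<le> 2 ^ L * 4 ^ L" using elim by simp
        also have "\<dots> = 2 ^ (3 * L)" by (simp add: power_mult flip: power_mult_distrib)
        finally have "33 / 2 ^ (3 * L) \<le> 1 / (8 * (real L + 2) * 4 ^ L)"
          by (simp add: divide_le_eq le_divide_eq mult_ac)
        also have "\<dots> = 1 / (4 * (real L + 2) * 4 ^ L) / 2" by simp
        also have "\<dots> \<le> \<mu> L / 2" by (intro divide_right_mono \<mu>_ge) auto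
        finally show ?thesis .
      qed
      \<comment> \<open>Mere positivity suffices, as the cutoff vanishes wherever
        \<open>tm_amp\<close> is at most T/2.\<close>
      finally have "g L (real h * x) > 0" using h(2) \<mu>0[of L] by linarith
      then have amp: "tm_amp L (real h * x) > T L / 2"
        unfolding g_def by (intro level_cutoff_pos T0)
      have "real (H L) \<le> 2 ^ (5 * L)"
      proof -
        have "(2::real) ^ 4 \<le> 2 ^ L" using elim by (intro power_increasing) auto
        then have "16 * 2 ^ (4 * L) \<le> (2::real) ^ L * 2 ^ (4 * L)" by simp
        also have "\<dots> = 2 ^ (5 * L)" by (simp flip: power_add)
        finally show ?thesis using Hbound[of L] by linarith
      qed
      then have "real (H L) \<le> real (2 ^ (5 * L))" by simp
      then have "H L \<le> 2 ^ (5 * L)" by (simp only: of_nat_le_iff)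
      then have h5: "h \<in> {1..2 ^ (5 * L)}" using h by auto
      have h0: "real h > 0" "real h \<le> real (H L)" using h by auto
      have "tm_norm1 L / (16 * (real L + 2)) * 2 powr (- \<delta> * real L)
          = tm_norm1 L / (4 * (real L + 2)) / (4 * 2 powr (\<delta> * real L))"
        by (simp add: powr_minus field_simps)
      also have "\<dots> \<le> T L * \<mu> L / (4 * 2 powr (\<delta> * real L))"
        unfolding \<mu>_def g_def by (intro divide_right_mono T) auto
      also have "\<dots> = (T L / 2) / (2 * 2 powr (\<delta> * real L) / \<mu> L)" by simp
      also have "\<dots> \<le> (T L / 2) / real h"
        using h0 H_le[of L] T0[of L] \<mu>0[of L] by (intro divide_left_mono mult_pos_pos divide_pos_pos) auto
      also have "\<dots> \<le> tm_amp L (real h * x) / real h" using amp h0 by (intro divide_right_mono) auto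
      finally show ?case using h5 by blast
    qed
  qed
qed

text \<open>Koksma's inequality at frequency h, with the Dirichlet part moved to the other side and
  4 pi bounded by 16. The first 2^L Thue-Morse integers are those below 2^(L+1), hence
  \<open>Suc L\<close>.\<close>

lemma tm_discrepancy_ge:
  assumes "h > 0"
  shows "tm_discrepancy x (2 ^ L) \<ge> (tm_amp (Suc L) (real h * x) / real h
      - norm (digit_poly 1 (2 ^ Suc L) (real h * x)) / real h) / 16"
proof -
  let ?F = "tm_amp (Suc L) (real h * x)" and ?P = "digit_poly 1 (2 ^ Suc L) (real h * x)"
  let ?S = "\<Sum>k = 1..2 ^ L. unit_exp (real h * frac (real (thue_morse_int k) * x))"
  have S: "2 * ?S = ?P + digit_poly (-1) (2 ^ Suc L) (real h * x)"
    using sum_thue_morse_frac[of h x "2 ^ L"] by simp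
  have "?F = norm (2 * ?S - ?P)"
    unfolding S tm_amp_def by simp
  also have "\<dots> \<le> norm (2 * ?S) + norm (?P)"
    by (rule norm_triangle_ineq4)
  also have "norm (2 * ?S) = 2 * norm ?S" by (simp add: norm_mult)
  also have "norm ?S \<le> 2 * pi * real h * tm_discrepancy x (2 ^ L)"
    by (rule koksma_unit_exp) (use assms frac_lt_1 in \<open>auto intro: less_imp_le\<close>)
  finally have 1: "?F - norm (?P)
      \<le> 4 * pi * real h * tm_discrepancy x (2 ^ L)" by simp
  have "tm_discrepancy x (2 ^ L) \<ge> 0"
    by (rule order.trans[OF abs_ge_zero star_discrepancy_ge[of 0]]) auto
  then have "4 * pi * real h * tm_discrepancy x (2 ^ L) \<le> 16 * real h * tm_discrepancy x (2 ^ L)"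
    using pi_less_4 by (intro mult_right_mono) auto
  then have "?F - norm (?P)
      \<le> 16 * real h * tm_discrepancy x (2 ^ L)" using 1 by linarith
  then have "(?F - norm (?P)) / real h
      \<le> 16 * real h * tm_discrepancy x (2 ^ L) / real h" by (intro divide_right_mono) auto
  then show ?thesis using assms by (simp add: diff_divide_distrib)
qed

lemma linear_geometric_tendsto_0:
  assumes "0 < r" "r < (1::real)"
  shows "(\<lambda>n. (real n + 2) * r ^ n) \<longlonglongrightarrow> 0"
proof (rule tendsto_sandwich[OF _ _ tendsto_const])
  have "(\<lambda>n. (real n + 1) ^ 3 * r ^ n) \<longlonglongrightarrow> 0" by (rule summable_LIMSEQ_zero[OF summable_cubic_geometric[OF assms]])
  from tendsto_mult_right_zero[OF this, of 2] show "(\<lambda>n. 2 * ((real n + 1) ^ 3 * r ^ n)) \<longlonglongrightarrow> 0" .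
  show "\<forall>\<^sub>F n in sequentially. (real n + 2) * r ^ n \<le> 2 * ((real n + 1) ^ 3 * r ^ n)"
  proof (rule always_eventually, rule allI)
    fix n
    have "real n + 1 \<le> (real n + 1) ^ 3" by (rule self_le_power) auto
    then have "real n + 2 \<le> 2 * (real n + 1) ^ 3" by simp
    then have "(real n + 2) * r ^ n \<le> (2 * (real n + 1) ^ 3) * r ^ n" using assms by (intro mult_right_mono) auto
    then show "(real n + 2) * r ^ n \<le> 2 * ((real n + 1) ^ 3 * r ^ n)" by simp
  qed
qed (use assms in auto)

text \<open>The main term, of order 2^((\<beta> - \<delta>) L) / (L + 2), has to beat both the
  untwisted term 2^(\<delta>L) and the target. The former is possible because the exponent \<beta>
  is positive. The estimate holds for all large powers of 2, not just for a sparse subsequence of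
  them.\<close>

theorem AE_tm_discrepancy_lower:
  assumes \<epsilon>: "\<epsilon> > 0"
  shows "AE x in lebesgue_on {0<..<1}. \<exists>\<^sub>\<infinity>N. tm_discrepancy x N \<ge> real N powr (tm_exponent - \<epsilon>)"
proof -
  define \<beta> where "\<beta> = tm_exponent"
  have \<beta>: "\<beta> > 0" unfolding \<beta>_def by (rule tm_exponent_pos)
  \<comment> \<open>The bound \<beta>/4 gives r1 < 1, so the untwisted term is negligible;
    \<epsilon>/4 gives r2 < 1, so the target is reached with room for L + 2 and constants; 1 is the
    range in which large multiples were found.\<close>
  define \<delta> where "\<delta> = min (min (\<epsilon> / 4) (\<beta> / 4)) 1"
  have \<delta>: "0 < \<delta>" "\<delta> \<le> 1" "\<delta> \<le> \<epsilon> / 4" "\<delta> \<le> \<beta> / 4" using \<epsilon> \<beta> by (auto simp: \<delta>_def)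
  obtain c where c: "c > 0" "\<And>L. c * 2 powr (\<beta> * real L) \<le> tm_norm1 L"
    using tm_norm1_bounds unfolding \<beta>_def by blast
  \<comment> \<open>Accounts for N = 2^(L-1): its power with exponent \<beta> - \<epsilon> is K
    times that of 2^L.\<close>
  define K where "K = 2 powr (- (\<beta> - \<epsilon>))"
  have K: "K > 0" by (simp add: K_def)
  define r1 where "r1 = 2 powr (2 * \<delta> - \<beta>)"
  define r2 where "r2 = 2 powr (\<delta> - \<epsilon>)"
  have r: "0 < r1" "r1 < 1" "0 < r2" "r2 < 1"
    unfolding r1_def r2_def using \<delta> \<epsilon> \<beta> by (auto intro!: two_powr_less_1)
  have "\<forall>\<^sub>F L in sequentially. (real L + 2) * r1 ^ L < c / 32"
    by (rule order_tendstoD(2)[OF linear_geometric_tendsto_0]) (use r c in auto)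
  moreover have "\<forall>\<^sub>F L in sequentially. (real L + 2) * r2 ^ L < c / (32 * (16 * K))"
    by (rule order_tendstoD(2)[OF linear_geometric_tendsto_0]) (use r c K in auto)
  moreover have "\<forall>\<^sub>F L::nat in sequentially. L \<ge> 1" by (rule eventually_ge_at_top)
  ultimately have ev: "\<forall>\<^sub>F L::nat in sequentially. (real L + 2) * r1 ^ L < c / 32 \<and>
      (real L + 2) * r2 ^ L < c / (32 * (16 * K)) \<and> L \<ge> 1" by eventually_elim simp
  show ?thesis
  proof (rule AE_mp[OF AE_conjI[OF AE_ex_large_tm_amp[OF \<delta>(1,2)] AE_dirichlet_sum_le[OF \<delta>(1)]] AE_I2], intro impI)
    fix x
    assume "(\<forall>\<^sub>F L in sequentially. \<exists>h\<in>{1..2 ^ (5 * L)}. tm_amp L (real h * x) / real h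
        \<ge> tm_norm1 L / (16 * (real L + 2)) * 2 powr (- \<delta> * real L))
      \<and> (\<forall>\<^sub>F L in sequentially. dirichlet_sum L x \<le> 2 powr (\<delta> * real L))"
    then have "\<forall>\<^sub>F L in sequentially. (\<exists>h\<in>{1..2 ^ (5 * L)}. tm_amp L (real h * x) / real h
        \<ge> tm_norm1 L / (16 * (real L + 2)) * 2 powr (- \<delta> * real L))
      \<and> dirichlet_sum L x \<le> 2 powr (\<delta> * real L)" by (simp add: eventually_conj_iff)
    with ev have "\<forall>\<^sub>F L in sequentially. L \<ge> 1 \<and> tm_discrepancy x (2 ^ (L - 1)) \<ge> real (2 ^ (L - 1)) powr (\<beta> - \<epsilon>)"
    proof eventually_elim
      case (elim L)
      let ?P = "\<lambda>h. norm (digit_poly 1 (2 ^ L) (real h * x)) / real h"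
      obtain h where h: "h \<in> {1..2 ^ (5 * L)}" "tm_amp L (real h * x) / real h
          \<ge> tm_norm1 L / (16 * (real L + 2)) * 2 powr (- \<delta> * real L)" using elim by blast
      have L: "Suc (L - 1) = L" using elim by simp
      have "?P h \<le> dirichlet_sum L x"
        unfolding dirichlet_sum_def
        by (rule member_le_sum[of h _ ?P]) (use h in auto)
      also have "\<dots> \<le> 2 powr (\<delta> * real L)" using elim by blast
      finally have d: "?P h \<le> 2 powr (\<delta> * real L)" .
      define E where "E = 2 powr ((\<beta> - \<delta>) * real L) / (real L + 2)"
      have E0: "E > 0" by (simp add: E_def)
      have a: "tm_amp L (real h * x) / real h \<ge> c / 16 * E"
      proof -
        have "c / 16 * E = (c * 2 powr (\<beta> * real L)) / (16 * (real L + 2)) * 2 powr (- \<delta> * real L)"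
          unfolding E_def by (simp add: powr_add[symmetric] left_diff_distrib)
        also have "\<dots> \<le> tm_norm1 L / (16 * (real L + 2)) * 2 powr (- \<delta> * real L)"
          using c(2)[of L] by (intro mult_right_mono divide_right_mono) auto
        finally show ?thesis using h(2) by linarith
      qed
      have 1: "2 powr (\<delta> * real L) \<le> c / 32 * E"
      proof -
        have "2 powr (\<delta> * real L) = r1 ^ L * 2 powr ((\<beta> - \<delta>) * real L)"
          unfolding r1_def powr_mult_power[symmetric] powr_add[symmetric] by (simp add: algebra_simps)
        also have "\<dots> = (real L + 2) * r1 ^ L * E" by (simp add: E_def)
        also have "\<dots> \<le> c / 32 * E" using elim E0 by (intro mult_right_mono) auto
        finally show ?thesis .
      qed
      have 2: "real (2 ^ (L - 1)) powr (\<beta> - \<epsilon>) \<le> c / 32 * E / 16"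
      proof -
        have "real (2 ^ (L - 1)) = 2 powr (real L - 1)"
          using elim by (simp add: powr_realpow[symmetric] of_nat_diff)
        then have "real (2 ^ (L - 1)) powr (\<beta> - \<epsilon>) = 2 powr ((real L - 1) * (\<beta> - \<epsilon>))"
          by (simp only: powr_powr)
        also have "\<dots> = K * (r2 ^ L * 2 powr ((\<beta> - \<delta>) * real L))"
          unfolding r2_def K_def powr_mult_power[symmetric] powr_add[symmetric] by (simp add: algebra_simps)
        also have "\<dots> = K * ((real L + 2) * r2 ^ L * E)" by (simp add: E_def)
        also have "\<dots> \<le> K * (c / (32 * (16 * K)) * E)"
          using elim E0 K by (intro mult_left_mono mult_right_mono) auto
        also have "\<dots> = c / 32 * E / 16" using K by simp
        finally show ?thesis .
      qed
      have "tm_discrepancy x (2 ^ (L - 1)) \<ge> (tm_amp L (real h * x) / real h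
          - ?P h) / 16"
        using tm_discrepancy_ge[of h "L - 1" x] h unfolding L by simp
      moreover have "(tm_amp L (real h * x) / real h - ?P h) / 16
          \<ge> c / 32 * E / 16"
      proof (rule divide_right_mono)
        \<comment> \<open>One half pays for the untwisted term, the other half remains as the lower
          bound.\<close>
        have "c / 16 * E = c / 32 * E + c / 32 * E" by simp
        then show "c / 32 * E \<le> tm_amp L (real h * x) / real h - ?P h"
          using a d 1 by linarith
      qed simp
      ultimately show ?case using 2 elim by linarith
    qed
    then obtain L0 where L0: "\<And>L. L \<ge> L0 \<Longrightarrow> L \<ge> 1 \<and> tm_discrepancy x (2 ^ (L - 1)) \<ge> real (2 ^ (L - 1)) powr (\<beta> - \<epsilon>)"
      by (auto simp: eventually_sequentially)
    show "\<exists>\<^sub>\<infinity>N. tm_discrepancy x N \<ge> real N powr (tm_exponent - \<epsilon>)"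
      unfolding INFM_nat_le
    proof
      fix m
      define L where "L = max L0 (m + 1)"
      have "m \<le> 2 ^ m" using less_exp[of m] by simp
      also have "(2::nat) ^ m \<le> 2 ^ (L - 1)" by (intro power_increasing) (auto simp: L_def)
      finally have "m \<le> 2 ^ (L - 1)" .
      moreover have "tm_discrepancy x (2 ^ (L - 1)) \<ge> real (2 ^ (L - 1)) powr (\<beta> - \<epsilon>)"
        using L0[of L] by (simp add: L_def)
      ultimately show "\<exists>N\<ge>m. tm_discrepancy x N \<ge> real N powr (tm_exponent - \<epsilon>)"
        unfolding \<beta>_def by blast
    qed
  qed
qed

theorem theorem3:
  fixes \<epsilon> :: real
  assumes "\<epsilon> > 0"
  shows "AE \<alpha> in lebesgue_on {0<..<1}.
    (\<lambda>N. real N * star_discrepancy (\<lambda>k. frac (real (thue_morse_int k) * \<alpha>)) N)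
       \<in> O(\<lambda>N. real N powr (1 + ln fouvry_mauduit_const / ln 2 + \<epsilon>)) \<and>
    (\<exists>\<^sub>\<infinity>N. real N * star_discrepancy (\<lambda>k. frac (real (thue_morse_int k) * \<alpha>)) N
       \<ge> real N powr (1 + ln fouvry_mauduit_const / ln 2 - \<epsilon>))"
  using AE_conjI[OF AE_tm_discrepancy_upper[OF assms] AE_tm_discrepancy_lower[OF assms]]
  unfolding tm_exponent_def by simp

end
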